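(* Let $n\ge3$ and let $C_1,\ldots,C_{n-2}$ be arbitrary convex bodies in $\mathbb{R}^n$ with $S_{B,\mathcal{C}}\ne0$, and let $\mathscr{A}$, $\mathcal{E}$ be the operator and closed form on $L^2(S_{B,\mathcal{C}})$ described in the context. Then there exists a measurable function $A:S^{n-1}\to\mathrm{Sym}_n(\mathbb{R})$ with $A(x)x=0$, $A(x)\ge0$ and $\mathrm{Tr}[A(x)]=1$ for all $x\in S^{n-1}$ such that $$\mathscr{A}f=\frac1n\mathrm{Tr}[A\,D^2f],\qquad \mathcal{E}(f,g)=\frac1n\int\{fg-\langle\nabla_{S^{n-1}}f,A\,\nabla_{S^{n-1}}g\rangle\}\,dS_{B,\mathcal{C}}$$ for all $f,g\in C^2(S^{n-1})$, where $\nabla_{S^{n-1}}$ is the covariant derivative on $S^{n-1}$.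
   Context: Mixed area measures are the symmetric multilinear coefficients in the polynomial expansion of the surface area measure; $B$ is the unit ball; $S_{B,\mathcal{C}}=S_{B,C_1,\ldots,C_{n-2}}$. For $f\in C^2(S^{n-1})$ write $f=h_K-h_{K'}$ (difference of support functions) and $S_{f,\mathcal{C}}:=S_{K,\mathcal{C}}-S_{K',\mathcal{C}}$; it is absolutely continuous w.r.t. $S_{B,\mathcal{C}}$ with bounded density. $\mathscr{A}$ is the Friedrichs extension (self-adjoint operator associated to the closure of the upper-semibounded symmetric form $\langle f,\mathscr{A}_0g\rangle_{L^2(S_{B,\mathcal{C}})}$) of $\mathscr{A}_0f:=\frac1n\frac{dS_{f,\mathcal{C}}}{dS_{B,\mathcal{C}}}$, $f\in C^2(S^{n-1})$, and $\mathcal{E}$ is the associated closed quadratic form. $D^2f(x)$ is the Hessian at $x$ of the $1$-homogeneous extension of $f$, viewed on $x^\perp$ (so $D^2f=\nabla^2_{S^{n-1}}f+fI$); $A(x)$ is likewise viewed as acting on $x^\perp$. *)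

theory Defs
  imports "HOL-Analysis.Analysis" "HOL-Library.Set_Algebras"
begin

definition convex_body :: "'a::euclidean_space set \<Rightarrow> bool" where
  "convex_body K \<longleftrightarrow> K \<noteq> {} \<and> compact K \<and> convex K"

definition support_fun :: "'a::euclidean_space set \<Rightarrow> 'a \<Rightarrow> real" where
  "support_fun K u = Sup ((\<lambda>x. x \<bullet> u) ` K)"

text \<open>Mixed volume V(K_1,...,K_m) (m = dimension), defined by the standard
  polarization (inclusion-exclusion) formula for the volume polynomial
  of Minkowski sums.\<close>
definition mixed_volume :: "'a::euclidean_space set list \<Rightarrow> real" where
  "mixed_volume Ks =
     (\<Sum>J\<in>Pow {..<length Ks}.
        (-1) ^ (length Ks - card J) * measure lebesgue (\<Sum>j\<in>J. Ks ! j)) / fact (length Ks)"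

definition is_mixed_area_measure :: "'a::euclidean_space set list \<Rightarrow> 'a measure \<Rightarrow> bool" where
  "is_mixed_area_measure Ks \<mu> \<longleftrightarrow>
     space \<mu> = sphere 0 1 \<and> sets \<mu> = sets (restrict_space borel (sphere (0::'a) 1)) \<and>
     finite_measure \<mu> \<and>
     (\<forall>L. convex_body L \<longrightarrow> integrable \<mu> (support_fun L) \<and>
        (\<integral>u. support_fun L u \<partial>\<mu>) = real DIM('a) * mixed_volume (L # Ks))"

definition mixed_area_measure :: "'a::euclidean_space set list \<Rightarrow> 'a measure" where
  "mixed_area_measure Ks = (THE \<mu>. is_mixed_area_measure Ks \<mu>)"

definition hom_ext :: "(real^'n \<Rightarrow> real) \<Rightarrow> real^'n \<Rightarrow> real" where
  "hom_ext f y = norm y * f (y /\<^sub>R norm y)"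

definition grad :: "(real^'n \<Rightarrow> real) \<Rightarrow> real^'n \<Rightarrow> real^'n" where
  "grad F x = (\<chi> i. frechet_derivative F (at x) (axis i 1))"

definition hessian :: "(real^'n \<Rightarrow> real) \<Rightarrow> real^'n \<Rightarrow> real^'n^'n" where
  "hessian F x = (\<chi> i j. frechet_derivative (\<lambda>y. grad F y $ j) (at x) (axis i 1))"

definition C2_sphere :: "(real^'n \<Rightarrow> real) \<Rightarrow> bool" where
  "C2_sphere f \<longleftrightarrow>
     (let F = hom_ext f; U = - {0::real^'n} in
       (\<forall>x\<in>U. F differentiable (at x)) \<and>
       (\<forall>j. \<forall>x\<in>U. (\<lambda>y. grad F y $ j) differentiable (at x)) \<and>
       continuous_on U (hessian F))"

definition D2 :: "(real^'n \<Rightarrow> real) \<Rightarrow> real^'n \<Rightarrow> real^'n^'n" where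
  "D2 f x = hessian (hom_ext f) x"

text \<open>Spherical gradient: projection of the Euclidean gradient of the
  1-homogeneous extension onto x-perp (grad F(x) = grad_S f(x) + f(x) x).\<close>
definition sgrad :: "(real^'n \<Rightarrow> real) \<Rightarrow> real^'n \<Rightarrow> real^'n" where
  "sgrad f x = grad (hom_ext f) x - f x *\<^sub>R x"

end

theory Submission
  imports Defs "HOL-Combinatorics.Transposition"
begin

text \<open>
  The existence of mixed area measures rests on Gromov's description of mixed volumes: if
  \<open>\<phi>\<^sub>i\<close> is a convex function whose gradient maps \<open>\<real>\<^sup>n\<close> onto the interior of \<open>K\<^sub>i\<close>, then
  \<open>vol (\<Sum> K\<^sub>i) = \<integral> det (\<Sum> D\<^sup>2\<phi>\<^sub>i)\<close>, so mixed volumes are integrals of mixed discriminants and hence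
  multilinear. For polytopes \<open>\<phi>\<close> is a log-sum-exp function; letting the weights of some of the
  vertices tend to zero and using Fatou's lemma gives monotonicity.

  The matrix \<open>A\<close> is read off from quadratic forms: writing \<open>\<rho>\<^sub>f\<close> for the density of \<open>S\<^bsub>f,C\<^esub>\<close> with respect
  to \<open>S\<^bsub>B,C\<^esub>\<close>, one puts \<open>A\<^sub>i\<^sub>j(x) = (\<rho>(x\<^sub>i x\<^sub>j) + x\<^sub>i x\<^sub>j) / 2\<close>. Volume is a valuation, which makes mixed area
  measures local; together with positivity this shows that \<open>\<rho>\<^sub>f \<ge> 0\<close> wherever \<open>D\<^sup>2f > 0\<close>. Thus \<open>\<rho>\<^sub>f(x)\<close>
  depends only on \<open>D\<^sup>2f(x)\<close>, and comparing \<open>f\<close> with quadratic forms having the same \<open>D\<^sup>2\<close> at \<open>x\<close> yields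
  \<open>\<rho>\<^sub>f = Tr[A D\<^sup>2f]\<close>. The formula for \<open>\<E>\<close> then follows by applying this to the product \<open>fg\<close> and using
  the symmetry of mixed volumes.
\<close>

section \<open>Mixed discriminants\<close>

text \<open>\<open>mixed_area_measure\<close> is a definite description, so nothing about it is
  known until one finite measure, and only one, is shown to represent L |-> n V(L, Ks). The obstacle
  is positivity: inclusion-exclusion hides that mixed volumes are monotone, hence the detour through
  integrals of mixed discriminants. The functional is represented on differences of support
  functions, a vector lattice that contains the C^2 functions. The bodies in \<open>Cs\<close> carry
  no regularity, so A is accessible only through densities, each defined up to a null set. Its
  constants solve an equation: for unit x and v orthogonal to x, the form q(y) = y . M y satisfies v
  . D^2q(x) v = 2 v . M v - q(x) |v|^2. With A x = 0 and Tr A = 1, the density of y_i y_j must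
  therefore be 2 A_ij - x_i x_j. Positivity of the measures forces A >= 0, and the density 1 of the
  constant function 1 forces Tr A = 1.\<close>

definition outer :: "real^'n \<Rightarrow> real^'n^'n" where
  "outer v = (\<chi> i j. v $ i * v $ j)"

text \<open>Finite sums of rank-one squares instead of a condition on the quadratic form: covariance
  matrices have this shape by construction, and a multilinear quantity can be tested on rank-one
  matrices by induction.\<close>

inductive psd :: "real^'n^'n \<Rightarrow> bool" where
  outer: "psd (outer v)"
| add: "psd A \<Longrightarrow> psd B \<Longrightarrow> psd (A + B)"

lemma psd_zero: "psd 0"
proof -
  have "outer 0 = (0 :: real^'n^'n)" by (simp add: outer_def vec_eq_iff)
  then show ?thesis by (metis psd.outer)
qed

lemma psd_scaleR: "psd A \<Longrightarrow> c \<ge> 0 \<Longrightarrow> psd (c *\<^sub>R A)"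
proof (induction rule: psd.induct)
  case (outer v)
  have "c *\<^sub>R outer v = outer (sqrt c *\<^sub>R v)"
    using outer by (simp add: outer_def vec_eq_iff mult.left_commute mult.assoc)
  then show ?case by (metis psd.outer)
qed (auto simp: scaleR_add_right intro: psd.add)

lemma psd_sum: "(\<And>i. i \<in> I \<Longrightarrow> psd (A i)) \<Longrightarrow> psd (sum A I)"
  by (induction I rule: infinite_finite_induct) (auto intro: psd_zero psd.add)

text \<open>Up to the factor \<open>n!\<close>, this is the mixed discriminant of the matrices \<open>A i\<close>.\<close>
definition mixed_disc :: "('n \<Rightarrow> real^'n^'n) \<Rightarrow> real" where
  "mixed_disc A = (\<Sum>p | p permutes UNIV. det (\<chi> i. A (p i) $ i))"

text \<open>Multilinear expansion by rows: \<open>f i\<close> records which summand supplies row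
  \<open>i\<close>.\<close>

lemma det_sum_eq:
  fixes A :: "'n::finite \<Rightarrow> real^'n^'n"
  shows "det (\<Sum>j\<in>J. A j) = (\<Sum>f | range f \<subseteq> J. det (\<chi> i. A (f i) $ i))"
proof -
  have "(\<Sum>j\<in>J. A j) = (\<chi> i. \<Sum>j\<in>J. A j $ i)"
    by (simp add: vec_eq_iff)
  then have "det (\<Sum>j\<in>J. A j) = (\<Sum>f | \<forall>i. f i \<in> J. det (\<chi> i. A (f i) $ i))"
    by (simp add: det_linear_rows_sum)
  moreover have "{f. \<forall>i. f i \<in> J} = {f. range f \<subseteq> J}" by auto
  ultimately show ?thesis by metis
qed

text \<open>Sorting the row choices \<open>h\<close> by their exact range turns
  \<open>det_sum_eq\<close> into a sum over subsets. Moebius inversion then isolates the surjective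
  choices, that is, the permutations. The right-hand side has the shape of the polarization formula
  for volumes, which is how volumes of Minkowski sums enter.\<close>

lemma mixed_disc_alternating:
  fixes A :: "'n::finite \<Rightarrow> real^'n^'n"
  shows "mixed_disc A = (\<Sum>J\<in>UNIV. (-1) ^ (CARD('n) - card J) * det (\<Sum>j\<in>J. A j))"
proof -
  define f where "f R = (\<Sum>h | range h = R. det (\<chi> i. A (h i) $ i))" for R :: "'n set"
  have "det (\<Sum>j\<in>S. A j) = sum f (Pow S)" for S :: "'n set"
  proof -
    have "{h::'n\<Rightarrow>'n. range h \<subseteq> S} = (\<Union>R\<in>Pow S. {h. range h = R})" by auto
    then have "det (\<Sum>j\<in>S. A j) = (\<Sum>h\<in>(\<Union>R\<in>Pow S. {h. range h = R}). det (\<chi> i. A (h i) $ i))"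
      by (simp add: det_sum_eq)
    also have "\<dots> = sum f (Pow S)"
      unfolding f_def by (rule sum.UNION_disjoint) auto
    finally show ?thesis .
  qed
  then have "f UNIV = (\<Sum>J\<in>Pow UNIV. (-1) ^ (card (UNIV::'n set) - card J) * det (\<Sum>j\<in>J. A j))"
    by (intro inclusion_exclusion_mobius) auto
  moreover have "{h::'n \<Rightarrow> 'n. range h = UNIV} = {p. p permutes UNIV}"
  proof (rule set_eqI, rule iffI; drule CollectD; rule CollectI)
    fix h :: "'n \<Rightarrow> 'n" assume "range h = UNIV"
    then have "bij h" using finite_UNIV_surj_inj[of h] by (simp add: bij_def)
    then show "h permutes UNIV" by (intro bij_imp_permutes) auto
  next
    fix h :: "'n \<Rightarrow> 'n" assume "h permutes UNIV"
    then show "range h = UNIV" by (rule permutes_surj)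
  qed
  ultimately show ?thesis by (simp add: f_def mixed_disc_def)
qed

lemma mixed_disc_same: "mixed_disc (\<lambda>_::'n::finite. A) = fact CARD('n) * det A"
proof -
  have "(\<chi> i. A $ i) = A" by (simp add: vec_eq_iff)
  then show ?thesis by (simp add: mixed_disc_def card_permutations)
qed

text \<open>For fixed \<open>p\<close> the matrix with index \<open>j\<close> contributes the single
  row \<open>inv p j\<close>; linearity of \<open>det\<close> in that row gives linearity of
  \<open>mixed_disc\<close> in each argument.\<close>

lemma mixed_disc_upd_row:
  fixes A :: "'n::finite \<Rightarrow> real^'n^'n"
  assumes "p permutes UNIV"
  shows "(\<chi> i. (A(j := B)) (p i) $ i) = (\<chi> i. if i = inv p j then B $ i else A (p i) $ i)"
  using assms by (auto simp: vec_eq_iff permutes_inverses)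

lemma mixed_disc_upd_add:
  "mixed_disc (A(j := B + C)) = mixed_disc (A(j := B)) + mixed_disc (A(j := C))"
proof -
  have "det (\<chi> i. (A(j := B + C)) (p i) $ i)
      = det (\<chi> i. (A(j := B)) (p i) $ i) + det (\<chi> i. (A(j := C)) (p i) $ i)"
    if "p permutes UNIV" for p
    unfolding mixed_disc_upd_row[OF that]
    using det_row_add[of "inv p j" "\<lambda>i. B $ i" "\<lambda>i. C $ i" "\<lambda>i. A (p i) $ i"]
    by (simp cong: if_cong)
  then show ?thesis by (simp add: mixed_disc_def sum.distrib)
qed

lemma mixed_disc_upd_scaleR: "mixed_disc (A(j := c *\<^sub>R B)) = c * mixed_disc (A(j := B))"
proof -
  have "det (\<chi> i. (A(j := c *\<^sub>R B)) (p i) $ i) = c * det (\<chi> i. (A(j := B)) (p i) $ i)"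
    if "p permutes UNIV" for p
    unfolding mixed_disc_upd_row[OF that]
    using det_row_mul[of "inv p j" c "\<lambda>i. B $ i" "\<lambda>i. A (p i) $ i"]
    by (simp add: scalar_mult_eq_scaleR cong: if_cong)
  then show ?thesis by (simp add: mixed_disc_def sum_distrib_left)
qed

text \<open>Row \<open>i\<close> of the matrix is a multiple of \<open>u (p i)\<close>. Extracting
  the scalars and undoing the permutation leaves \<open>sign p\<close> times a product times
  \<open>det U\<close>; the sum over \<open>p\<close> is a second determinant, so the value is the
  square of \<open>det U\<close>.\<close>

lemma mixed_disc_outer_nonneg:
  fixes u :: "'n::finite \<Rightarrow> real^'n"
  shows "mixed_disc (\<lambda>j. outer (u j)) \<ge> 0"
proof -
  define U :: "real^'n^'n" where "U = (\<chi> i. u i)"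
  have "det (\<chi> i. outer (u (p i)) $ i) = (of_int (sign p) * (\<Prod>i\<in>UNIV. transpose U $ i $ p i)) * det U"
    if p: "p permutes UNIV" for p
  proof -
    have "(\<chi> i. outer (u (p i)) $ i) = (\<chi> i. u (p i) $ i *s u (p i))"
      by (simp add: outer_def vec_eq_iff)
    then have "det (\<chi> i. outer (u (p i)) $ i)
        = (\<Prod>i\<in>UNIV. u (p i) $ i) * det (\<chi> i. u (p i))"
      by (simp add: det_rows_mul)
    also have "(\<chi> i. u (p i)) = (\<chi> i. U $ p i)" by (simp add: U_def)
    also have "det \<dots> = of_int (sign p) * det U" by (rule det_permute_rows[OF p])
    finally show ?thesis by (simp add: U_def transpose_def)
  qed
  then have "mixed_disc (\<lambda>j. outer (u j)) = det (transpose U) * det U"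
    unfolding mixed_disc_def det_def[of "transpose U"] sum_distrib_right
    by (intro sum.cong) auto
  then show ?thesis by (simp add: det_transpose)
qed

lemma mixed_disc_nonneg:
  fixes A :: "'n::finite \<Rightarrow> real^'n^'n"
  assumes "\<And>j. psd (A j)"
  shows "mixed_disc A \<ge> 0"
proof -
  \<comment> \<open>\<open>T\<close> collects the indices whose matrix may still be a sum of several
    rank-one terms; the induction removes one index at a time by additivity in that slot.\<close>
  have "mixed_disc A \<ge> 0" if "\<And>j. j \<in> T \<Longrightarrow> psd (A j)" "\<And>j. j \<notin> T \<Longrightarrow> \<exists>v. A j = outer v" "finite T"
    for T and A :: "'n \<Rightarrow> real^'n^'n"
    using that(3,1,2)
  proof (induction T arbitrary: A)
    case empty
    then have "\<forall>j. \<exists>v. A j = outer v" by simp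
    then obtain u where "\<And>j. A j = outer (u j)" by metis
    then have "A = (\<lambda>j. outer (u j))" by auto
    then show ?case using mixed_disc_outer_nonneg by simp
  next
    case (insert k T)
    have "psd B \<Longrightarrow> mixed_disc (A(k := B)) \<ge> 0" for B
    proof (induction rule: psd.induct)
      case (outer v)
      show ?case by (rule insert.IH) (use insert.prems insert.hyps in auto)
    qed (simp add: mixed_disc_upd_add del: fun_upd_apply)
    from this[of "A k"] show ?case using insert.prems by simp
  qed
  from this[of UNIV A] show ?thesis using assms by simp
qed

lemma det_psd_nonneg: "psd A \<Longrightarrow> det A \<ge> 0" for A :: "real^'n^'n"
  using mixed_disc_nonneg[of "\<lambda>_. A"] fact_gt_zero[of "CARD('n)", where 'a=real]
  by (simp add: mixed_disc_same zero_le_mult_iff del: fact_gt_zero)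

section \<open>Gradient models of convex bodies\<close>

lemma outer_mult: "outer v *v x = (v \<bullet> x) *\<^sub>R v" for v x :: "real^'n"
  by (simp add: outer_def matrix_vector_mult_def vec_eq_iff inner_vec_def sum_distrib_left mult_ac)

lemma outer_quadratic: "x \<bullet> (outer v *v x) = (v \<bullet> x)\<^sup>2" for v x :: "real^'n"
  by (simp add: outer_mult power2_eq_square inner_commute)

text \<open>The gradient of the convex function \<open>\<phi>\<close> maps the whole space injectively onto \<open>P\<close> up to
  its boundary; \<open>H\<close> is the Hessian of \<open>\<phi>\<close>.\<close>
definition gradient_model :: "(real^'n) set \<Rightarrow> (real^'n \<Rightarrow> real^'n^'n) \<Rightarrow> bool" where
  "gradient_model P H \<longleftrightarrow> compact P \<and> convex P \<and>
     (\<exists>\<phi> g C. (\<forall>x. (\<phi> has_derivative (\<lambda>v. g x \<bullet> v)) (at x)) \<and>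
        (\<forall>x. (g has_derivative (\<lambda>v. H x *v v)) (at x)) \<and>
        (\<forall>x. g x \<in> P) \<and> (\<forall>x. \<forall>p\<in>P. p \<bullet> x \<le> \<phi> x + C)) \<and>
     (\<forall>x. psd (H x)) \<and> (\<forall>x d. d \<noteq> 0 \<longrightarrow> d \<bullet> (H x *v d) > 0)"

text \<open>The gradient image is described through membership in \<open>P\<close> and a linear
  growth bound because both conditions simply add. That the sum of the gradients fills
  \<open>P + Q\<close> up to its boundary is recovered in
  \<open>gradient_model_volume\<close>.\<close>

lemma gradient_model_add:
  assumes "gradient_model P H" "gradient_model Q G"
  shows "gradient_model (P + Q) (\<lambda>x. H x + G x)"
proof -
  from assms(1) obtain \<phi> g C where 1: "compact P" "convex P"
    "\<And>x. (\<phi> has_derivative (\<lambda>v. g x \<bullet> v)) (at x)" "\<And>x. (g has_derivative (\<lambda>v. H x *v v)) (at x)"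
    "\<And>x. g x \<in> P" "\<And>x p. p \<in> P \<Longrightarrow> p \<bullet> x \<le> \<phi> x + C"
    "\<And>x. psd (H x)" "\<And>x d. d \<noteq> 0 \<Longrightarrow> d \<bullet> (H x *v d) > 0"
    unfolding gradient_model_def by blast
  from assms(2) obtain \<psi> k D where 2: "compact Q" "convex Q"
    "\<And>x. (\<psi> has_derivative (\<lambda>v. k x \<bullet> v)) (at x)" "\<And>x. (k has_derivative (\<lambda>v. G x *v v)) (at x)"
    "\<And>x. k x \<in> Q" "\<And>x p. p \<in> Q \<Longrightarrow> p \<bullet> x \<le> \<psi> x + D"
    "\<And>x. psd (G x)" "\<And>x d. d \<noteq> 0 \<Longrightarrow> d \<bullet> (G x *v d) > 0"
    unfolding gradient_model_def by blast
  show ?thesis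
    unfolding gradient_model_def
  proof (intro conjI exI allI ballI impI)
    show "((\<lambda>x. \<phi> x + \<psi> x) has_derivative (\<lambda>v. (g x + k x) \<bullet> v)) (at x)" for x
      unfolding inner_add_left by (intro has_derivative_add 1 2)
    show "((\<lambda>x. g x + k x) has_derivative (\<lambda>v. (H x + G x) *v v)) (at x)" for x
      unfolding matrix_vector_mult_add_rdistrib by (intro has_derivative_add 1 2)
    show "compact (P + Q)"
      using compact_sums[OF 1(1) 2(1)] by (simp add: set_plus_def) (smt (verit) Collect_cong)
    show "convex (P + Q)" by (intro convex_set_plus 1 2)
    show "g x + k x \<in> P + Q" for x by (intro set_plus_intro 1 2)
    show "p \<bullet> x \<le> (\<phi> x + \<psi> x) + (C + D)" if p: "p \<in> P + Q" for p x
    proof -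
      from p obtain a b where "p = a + b" "a \<in> P" "b \<in> Q" by (auto elim: set_plus_elim)
      then show ?thesis using 1(6)[of a x] 2(6)[of b x] by (simp add: inner_add_left)
    qed
    show "d \<bullet> ((H x + G x) *v d) > 0" if "d \<noteq> 0" for x d
      using 1(8)[OF that, of x] 2(8)[OF that, of x]
      by (simp add: matrix_vector_mult_add_rdistrib inner_add_right)
  qed (intro psd.add 1 2)
qed

lemma gradient_model_sum:
  assumes "finite J" "J \<noteq> {}" "\<And>j. j \<in> J \<Longrightarrow> gradient_model (P j) (H j)"
  shows "gradient_model (\<Sum>j\<in>J. P j) (\<lambda>x. \<Sum>j\<in>J. H j x)"
  using assms
proof (induction J rule: finite_ne_induct)
  case (insert j J)
  then show ?case using gradient_model_add[of "P j" "H j"] by simp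
qed simp

lemma gradient_model_scaleR:
  assumes "gradient_model P H" "t > 0"
  shows "gradient_model ((*\<^sub>R) t ` P) (\<lambda>x. t *\<^sub>R H x)"
proof -
  from assms(1) obtain \<phi> g C where 1: "compact P" "convex P"
    "\<And>x. (\<phi> has_derivative (\<lambda>v. g x \<bullet> v)) (at x)" "\<And>x. (g has_derivative (\<lambda>v. H x *v v)) (at x)"
    "\<And>x. g x \<in> P" "\<And>x p. p \<in> P \<Longrightarrow> p \<bullet> x \<le> \<phi> x + C"
    "\<And>x. psd (H x)" "\<And>x d. d \<noteq> 0 \<Longrightarrow> d \<bullet> (H x *v d) > 0"
    unfolding gradient_model_def by blast
  show ?thesis
    unfolding gradient_model_def
  proof (intro conjI exI allI ballI impI)
    show "((\<lambda>x. t * \<phi> x) has_derivative (\<lambda>v. (t *\<^sub>R g x) \<bullet> v)) (at x)" for x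
      unfolding inner_scaleR_left by (intro has_derivative_mult_right 1)
    show "((\<lambda>x. t *\<^sub>R g x) has_derivative (\<lambda>v. (t *\<^sub>R H x) *v v)) (at x)" for x
      unfolding scaleR_matrix_vector_assoc[symmetric] by (intro has_derivative_scaleR_right 1)
    show "compact ((*\<^sub>R) t ` P)" "convex ((*\<^sub>R) t ` P)"
      using 1 by (auto intro: compact_scaling convex_scaling)
    show "t *\<^sub>R g x \<in> (*\<^sub>R) t ` P" for x using 1 by auto
    show "p \<bullet> x \<le> t * \<phi> x + t * C" if "p \<in> (*\<^sub>R) t ` P" for p x
      using that 1(6) assms(2) by (auto simp flip: distrib_left)
    show "d \<bullet> ((t *\<^sub>R H x) *v d) > 0" if "d \<noteq> 0" for x d
      using 1(8)[OF that, of x] assms(2) by (simp flip: scaleR_matrix_vector_assoc)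
  qed (intro psd_scaleR 1 less_imp_le assms)
qed

text \<open>Change of variables under \<open>g\<close>. Positive definiteness makes \<open>g\<close>
  strictly monotone along lines, hence injective. A point \<open>y\<close> interior to
  \<open>P\<close> is attained at a minimum of the coercive function phi(x) - y . x, and what is
  missed lies in the frontier of a convex set, a null set.\<close>

lemma gradient_model_volume:
  fixes P :: "(real^'n::{finite,wellorder}) set"
  assumes "gradient_model P H"
  shows "integrable lebesgue (\<lambda>x. det (H x))"
    and "(\<integral>x. det (H x) \<partial>lebesgue) = measure lebesgue P"
proof -
  from assms(1) obtain \<phi> g C where 1: "compact P" "convex P"
    "\<And>x. (\<phi> has_derivative (\<lambda>v. g x \<bullet> v)) (at x)" "\<And>x. (g has_derivative (\<lambda>v. H x *v v)) (at x)"
    "\<And>x. g x \<in> P" "\<And>x p. p \<in> P \<Longrightarrow> p \<bullet> x \<le> \<phi> x + C"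
    "\<And>x. psd (H x)" "\<And>x d. d \<noteq> 0 \<Longrightarrow> d \<bullet> (H x *v d) > 0"
    unfolding gradient_model_def by blast
  have inj: "inj g"
  proof (rule injI, rule ccontr)
    fix x y assume eq: "g x = g y" and ne: "x \<noteq> y"
    define d where "d = y - x"
    have "((\<lambda>s. d \<bullet> g (x + s *\<^sub>R d)) has_real_derivative d \<bullet> (H (x + s *\<^sub>R d) *v d)) (at s)" for s
    proof -
      have "((\<lambda>s. x + s *\<^sub>R d) has_derivative (\<lambda>u. u *\<^sub>R d)) (at s)"
        by (auto intro!: derivative_eq_intros)
      then have "((\<lambda>s. d \<bullet> g (x + s *\<^sub>R d)) has_derivative (\<lambda>u. d \<bullet> (H (x + s *\<^sub>R d) *v (u *\<^sub>R d)))) (at s)"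
        by (intro has_derivative_inner_right has_derivative_compose[OF _ 1(4)])
      then show ?thesis
        by (simp add: has_field_derivative_def matrix_vector_mult_scaleR mult.commute[of _ "d \<bullet> _"])
    qed
    moreover have "d \<noteq> 0" using ne by (simp add: d_def)
    ultimately have "d \<bullet> g (x + 0 *\<^sub>R d) < d \<bullet> g (x + 1 *\<^sub>R d)"
      by (intro DERIV_pos_imp_increasing[of 0 1 "\<lambda>s. d \<bullet> g (x + s *\<^sub>R d)"]) (auto intro: 1(8))
    then show False by (simp add: eq d_def)
  qed
  have onto: "interior P \<subseteq> range g"
  proof
    fix y assume "y \<in> interior P"
    then obtain r where r: "r > 0" "cball y r \<subseteq> P" unfolding mem_interior_cball by blast
    define \<psi> where "\<psi> x = \<phi> x - y \<bullet> x" for x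
    \<comment> \<open>A ball of radius \<open>r\<close> around \<open>y\<close> inside
      \<open>P\<close> is tested at its point furthest in the direction of \<open>x\<close>, which
      turns the bound for \<open>P\<close> into linear growth of \<open>\<psi>\<close>.\<close>
    have low: "\<psi> x \<ge> r * norm x - C" for x
    proof -
      have "y + (r / norm x) *\<^sub>R x \<in> cball y r" using r by (simp add: dist_norm)
      then have "(y + (r / norm x) *\<^sub>R x) \<bullet> x \<le> \<phi> x + C" using r 1(6) by blast
      moreover have "(r / norm x) *\<^sub>R x \<bullet> x = r * norm x"
        by (cases "x = 0") (auto simp: power2_norm_eq_inner[symmetric] power2_eq_square)
      ultimately show ?thesis by (simp add: \<psi>_def inner_add_left)
    qed
    \<comment> \<open>Outside this radius the growth bound exceeds \<open>\<psi> 0\<close>, so a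
      minimum over the ball is a global minimum.\<close>
    define R where "R = (\<bar>\<psi> 0\<bar> + \<bar>C\<bar> + 1) / r"
    have Rpos: "R > 0" using r by (simp add: R_def)
    have d\<psi>: "(\<psi> has_derivative (\<lambda>v. (g x - y) \<bullet> v)) (at x)" for x
      unfolding \<psi>_def inner_diff_left by (intro has_derivative_diff 1 has_derivative_inner_right has_derivative_ident)
    then have "continuous_on (cball 0 R) \<psi>"
      by (meson continuous_at_imp_continuous_on has_derivative_continuous)
    then obtain x where x: "x \<in> cball 0 R" "\<And>z. z \<in> cball 0 R \<Longrightarrow> \<psi> x \<le> \<psi> z"
      using continuous_attains_inf[of "cball 0 R" \<psi>] Rpos by auto
    have "\<psi> x \<le> \<psi> z" for z
    proof (cases "z \<in> cball 0 R")
      case False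
      then have "r * norm z \<ge> r * R" using r by simp
      then have "r * norm z \<ge> \<bar>\<psi> 0\<bar> + \<bar>C\<bar> + 1" using r by (simp add: R_def)
      then show ?thesis using low[of z] x(2)[of 0] Rpos by simp
    qed (use x in auto)
    then have "(\<lambda>v. (g x - y) \<bullet> v) = (\<lambda>v. 0)"
      using differential_zero_maxmin[of x UNIV \<psi>, OF _ _ d\<psi>] by auto
    then have "(g x - y) \<bullet> (g x - y) = 0" by (rule fun_cong)
    then show "y \<in> range g" by auto
  qed
  have sub: "range g \<subseteq> P" using 1 by auto
  have "(P - range g) \<union> (range g - P) \<subseteq> frontier P"
    using onto sub closure_subset[of P] by (auto simp: frontier_def)
  then have neg: "negligible ((P - range g) \<union> (range g - P))"
    using negligible_subset negligible_convex_frontier[OF 1(2)] by blast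
  have "P \<in> lmeasurable" using 1 by (simp add: lmeasurable_compact)
  then have rg: "range g \<in> lmeasurable" "measure lebesgue (range g) = measure lebesgue P"
    using neg lmeasurable_negligible_symdiff measure_negligible_symdiff by blast+
  have det: "\<bar>det (H x)\<bar> = det (H x)" for x
    using det_psd_nonneg[OF 1(7)] by simp
  have i: "(\<lambda>x. det (H x)) integrable_on UNIV"
    using measurable_differentiable_image_eq[of UNIV g "\<lambda>x v. H x *v v"] inj rg 1(4)
    by (simp add: det)
  then have m: "measure lebesgue P = integral UNIV (\<lambda>x. det (H x))"
    using measure_differentiable_image_eq[of UNIV g "\<lambda>x v. H x *v v"] inj rg 1(4)
    by (simp add: det)
  have "(\<lambda>x. det (H x)) absolutely_integrable_on UNIV"
    using i det_psd_nonneg[OF 1(7)] by (intro nonnegative_absolutely_integrable_1) auto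
  then have a: "set_integrable lebesgue UNIV (\<lambda>x. det (H x))" .
  then show "integrable lebesgue (\<lambda>x. det (H x))" by (simp add: set_integrable_def)
  show "(\<integral>x. det (H x) \<partial>lebesgue) = measure lebesgue P"
    using set_lebesgue_integral_eq_integral(2)[OF a] m by (simp add: set_lebesgue_integral_def)
qed

section \<open>Log-sum-exp functions and their covariance Hessians\<close>

definition lse_weight :: "(real^'n) set \<Rightarrow> (real^'n \<Rightarrow> real) \<Rightarrow> real^'n \<Rightarrow> real^'n \<Rightarrow> real" where
  "lse_weight Y w x y = w y * exp (x \<bullet> y) / (\<Sum>z\<in>Y. w z * exp (x \<bullet> z))"

text \<open>The barycentre of the Gibbs weights, which is the gradient of the log-sum-exp
  function.\<close>

definition lse_mean :: "(real^'n) set \<Rightarrow> (real^'n \<Rightarrow> real) \<Rightarrow> real^'n \<Rightarrow> real^'n" where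
  "lse_mean Y w x = (\<Sum>y\<in>Y. lse_weight Y w x y *\<^sub>R y)"

text \<open>The Hessian of \<open>\<lambda>x. ln (\<Sum>y\<in>Y. w y * exp (x \<bullet> y))\<close> is a covariance matrix.\<close>
definition lse_hessian :: "(real^'n) set \<Rightarrow> (real^'n \<Rightarrow> real) \<Rightarrow> real^'n \<Rightarrow> real^'n^'n" where
  "lse_hessian Y w x = (\<Sum>y\<in>Y. lse_weight Y w x y *\<^sub>R outer (y - lse_mean Y w x))"

text \<open>The gradient is an average of the points of \<open>Y\<close>, so it stays in the hull;
  the sum dominates each single exponential, which is the growth bound. A covariance matrix
  degenerates in a direction \<open>d\<close> only if all points of \<open>Y\<close> lie in one
  hyperplane orthogonal to \<open>d\<close>, and this is excluded by the nonempty interior.\<close>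

lemma gradient_model_lse:
  fixes Y :: "(real^'n) set"
  assumes Y: "finite Y" "interior (convex hull Y) \<noteq> {}" and w: "\<And>y. y \<in> Y \<Longrightarrow> w y > 0"
  shows "gradient_model (convex hull Y) (lse_hessian Y w)"
proof -
  define Z where "Z x = (\<Sum>z\<in>Y. w z * exp (x \<bullet> z))" for x :: "real^'n"
  define p where "p = lse_weight Y w"
  define g where "g = lse_mean Y w"
  have ne: "Y \<noteq> {}" using Y by auto
  have Zpos: "Z x > 0" for x unfolding Z_def by (rule sum_pos) (use Y ne w in auto)
  have p_def': "p x y = w y * exp (x \<bullet> y) / Z x" for x y by (simp add: p_def lse_weight_def Z_def)
  have g_def': "g x = (\<Sum>y\<in>Y. p x y *\<^sub>R y)" for x by (simp add: g_def p_def lse_mean_def)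
  have H_def': "lse_hessian Y w x = (\<Sum>y\<in>Y. p x y *\<^sub>R outer (y - g x))" for x
    by (simp add: g_def p_def lse_hessian_def)
  have ppos: "p x y > 0" if "y \<in> Y" for x y using Zpos w[OF that] by (simp add: p_def')
  have psum: "(\<Sum>y\<in>Y. p x y) = 1" for x
    using Zpos[of x] by (simp add: p_def' Z_def flip: sum_divide_distrib)
  have dZ: "(Z has_derivative (\<lambda>v. Z x * (g x \<bullet> v))) (at x)" for x
  proof -
    have "(Z has_derivative (\<lambda>v. \<Sum>z\<in>Y. w z * (exp (x \<bullet> z) * (v \<bullet> z)))) (at x)"
      unfolding Z_def[abs_def] by (auto intro!: derivative_eq_intros sum.cong simp: mult_ac)
    moreover have "(\<Sum>z\<in>Y. w z * (exp (x \<bullet> z) * (v \<bullet> z))) = Z x * (g x \<bullet> v)" for v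
      using Zpos[of x] by (auto simp: g_def' p_def' inner_sum_left sum_distrib_left inner_commute[of v] mult_ac
        intro!: sum.cong)
    ultimately show ?thesis by simp
  qed
  have dp: "((\<lambda>x. p x y) has_derivative (\<lambda>v. p x y * ((y - g x) \<bullet> v))) (at x)" for x y
  proof -
    have "((\<lambda>x. w y * exp (x \<bullet> y) / Z x) has_derivative
       (\<lambda>v. - (w y * exp (x \<bullet> y)) * (inverse (Z x) * (Z x * (g x \<bullet> v)) * inverse (Z x))
            + w y * (exp (x \<bullet> y) * (v \<bullet> y)) / Z x)) (at x)"
      by (rule has_derivative_divide[OF _ dZ]) (use Zpos[of x] in \<open>auto intro!: derivative_eq_intros\<close>)
    then show ?thesis
      unfolding p_def'[abs_def]
      by (rule has_derivative_eq_rhs)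
        (use Zpos[of x] in \<open>auto simp: fun_eq_iff field_simps inner_diff_left inner_diff_right inner_commute\<close>)
  qed
  have dg: "(g has_derivative (\<lambda>v. lse_hessian Y w x *v v)) (at x)" for x
  proof -
    have "(g has_derivative (\<lambda>v. \<Sum>y\<in>Y. (p x y * ((y - g x) \<bullet> v)) *\<^sub>R y)) (at x)"
      unfolding g_def'[abs_def]
      by (intro has_derivative_sum has_derivative_scaleR_left dp[unfolded g_def'])
    moreover have "(\<Sum>y\<in>Y. (p x y * ((y - g x) \<bullet> v)) *\<^sub>R y) = lse_hessian Y w x *v v" for v
    proof -
      \<comment> \<open>The deviations from the mean average to zero, so subtracting
        \<open>g x\<close> in one factor of the covariance changes nothing.\<close>
      have "(\<Sum>y\<in>Y. p x y * ((y - g x) \<bullet> v)) = (\<Sum>y\<in>Y. p x y *\<^sub>R y) \<bullet> v - (\<Sum>y\<in>Y. p x y) * (g x \<bullet> v)"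
        by (simp add: inner_sum_left inner_diff_left right_diff_distrib sum_subtractf sum_distrib_right)
      also have "\<dots> = 0" by (simp add: psum flip: g_def')
      finally have 0: "(\<Sum>y\<in>Y. p x y * ((y - g x) \<bullet> v)) = 0" .
      have "lse_hessian Y w x *v v = (\<Sum>y\<in>Y. (p x y *\<^sub>R outer (y - g x)) *v v)"
        unfolding H_def' using Y(1) by (induction Y rule: finite_induct) (auto simp: matrix_vector_mult_add_rdistrib)
      also have "\<dots> = (\<Sum>y\<in>Y. (p x y * ((y - g x) \<bullet> v)) *\<^sub>R y - (p x y * ((y - g x) \<bullet> v)) *\<^sub>R g x)"
        by (simp add: outer_mult scaleR_right_diff_distrib flip: scaleR_matrix_vector_assoc)
      also have "\<dots> = (\<Sum>y\<in>Y. (p x y * ((y - g x) \<bullet> v)) *\<^sub>R y) - (\<Sum>y\<in>Y. p x y * ((y - g x) \<bullet> v)) *\<^sub>R g x"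
        by (simp only: sum_subtractf scaleR_sum_left)
      finally show ?thesis by (simp add: 0)
    qed
    ultimately show ?thesis by simp
  qed
  have quad: "d \<bullet> (lse_hessian Y w x *v d) = (\<Sum>y\<in>Y. p x y * ((y - g x) \<bullet> d)\<^sup>2)" for x d
  proof -
    have "d \<bullet> ((\<Sum>y\<in>Y. p x y *\<^sub>R outer (y - g x)) *v d) = (\<Sum>y\<in>Y. d \<bullet> ((p x y *\<^sub>R outer (y - g x)) *v d))"
      using Y(1) by (induction Y rule: finite_induct) (auto simp: matrix_vector_mult_add_rdistrib inner_add_right)
    then show ?thesis unfolding H_def' by (simp add: outer_quadratic flip: scaleR_matrix_vector_assoc)
  qed
  \<comment> \<open>The largest loss caused by the weights: every \<open>y\<close> in
    \<open>Y\<close> satisfies x . y <= ln (Z x) - ln (w y).\<close>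
  define C where "C = Max ((\<lambda>y. - ln (w y)) ` Y)"
  show ?thesis
    unfolding gradient_model_def
  proof (intro conjI exI allI ballI impI)
    show "((\<lambda>x. ln (Z x)) has_derivative (\<lambda>v. g x \<bullet> v)) (at x)" for x
      by (rule has_derivative_eq_rhs, rule has_derivative_ln[OF Zpos dZ])
        (use Zpos[of x] in \<open>auto simp: fun_eq_iff\<close>)
    show "(g has_derivative (\<lambda>v. lse_hessian Y w x *v v)) (at x)" for x by (rule dg)
    show "compact (convex hull Y)" using Y by (simp add: finite_imp_compact_convex_hull)
    show "g x \<in> convex hull Y" for x
      unfolding g_def' using Y ppos psum
      by (intro convex_sum) (auto intro: hull_inc less_imp_le)
    show "q \<bullet> x \<le> ln (Z x) + C" if q: "q \<in> convex hull Y" for q x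
    proof -
      have "y \<bullet> x \<le> ln (Z x) + C" if y: "y \<in> Y" for y
      proof -
        have "w y * exp (x \<bullet> y) \<le> Z x"
          unfolding Z_def using Y(1) y w by (intro member_le_sum) (auto intro: less_imp_le)
        then have "ln (w y * exp (x \<bullet> y)) \<le> ln (Z x)"
          using w[OF y] Zpos by (subst ln_le_cancel_iff) auto
        then have "ln (w y) + x \<bullet> y \<le> ln (Z x)" using w[OF y] by (simp add: ln_mult)
        moreover have "- ln (w y) \<le> C" unfolding C_def using Y y by (intro Max_ge) auto
        ultimately show ?thesis by (simp add: inner_commute)
      qed
      then have "convex hull Y \<subseteq> {q. x \<bullet> q \<le> ln (Z x) + C}"
        by (intro hull_minimal convex_halfspace_le) (auto simp: inner_commute)
      then show ?thesis using q by (auto simp: inner_commute)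
    qed
    show "d \<bullet> (lse_hessian Y w x *v d) > 0" if "d \<noteq> 0" for x d
    proof (rule ccontr)
      assume "\<not> d \<bullet> (lse_hessian Y w x *v d) > 0"
      moreover have nn: "p x y * ((y - g x) \<bullet> d)\<^sup>2 \<ge> 0" if "y \<in> Y" for y
        using ppos[OF that] by (simp add: less_imp_le)
      ultimately have "(\<Sum>y\<in>Y. p x y * ((y - g x) \<bullet> d)\<^sup>2) = 0"
        using quad[of d x] sum_nonneg[of Y, OF nn] by force
      then have "\<And>y. y \<in> Y \<Longrightarrow> p x y * ((y - g x) \<bullet> d)\<^sup>2 = 0"
        using sum_nonneg_eq_0_iff[OF Y(1), of "\<lambda>y. p x y * ((y - g x) \<bullet> d)\<^sup>2"] nn by blast
      then have "(y - g x) \<bullet> d = 0" if "y \<in> Y" for y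
        using ppos[OF that, of x] that by force
      then have "d \<bullet> y = d \<bullet> g x" if "y \<in> Y" for y
        using that by (simp add: inner_commute[of _ d] inner_diff_right)
      then have "convex hull Y \<subseteq> {y. d \<bullet> y = d \<bullet> g x}"
        by (intro hull_minimal convex_hyperplane) auto
      then have "interior (convex hull Y) \<subseteq> interior {y. d \<bullet> y = d \<bullet> g x}"
        by (rule interior_mono)
      then show False using Y(2) interior_hyperplane[OF that] by auto
    qed
  qed (auto simp: H_def' intro!: psd_sum psd_scaleR psd.outer less_imp_le ppos)
qed

text \<open>Since \<open>Y1\<close> is nonempty the limiting denominator is positive, and the
  weights of the points outside \<open>Y1\<close> vanish in the limit.\<close>

lemma lse_hessian_tendsto:
  fixes Y1 Y2 :: "(real^'n) set"
  assumes "finite Y2" "Y1 \<subseteq> Y2" "Y1 \<noteq> {}" and w: "\<And>y. y \<in> Y2 \<Longrightarrow> (\<lambda>m. w m y) \<longlonglongrightarrow> (if y \<in> Y1 then 1 else 0)"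
  shows "(\<lambda>m. lse_hessian Y2 (w m) x) \<longlonglongrightarrow> lse_hessian Y1 (\<lambda>_. 1) x"
proof -
  let ?i = "\<lambda>y. if y \<in> Y1 then 1 else 0 :: real"
  have 1: "(\<Sum>y\<in>Y1. f y) = (\<Sum>y\<in>Y2. if y \<in> Y1 then f y else 0)" for f :: "_ \<Rightarrow> 'b::comm_monoid_add"
    using assms by (simp add: sum.If_cases Int_absorb1)
  have fin: "finite Y1" using assms finite_subset by blast
  have pos: "(\<Sum>z\<in>Y1. exp (x \<bullet> z)) > 0" using assms fin by (intro sum_pos) auto
  have den: "(\<lambda>m. \<Sum>z\<in>Y2. w m z * exp (x \<bullet> z)) \<longlonglongrightarrow> (\<Sum>z\<in>Y1. exp (x \<bullet> z))"
    unfolding 1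
  proof (rule tendsto_sum)
    fix z assume "z \<in> Y2"
    from tendsto_mult[OF w[OF this] tendsto_const]
    show "(\<lambda>m. w m z * exp (x \<bullet> z)) \<longlonglongrightarrow> (if z \<in> Y1 then exp (x \<bullet> z) else 0)"
      using w[OF \<open>z \<in> Y2\<close>] by (auto split: if_splits)
  qed
  have wt: "(\<lambda>m. lse_weight Y2 (w m) x y) \<longlonglongrightarrow> (if y \<in> Y1 then lse_weight Y1 (\<lambda>_. 1) x y else 0)" if "y \<in> Y2" for y
    unfolding lse_weight_def
    using tendsto_divide[OF tendsto_mult[OF w[OF that] tendsto_const] den, of "exp (x \<bullet> y)"] pos
    by (auto split: if_splits)
  have mean: "(\<lambda>m. lse_mean Y2 (w m) x) \<longlonglongrightarrow> lse_mean Y1 (\<lambda>_. 1) x"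
    unfolding lse_mean_def 1 by (rule tendsto_sum) (auto intro!: tendsto_eq_intros wt split: if_splits)
  have out: "(\<lambda>m. outer (y - lse_mean Y2 (w m) x)) \<longlonglongrightarrow> outer (y - lse_mean Y1 (\<lambda>_. 1) x)" for y
    unfolding outer_def by (intro tendsto_intros mean)
  show ?thesis
    unfolding lse_hessian_def 1
    by (rule tendsto_sum) (auto intro!: tendsto_eq_intros wt out split: if_splits)
qed

section \<open>Multilinearity and monotonicity of mixed volumes\<close>

text \<open>This is n! times the mixed volume. Indexing the bodies by the coordinate type matches
  the arguments of \<open>mixed_disc\<close>, which are indexed by the same type.\<close>

definition polar_volume :: "('n::finite \<Rightarrow> (real^'n) set) \<Rightarrow> real" where
  "polar_volume K = (\<Sum>J\<in>UNIV. (-1) ^ (CARD('n) - card J) * measure lebesgue (\<Sum>j\<in>J. K j))"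

text \<open>The volume side and the determinant side are the same alternating sum over subsets, and
  they agree term by term by \<open>gradient_model_volume\<close>.\<close>

lemma polar_volume_gradient_model:
  fixes P :: "'n \<Rightarrow> (real^'n::{finite,wellorder}) set"
  assumes "\<And>j. gradient_model (P j) (H j)"
  shows "integrable lebesgue (\<lambda>x. mixed_disc (\<lambda>j. H j x))"
    and "(\<integral>x. mixed_disc (\<lambda>j. H j x) \<partial>lebesgue) = polar_volume P"
proof -
  have 1: "integrable lebesgue (\<lambda>x. det (\<Sum>j\<in>J. H j x)) \<and>
      (\<integral>x. det (\<Sum>j\<in>J. H j x) \<partial>lebesgue) = measure lebesgue (\<Sum>j\<in>J. P j)" for J
  proof (cases "J = {}")
    case True
    \<comment> \<open>The empty Minkowski sum is the single point 0, of measure zero; the empty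
      matrix sum has determinant 0.\<close>
    have "measure lebesgue {0 :: real^'n::{finite,wellorder}} = 0"
      by (rule negligible_imp_measure0) simp
    then show ?thesis using True by (simp add: det_def set_zero zero_power)
  next
    case False
    then have "gradient_model (\<Sum>j\<in>J. P j) (\<lambda>x. \<Sum>j\<in>J. H j x)"
      by (intro gradient_model_sum assms) auto
    then show ?thesis using gradient_model_volume by blast
  qed
  show "integrable lebesgue (\<lambda>x. mixed_disc (\<lambda>j. H j x))"
    unfolding mixed_disc_alternating using 1 by (intro Bochner_Integration.integrable_sum) auto
  show "(\<integral>x. mixed_disc (\<lambda>j. H j x) \<partial>lebesgue) = polar_volume P"
    unfolding mixed_disc_alternating polar_volume_def using 1 by (subst Bochner_Integration.integral_sum) auto
qed

lemma mixed_disc_upd_app: "(\<lambda>i. (H(j := G)) i x) = (\<lambda>i. H i x)(j := G x)"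
  by auto

text \<open>Additivity of \<open>mixed_disc\<close> in one argument passes to the integral, since
  the sum of two gradient models is one for \<open>A + B\<close>.\<close>

lemma polar_volume_gradient_model_add:
  fixes P :: "'n \<Rightarrow> (real^'n::{finite,wellorder}) set"
  assumes P: "\<And>i. i \<noteq> j \<Longrightarrow> gradient_model (P i) (H i)" and AB: "gradient_model A G" "gradient_model B G'"
  shows "polar_volume (P(j := A + B)) = polar_volume (P(j := A)) + polar_volume (P(j := B))"
proof -
  have a: "gradient_model ((P(j := A)) i) ((H(j := G)) i)" for i
    using P AB by simp
  have b: "gradient_model ((P(j := B)) i) ((H(j := G')) i)" for i
    using P AB by simp
  have c: "gradient_model ((P(j := A + B)) i) ((H(j := (\<lambda>x. G x + G' x))) i)" for i
    using P gradient_model_add[OF AB] by simp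
  show ?thesis
    using polar_volume_gradient_model[of "P(j := A)" "H(j := G)", OF a]
      polar_volume_gradient_model[of "P(j := B)" "H(j := G')", OF b]
      polar_volume_gradient_model(2)[of "P(j := A + B)" "H(j := (\<lambda>x. G x + G' x))", OF c]
    by (simp add: mixed_disc_upd_app mixed_disc_upd_add del: fun_upd_apply)
qed

lemma polar_volume_gradient_model_scaleR:
  fixes P :: "'n \<Rightarrow> (real^'n::{finite,wellorder}) set"
  assumes P: "\<And>i. i \<noteq> j \<Longrightarrow> gradient_model (P i) (H i)" and A: "gradient_model A G" and t: "t > 0"
  shows "polar_volume (P(j := (*\<^sub>R) t ` A)) = t * polar_volume (P(j := A))"
proof -
  have a: "gradient_model ((P(j := A)) i) ((H(j := G)) i)" for i
    using P A by simp
  have c: "gradient_model ((P(j := (*\<^sub>R) t ` A)) i) ((H(j := (\<lambda>x. t *\<^sub>R G x))) i)" for i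
    using P gradient_model_scaleR[OF A t] by simp
  show ?thesis
    using polar_volume_gradient_model[of "P(j := A)" "H(j := G)", OF a]
      polar_volume_gradient_model(2)[of "P(j := (*\<^sub>R) t ` A)" "H(j := (\<lambda>x. t *\<^sub>R G x))", OF c]
    by (simp add: mixed_disc_upd_app mixed_disc_upd_scaleR del: fun_upd_apply)
qed

text \<open>Shrinking to zero the weights of the points of \<open>Y2 - Y1\<close> does not change the image of the
  gradient map, but its Hessian tends to the one for \<open>Y1\<close>, so Fatou's lemma applies.\<close>
lemma polar_volume_polytope_mono:
  fixes P :: "'n \<Rightarrow> (real^'n::{finite,wellorder}) set"
  assumes P: "\<And>i. i \<noteq> j \<Longrightarrow> gradient_model (P i) (H i)"
    and Y: "finite Y2" "Y1 \<subseteq> Y2" "interior (convex hull Y1) \<noteq> {}"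
  shows "polar_volume (P(j := convex hull Y1)) \<le> polar_volume (P(j := convex hull Y2))"
proof -
  \<comment> \<open>Positive for every \<open>m\<close>, so that \<open>gradient_model_lse\<close>
    applies, and tending to the indicator of \<open>Y1\<close>.\<close>
  define w where "w m y = (if y \<in> Y1 then 1 else 1 / Suc m :: real)" for m y
  have fin: "finite Y1" using Y finite_subset by blast
  have ne: "Y1 \<noteq> {}" using Y by auto
  have int: "interior (convex hull Y2) \<noteq> {}"
    using interior_mono[OF hull_mono[OF Y(2)], of convex] Y(3) by blast
  have g1: "gradient_model ((P(j := convex hull Y1)) i) ((H(j := lse_hessian Y1 (\<lambda>_. 1))) i)" for i
    using P gradient_model_lse[OF fin Y(3), of "\<lambda>_. 1"] by simp
  have "gradient_model (convex hull Y2) (lse_hessian Y2 (w m))" for m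
    by (rule gradient_model_lse[OF Y(1) int]) (simp add: w_def)
  then have g2: "gradient_model ((P(j := convex hull Y2)) i) ((H(j := lse_hessian Y2 (w m))) i)" for i m
    using P by simp
  define u where "u x = mixed_disc (\<lambda>i. (H(j := lse_hessian Y1 (\<lambda>_. 1))) i x)" for x
  define v where "v m x = mixed_disc (\<lambda>i. (H(j := lse_hessian Y2 (w m))) i x)" for m x
  have u: "integrable lebesgue u" "integral\<^sup>L lebesgue u = polar_volume (P(j := convex hull Y1))"
    unfolding u_def[abs_def]
    using polar_volume_gradient_model[of "P(j := convex hull Y1)" "H(j := lse_hessian Y1 (\<lambda>_. 1))", OF g1] by blast+
  have v: "integrable lebesgue (v m)" "integral\<^sup>L lebesgue (v m) = polar_volume (P(j := convex hull Y2))" for m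
    unfolding v_def[abs_def]
    using polar_volume_gradient_model[of "P(j := convex hull Y2)" "H(j := lse_hessian Y2 (w m))", OF g2] by blast+
  have "psd ((H(j := lse_hessian Y1 (\<lambda>_. 1))) i x)" for i x
    using g1[where i=i] by (simp add: gradient_model_def)
  then have u0: "u x \<ge> 0" for x unfolding u_def by (rule mixed_disc_nonneg)
  have "psd ((H(j := lse_hessian Y2 (w m))) i x)" for i x m
    using g2[where i=i and m=m] by (simp add: gradient_model_def)
  then have v0: "v m x \<ge> 0" for m x unfolding v_def by (rule mixed_disc_nonneg)
  have lim: "(\<lambda>m. v m x) \<longlonglongrightarrow> u x" for x
  proof -
    have "(\<lambda>m. lse_hessian Y2 (w m) x) \<longlonglongrightarrow> lse_hessian Y1 (\<lambda>_. 1) x"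
    proof (rule lse_hessian_tendsto[OF Y(1,2) ne])
      show "(\<lambda>m. w m y) \<longlonglongrightarrow> (if y \<in> Y1 then 1 else 0)" for y
        unfolding w_def using LIMSEQ_inverse_real_of_nat by (auto simp: inverse_eq_divide)
    qed
    then have "(\<lambda>m. (H(j := lse_hessian Y2 (w m))) i x) \<longlonglongrightarrow> (H(j := lse_hessian Y1 (\<lambda>_. 1))) i x" for i
      by simp
    then show ?thesis
      unfolding v_def u_def mixed_disc_def det_def by (intro tendsto_intros) simp
  qed
  have "ennreal (polar_volume (P(j := convex hull Y1))) = (\<integral>\<^sup>+x. ennreal (u x) \<partial>lebesgue)"
    using nn_integral_eq_integral[OF u(1)] u0 u(2) by simp
  also have "\<dots> = (\<integral>\<^sup>+x. liminf (\<lambda>m. ennreal (v m x)) \<partial>lebesgue)"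
    by (intro nn_integral_cong lim_imp_Liminf[symmetric] tendsto_ennrealI lim) simp
  also have "\<dots> \<le> liminf (\<lambda>m. \<integral>\<^sup>+x. ennreal (v m x) \<partial>lebesgue)"
    by (rule nn_integral_liminf) (use v in \<open>auto intro: borel_measurable_integrable\<close>)
  also have "\<dots> = liminf (\<lambda>m::nat. ennreal (polar_volume (P(j := convex hull Y2))))"
    using nn_integral_eq_integral[OF v(1)] v0 v(2) by simp
  finally have "ennreal (polar_volume (P(j := convex hull Y1))) \<le> ennreal (polar_volume (P(j := convex hull Y2)))"
    by (simp add: Liminf_const)
  moreover have "polar_volume (P(j := convex hull Y2)) \<ge> 0"
    using v(2)[of 0] v0 Bochner_Integration.integral_nonneg[of lebesgue "v 0"] by simp
  ultimately show ?thesis by (simp add: ennreal_le_iff)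
qed

section \<open>Polytopal approximation of convex bodies from outside\<close>

lemma compact_set_plus: "compact A \<Longrightarrow> compact B \<Longrightarrow> compact (A + B)" for A B :: "'a::real_normed_vector set"
proof -
  assume "compact A" "compact B"
  moreover have "A + B = (\<Union>x\<in>A. \<Union>y\<in>B. {x + y})" by (auto simp: set_plus_def)
  ultimately show ?thesis using compact_sums' by metis
qed

lemma convex_body_plus: "convex_body A \<Longrightarrow> convex_body B \<Longrightarrow> convex_body (A + B)"
  by (auto simp: convex_body_def intro: compact_set_plus convex_set_plus)

lemma convex_body_scaleR: "convex_body A \<Longrightarrow> convex_body ((*\<^sub>R) t ` A)"
  by (auto simp: convex_body_def intro: compact_scaling convex_scaling)

lemma convex_body_sing: "convex_body {a}"
  by (simp add: convex_body_def)

lemma convex_body_cball: "r \<ge> 0 \<Longrightarrow> convex_body (cball a r)"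
  by (simp add: convex_body_def)

lemma convex_body_sum: "(\<And>j. j \<in> J \<Longrightarrow> convex_body (K j)) \<Longrightarrow> convex_body (\<Sum>j\<in>J. K j)"
  by (induction J rule: infinite_finite_induct) (auto simp: set_zero convex_body_sing intro: convex_body_plus)

lemma cball_plus_cball: "0 \<le> a \<Longrightarrow> 0 \<le> b \<Longrightarrow> cball 0 a + cball 0 b \<subseteq> cball (0::'a::real_normed_vector) (a + b)"
  by (auto elim!: set_plus_elim intro: norm_triangle_mono)

text \<open>A rate c/(m+1) with one constant for all \<open>m\<close> survives Minkowski sums, and
  containing \<open>K\<close> bounds volumes from below, so that only the upper bound needs a limit
  argument.\<close>

definition outer_approx :: "(nat \<Rightarrow> 'a::euclidean_space set) \<Rightarrow> 'a set \<Rightarrow> bool" where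
  "outer_approx P K \<longleftrightarrow> (\<forall>m. convex_body (P m) \<and> K \<subseteq> P m) \<and>
     (\<exists>c\<ge>0. \<forall>m. P m \<subseteq> K + cball 0 (c / Suc m))"

lemma outer_approx_add:
  assumes "outer_approx P K" "outer_approx Q L"
  shows "outer_approx (\<lambda>m. P m + Q m) (K + L)"
proof -
  obtain c where c: "c \<ge> 0" "\<And>m. P m \<subseteq> K + cball 0 (c / Suc m)"
    using assms(1) by (auto simp: outer_approx_def)
  obtain d where d: "d \<ge> 0" "\<And>m. Q m \<subseteq> L + cball 0 (d / Suc m)"
    using assms(2) by (auto simp: outer_approx_def)
  have "P m + Q m \<subseteq> K + L + cball 0 ((c + d) / Suc m)" for m
  proof -
    have "P m + Q m \<subseteq> (K + cball 0 (c / Suc m)) + (L + cball 0 (d / Suc m))"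
      by (intro set_plus_mono2 c d)
    also have "\<dots> = (K + L) + (cball 0 (c / Suc m) + cball 0 (d / Suc m))" by (simp only: ac_simps)
    also have "\<dots> \<subseteq> K + L + cball 0 (c / Suc m + d / Suc m)"
      using c d by (intro set_plus_mono2 cball_plus_cball) auto
    finally show ?thesis by (simp only: add_divide_distrib)
  qed
  moreover have "K + L \<subseteq> P m + Q m" for m
    using assms unfolding outer_approx_def by (intro set_plus_mono2) blast+
  moreover have "convex_body (P m + Q m)" for m
    using assms unfolding outer_approx_def by (intro convex_body_plus) blast+
  ultimately show ?thesis
    using c(1) d(1) unfolding outer_approx_def by (intro conjI allI exI[of _ "c + d"]) simp_all
qed

lemma outer_approx_scaleR:
  assumes "outer_approx P K" "t > 0"
  shows "outer_approx (\<lambda>m. (*\<^sub>R) t ` P m) ((*\<^sub>R) t ` K)"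
proof -
  obtain c where c: "c \<ge> 0" "\<And>m. P m \<subseteq> K + cball 0 (c / Suc m)"
    using assms(1) by (auto simp: outer_approx_def)
  have "(*\<^sub>R) t ` P m \<subseteq> (*\<^sub>R) t ` K + cball 0 (t * c / Suc m)" for m
  proof clarify
    fix x assume "x \<in> P m"
    then obtain k b where kb: "x = k + b" "k \<in> K" "norm b \<le> c / Suc m"
      using c(2)[of m] by (auto elim!: set_plus_elim)
    then have "norm (t *\<^sub>R b) \<le> t * c / Suc m"
      using assms(2) mult_left_mono[of "norm b" "c / Suc m" t] by simp
    then show "t *\<^sub>R x \<in> (*\<^sub>R) t ` K + cball 0 (t * c / Suc m)"
      using kb by (auto simp: scaleR_add_right intro!: set_plus_intro)
  qed
  then show ?thesis
    using assms c(1) unfolding outer_approx_def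
    by (intro conjI allI exI[of _ "t * c"] image_mono convex_body_scaleR) auto
qed

lemma outer_approx_sum:
  fixes K :: "'i \<Rightarrow> 'a::euclidean_space set"
  assumes "\<And>j. j \<in> J \<Longrightarrow> outer_approx (\<lambda>m. P m j) (K j)"
  shows "outer_approx (\<lambda>m. \<Sum>j\<in>J. P m j) (\<Sum>j\<in>J. K j)"
proof -
  have "outer_approx (\<lambda>m. 0) (0 :: 'a set)"
    by (auto simp: outer_approx_def set_zero convex_body_sing intro!: exI[of _ 0])
  then show ?thesis
    using assms by (induction J rule: infinite_finite_induct) (auto intro: outer_approx_add)
qed

text \<open>The volumes are squeezed between that of \<open>K\<close> and those of parallel bodies
  of \<open>K\<close>, which decrease to \<open>K\<close> because \<open>K\<close> is
  closed.\<close>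

lemma outer_approx_measure:
  assumes "outer_approx P K" "compact K"
  shows "(\<lambda>m. measure lebesgue (P m)) \<longlonglongrightarrow> measure lebesgue K"
proof -
  obtain c where c: "c \<ge> 0" "\<And>m. P m \<subseteq> K + cball 0 (c / Suc m)"
    using assms(1) by (auto simp: outer_approx_def)
  define A where "A m = K + cball 0 (c / Suc m)" for m
  have comp: "compact (A m)" for m unfolding A_def by (intro compact_set_plus assms(2) compact_cball)
  have "decseq A"
    unfolding A_def using c(1)
    by (intro decseq_SucI set_plus_mono2 subset_cball order_refl divide_left_mono) auto
  have "(\<Inter>m. A m) = K"
  proof
    show "K \<subseteq> (\<Inter>m. A m)"
      using c(1) set_plus_intro[of _ K 0] by (fastforce simp: A_def)
    show "(\<Inter>m. A m) \<subseteq> K"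
    proof
      fix x assume x: "x \<in> (\<Inter>m. A m)"
      have "\<exists>k\<in>K. dist k x < e" if "e > 0" for e
      proof -
        obtain m where m: "c / e < real m" using reals_Archimedean2 by blast
        obtain k b where kb: "x = k + b" "k \<in> K" "norm b \<le> c / Suc m"
        proof -
          have "x \<in> K + cball 0 (c / Suc m)" using x unfolding A_def by blast
          then show ?thesis by (elim set_plus_elim) (auto intro: that)
        qed
        have "c < e * Suc m" using m that by (simp add: field_simps)
        then have "c / Suc m < e" by (simp add: field_simps)
        then show ?thesis using kb by (intro bexI[of _ k]) (auto simp: dist_norm)
      qed
      then have "x \<in> closure K" by (simp add: closure_approachable)
      then show "x \<in> K" using compact_imp_closed[OF assms(2)] by simp
    qed
  qed
  moreover have "(\<lambda>m. measure lebesgue (A m)) \<longlonglongrightarrow> measure lebesgue (\<Inter>m. A m)"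
  proof (rule Lim_measure_decseq[OF _ \<open>decseq A\<close>])
    show "range A \<subseteq> sets lebesgue" using comp by (auto intro: lmeasurable_compact fmeasurableD)
    show "emeasure lebesgue (A m) \<noteq> \<infinity>" for m
      using lmeasurable_compact[OF comp, of m] by (auto simp: fmeasurable_def)
  qed
  ultimately have up: "(\<lambda>m. measure lebesgue (A m)) \<longlonglongrightarrow> measure lebesgue K" by simp
  have Pc: "compact (P m)" "K \<subseteq> P m" for m using assms(1) by (auto simp: outer_approx_def convex_body_def)
  have "measure lebesgue K \<le> measure lebesgue (P m)" "measure lebesgue (P m) \<le> measure lebesgue (A m)" for m
    using c(2)[of m] Pc[of m] assms(2) comp[of m]
    by (auto intro!: measure_mono_fmeasurable lmeasurable_compact fmeasurableD[OF lmeasurable_compact] simp: A_def)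
  then show ?thesis
    by (intro tendsto_sandwich[OF _ _ tendsto_const up]) auto
qed

text \<open>Finitely many small cubes centred in \<open>K\<close> cover \<open>K\<close>; the hull
  of their vertices is the polytope. The cubes also provide interior points when \<open>K\<close>
  itself is lower-dimensional, as \<open>gradient_model_lse\<close> requires.\<close>

lemma polytope_outer_approx:
  fixes K :: "'a::euclidean_space set"
  assumes K: "convex_body K"
  shows "\<exists>Y. (\<forall>m. finite (Y m) \<and> interior (convex hull (Y m)) \<noteq> {}) \<and>
    outer_approx (\<lambda>m. convex hull (Y m)) K"
proof -
  have "\<exists>Y. finite Y \<and> interior (convex hull Y) \<noteq> {} \<and> K \<subseteq> convex hull Y \<and> convex hull Y \<subseteq> K + cball 0 e"
    if e: "e > 0" for e :: real
  proof -
    \<comment> \<open>Half the edge length, chosen so that the l1 bound on the norm places each cube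
      in the ball of radius \<open>e\<close> about its centre.\<close>
    define d where "d = e / DIM('a)"
    have d: "d > 0" using e by (simp add: d_def)
    define b where "b = (\<Sum>i\<in>Basis. d *\<^sub>R i :: 'a)"
    have bi: "b \<bullet> i = d" if "i \<in> Basis" for i
      using that by (simp add: b_def inner_sum_left inner_Basis if_distrib sum.delta cong: if_cong)
    have "\<exists>S. finite S \<and> cbox (x - b) (x + b) = convex hull S" for x
      using cube_convex_hull[OF d, of x] unfolding b_def by metis
    then obtain V where V: "\<And>x. finite (V x)" "\<And>x. cbox (x - b) (x + b) = convex hull (V x)" by metis
    have xin: "x \<in> box (x - b) (x + b)" for x using d by (simp add: mem_box bi inner_diff_left inner_add_left)
    have small: "cbox (x - b) (x + b) \<subseteq> cball x e" for x
    proof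
      fix y assume y: "y \<in> cbox (x - b) (x + b)"
      have "norm (y - x) \<le> (\<Sum>i\<in>Basis. \<bar>(y - x) \<bullet> i\<bar>)" by (rule norm_le_l1)
      also have "\<dots> \<le> (\<Sum>i\<in>(Basis::'a set). d)"
        using y by (intro sum_mono) (fastforce simp: mem_box bi inner_diff_left inner_add_left abs_le_iff)
      also have "\<dots> = e" by (simp add: d_def)
      finally show "y \<in> cball x e" by (simp add: dist_norm norm_minus_commute)
    qed
    have "compact K" "K \<noteq> {}" "convex K" using K by (auto simp: convex_body_def)
    have "K \<subseteq> (\<Union>x\<in>K. box (x - b) (x + b))" using xin by auto
    then obtain F where F: "F \<subseteq> K" "finite F" "K \<subseteq> (\<Union>x\<in>F. box (x - b) (x + b))"
      using \<open>compact K\<close> by (rule_tac compactE_image[of K K "\<lambda>x. box (x - b) (x + b)"]) auto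
    define Y where "Y = (\<Union>x\<in>F. V x)"
    have sub: "cbox (x - b) (x + b) \<subseteq> convex hull Y" if "x \<in> F" for x
      unfolding V(2) Y_def using that by (intro hull_mono) auto
    obtain x where x: "x \<in> F" using F \<open>K \<noteq> {}\<close> by auto
    have "box (x - b) (x + b) \<subseteq> interior (convex hull Y)"
      using sub[OF x] by (intro interior_maximal) (auto intro: subsetD[OF box_subset_cbox] open_box)
    then have "interior (convex hull Y) \<noteq> {}" using xin by auto
    moreover have "K \<subseteq> convex hull Y"
      using F(3) sub box_subset_cbox by (fastforce dest: subsetD)
    moreover have "convex hull Y \<subseteq> K + cball 0 e"
    proof (rule hull_minimal)
      show "convex (K + cball 0 e)" by (intro convex_set_plus \<open>convex K\<close> convex_cball)
      show "Y \<subseteq> K + cball 0 e"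
      proof
        fix y assume "y \<in> Y"
        then obtain x where x: "x \<in> F" "y \<in> V x" by (auto simp: Y_def)
        then have "y \<in> cball x e" using small[of x] hull_inc[of y "V x" convex] V(2)[of x] by auto
        then have "x + (y - x) \<in> K + cball 0 e"
          using x F by (intro set_plus_intro) (auto simp: dist_norm norm_minus_commute)
        then show "y \<in> K + cball 0 e" by simp
      qed
    qed
    ultimately show ?thesis using F V by (intro exI[of _ Y]) (auto simp: Y_def)
  qed
  then have "\<forall>m. \<exists>Y. finite Y \<and> interior (convex hull Y) \<noteq> {} \<and> K \<subseteq> convex hull Y \<and>
      convex hull Y \<subseteq> K + cball 0 (1 / Suc m)" by simp
  then obtain Y where Y: "\<And>m. finite (Y m)" "\<And>m. interior (convex hull (Y m)) \<noteq> {}"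
    "\<And>m. K \<subseteq> convex hull (Y m)" "\<And>m. convex hull (Y m) \<subseteq> K + cball 0 (1 / Suc m)"
    by metis
  have "convex_body (convex hull (Y m))" for m
    using Y(1,2)[of m] by (auto simp: convex_body_def intro!: finite_imp_compact_convex_hull)
  then have "outer_approx (\<lambda>m. convex hull (Y m)) K"
    unfolding outer_approx_def by (intro conjI allI exI[of _ 1] Y) simp_all
  with Y(1,2) show ?thesis by blast
qed

lemma polar_volume_tendsto:
  assumes "\<And>j. outer_approx (\<lambda>m. P m j) (K j)" "\<And>j. convex_body (K j)"
  shows "(\<lambda>m. polar_volume (P m)) \<longlonglongrightarrow> polar_volume K"
  unfolding polar_volume_def
proof (intro tendsto_intros outer_approx_measure outer_approx_sum assms)
  show "compact (\<Sum>j\<in>J. K j)" for J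
    using convex_body_sum[of J K] assms(2) by (simp add: convex_body_def)
qed

lemma polytope_outer_approx_family:
  assumes "\<And>i. convex_body (K i)"
  shows "\<exists>Y. (\<forall>i m. finite (Y i m) \<and> interior (convex hull (Y i m)) \<noteq> {}) \<and>
    (\<forall>i. outer_approx (\<lambda>m. convex hull (Y i m)) (K i))"
proof -
  have "\<forall>i. \<exists>Y. (\<forall>m. finite (Y m)) \<and> (\<forall>m. interior (convex hull (Y m)) \<noteq> {}) \<and>
      outer_approx (\<lambda>m. convex hull (Y m)) (K i)"
    using polytope_outer_approx[OF assms] by metis
  then show ?thesis by metis
qed

section \<open>Passage from polytopes to arbitrary convex bodies\<close>

context
  fixes K :: "'n \<Rightarrow> (real^'n::{finite,wellorder}) set"
  assumes K: "\<And>i. convex_body (K i)"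
begin

lemma polar_volume_tendsto_upd:
  assumes "\<And>i. outer_approx (\<lambda>m. P i m) (K i)" "outer_approx Q L" "convex_body L"
  shows "(\<lambda>m. polar_volume ((\<lambda>i. P i m)(j := Q m))) \<longlonglongrightarrow> polar_volume (K(j := L))"
  by (rule polar_volume_tendsto) (use assms K in auto)

text \<open>The identity holds for the approximating polytopes, all of which have interior points,
  and passes to the limit since \<open>outer_approx\<close> is stable under sums.\<close>

lemma polar_volume_add:
  assumes A: "convex_body A" and B: "convex_body B"
  shows "polar_volume (K(j := A + B)) = polar_volume (K(j := A)) + polar_volume (K(j := B))"
proof -
  obtain Y where Y: "\<And>i m. finite (Y i m)" "\<And>i m. interior (convex hull (Y i m)) \<noteq> {}"
    "\<And>i. outer_approx (\<lambda>m. convex hull (Y i m)) (K i)"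
    using polytope_outer_approx_family[of K, OF K] by blast
  obtain YA where YA: "\<And>m. finite (YA m)" "\<And>m. interior (convex hull (YA m)) \<noteq> {}"
    "outer_approx (\<lambda>m. convex hull (YA m)) A"
    using polytope_outer_approx[OF A] by blast
  obtain YB where YB: "\<And>m. finite (YB m)" "\<And>m. interior (convex hull (YB m)) \<noteq> {}"
    "outer_approx (\<lambda>m. convex hull (YB m)) B"
    using polytope_outer_approx[OF B] by blast
  have eq: "polar_volume ((\<lambda>i. convex hull (Y i m))(j := convex hull (YA m) + convex hull (YB m)))
      = polar_volume ((\<lambda>i. convex hull (Y i m))(j := convex hull (YA m)))
      + polar_volume ((\<lambda>i. convex hull (Y i m))(j := convex hull (YB m)))" for m
    by (rule polar_volume_gradient_model_add gradient_model_lse[where w="\<lambda>_. 1"] Y YA YB zero_less_one)+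
  have "(\<lambda>m. polar_volume ((\<lambda>i. convex hull (Y i m))(j := convex hull (YA m)))
      + polar_volume ((\<lambda>i. convex hull (Y i m))(j := convex hull (YB m)))) \<longlonglongrightarrow> polar_volume (K(j := A)) + polar_volume (K(j := B))"
    by (intro tendsto_add polar_volume_tendsto_upd Y YA YB A B)
  moreover have "(\<lambda>m. polar_volume ((\<lambda>i. convex hull (Y i m))(j := convex hull (YA m) + convex hull (YB m))))
      \<longlonglongrightarrow> polar_volume (K(j := A + B))"
    by (intro polar_volume_tendsto_upd Y outer_approx_add YA YB convex_body_plus A B)
  ultimately show ?thesis
    unfolding eq using LIMSEQ_unique by blast
qed

lemma polar_volume_scaleR:
  assumes A: "convex_body A" and t: "t > 0"
  shows "polar_volume (K(j := (*\<^sub>R) t ` A)) = t * polar_volume (K(j := A))"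
proof -
  obtain Y where Y: "\<And>i m. finite (Y i m)" "\<And>i m. interior (convex hull (Y i m)) \<noteq> {}"
    "\<And>i. outer_approx (\<lambda>m. convex hull (Y i m)) (K i)"
    using polytope_outer_approx_family[of K, OF K] by blast
  obtain YA where YA: "\<And>m. finite (YA m)" "\<And>m. interior (convex hull (YA m)) \<noteq> {}"
    "outer_approx (\<lambda>m. convex hull (YA m)) A"
    using polytope_outer_approx[OF A] by blast
  have eq: "polar_volume ((\<lambda>i. convex hull (Y i m))(j := (*\<^sub>R) t ` (convex hull (YA m))))
      = t * polar_volume ((\<lambda>i. convex hull (Y i m))(j := convex hull (YA m)))" for m
    by (rule polar_volume_gradient_model_scaleR gradient_model_lse[where w="\<lambda>_. 1"] Y YA t zero_less_one)+
  have "(\<lambda>m. t * polar_volume ((\<lambda>i. convex hull (Y i m))(j := convex hull (YA m)))) \<longlonglongrightarrow> t * polar_volume (K(j := A))"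
    by (intro tendsto_mult tendsto_const polar_volume_tendsto_upd Y YA A)
  moreover have "(\<lambda>m. polar_volume ((\<lambda>i. convex hull (Y i m))(j := (*\<^sub>R) t ` (convex hull (YA m)))))
      \<longlonglongrightarrow> polar_volume (K(j := (*\<^sub>R) t ` A))"
    by (intro polar_volume_tendsto_upd Y outer_approx_scaleR YA t convex_body_scaleR A)
  ultimately show ?thesis
    unfolding eq using LIMSEQ_unique by blast
qed

lemma polar_volume_mono:
  assumes A: "convex_body A" and B: "convex_body B" and AB: "A \<subseteq> B"
  shows "polar_volume (K(j := A)) \<le> polar_volume (K(j := B))"
proof -
  obtain Y where Y: "\<And>i m. finite (Y i m)" "\<And>i m. interior (convex hull (Y i m)) \<noteq> {}"
    "\<And>i. outer_approx (\<lambda>m. convex hull (Y i m)) (K i)"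
    using polytope_outer_approx_family[of K, OF K] by blast
  obtain YA where YA: "\<And>m. finite (YA m)" "\<And>m. interior (convex hull (YA m)) \<noteq> {}"
    "outer_approx (\<lambda>m. convex hull (YA m)) A"
    using polytope_outer_approx[OF A] by blast
  obtain YB where YB: "\<And>m. finite (YB m)" "\<And>m. interior (convex hull (YB m)) \<noteq> {}"
    "outer_approx (\<lambda>m. convex hull (YB m)) B"
    using polytope_outer_approx[OF B] by blast
  \<comment> \<open>The approximants of \<open>A\<close> need not lie in those of \<open>B\<close>.
    Adjoining the vertices of both gives a nested pair and still approximates \<open>B\<close>,
    because \<open>A\<close> is contained in \<open>B\<close>.\<close>
  have "outer_approx (\<lambda>m. convex hull (YA m \<union> YB m)) B"
  proof -
    obtain c where c: "c \<ge> 0" "\<And>m. convex hull (YA m) \<subseteq> A + cball 0 (c / Suc m)"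
      using YA(3) by (auto simp: outer_approx_def)
    obtain d where d: "d \<ge> 0" "\<And>m. convex hull (YB m) \<subseteq> B + cball 0 (d / Suc m)"
      using YB(3) by (auto simp: outer_approx_def)
    have "convex hull (YA m \<union> YB m) \<subseteq> B + cball 0 (max c d / Suc m)" for m
    proof (rule hull_minimal)
      show "convex (B + cball 0 (max c d / Suc m))"
        using B by (intro convex_set_plus convex_cball) (simp add: convex_body_def)
      have "A + cball 0 (c / Suc m) \<subseteq> B + cball 0 (max c d / Suc m)"
        "B + cball 0 (d / Suc m) \<subseteq> B + cball 0 (max c d / Suc m)"
        using AB by (intro set_plus_mono2 subset_cball divide_right_mono; simp)+
      then show "YA m \<union> YB m \<subseteq> B + cball 0 (max c d / Suc m)"
        using c(2)[of m] d(2)[of m] hull_subset[of "YA m" convex] hull_subset[of "YB m" convex] by blast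
    qed
    moreover have "B \<subseteq> convex hull (YA m \<union> YB m)" for m
      using YB(3) hull_mono[of "YB m" "YA m \<union> YB m" convex] by (auto simp: outer_approx_def)
    moreover have "convex_body (convex hull (YA m \<union> YB m))" for m
      using YA(1,2)[of m] YB(1)[of m] by (auto simp: convex_body_def intro!: finite_imp_compact_convex_hull)
    ultimately show ?thesis unfolding outer_approx_def using c(1) by (auto intro!: exI[of _ "max c d"])
  qed
  then have "(\<lambda>m. polar_volume ((\<lambda>i. convex hull (Y i m))(j := convex hull (YA m \<union> YB m)))) \<longlonglongrightarrow> polar_volume (K(j := B))"
    by (intro polar_volume_tendsto_upd Y B)
  moreover have "(\<lambda>m. polar_volume ((\<lambda>i. convex hull (Y i m))(j := convex hull (YA m)))) \<longlonglongrightarrow> polar_volume (K(j := A))"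
    by (intro polar_volume_tendsto_upd Y YA A)
  moreover have "polar_volume ((\<lambda>i. convex hull (Y i m))(j := convex hull (YA m)))
      \<le> polar_volume ((\<lambda>i. convex hull (Y i m))(j := convex hull (YA m \<union> YB m)))" for m
    by (rule polar_volume_polytope_mono[OF gradient_model_lse[where w="\<lambda>_. 1"]]) (use Y YA YB in auto)
  ultimately show ?thesis
    by (intro LIMSEQ_le) auto
qed

end

section \<open>Mixed volumes of lists: reindexing and symmetry\<close>

lemma mixed_volume_eq_polar_volume:
  fixes Ks :: "(real^'n) set list"
  assumes len: "length Ks = CARD('n)" and ix: "bij_betw ix (UNIV :: 'n set) {..<CARD('n)}"
  shows "mixed_volume Ks = polar_volume (\<lambda>j. Ks ! ix j) / fact CARD('n)"
proof -
  have inj: "inj ix" using ix by (simp add: bij_betw_def)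
  have "bij_betw ((`) ix) (Pow UNIV) (Pow {..<CARD('n)})" using ix by (rule bij_betw_Pow)
  then have "(\<Sum>J\<in>Pow {..<CARD('n)}. (-1) ^ (CARD('n) - card J) * measure lebesgue (\<Sum>j\<in>J. Ks ! j))
     = (\<Sum>J\<in>Pow UNIV. (-1) ^ (CARD('n) - card (ix ` J)) * measure lebesgue (\<Sum>j\<in>ix ` J. Ks ! j))"
    by (rule sum.reindex_bij_betw[symmetric])
  also have "\<dots> = polar_volume (\<lambda>j. Ks ! ix j)"
  proof -
    have "card (ix ` J) = card J" "(\<Sum>j\<in>ix ` J. Ks ! j) = (\<Sum>j\<in>J. Ks ! ix j)" for J
      using inj by (auto simp: card_image sum.reindex inj_on_subset)
    then show ?thesis by (simp add: polar_volume_def)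
  qed
  finally show ?thesis by (simp add: mixed_volume_def len)
qed

lemma mixed_volume_permute:
  assumes "length Ls = length Ks" "bij_betw p {..<length Ks} {..<length Ks}"
    "\<And>j. j < length Ks \<Longrightarrow> Ls ! j = Ks ! p j"
  shows "mixed_volume Ls = mixed_volume Ks"
proof -
  let ?n = "length Ks"
  have inj: "inj_on p {..<?n}" using assms by (simp add: bij_betw_def)
  have "bij_betw ((`) p) (Pow {..<?n}) (Pow {..<?n})" using assms(2) by (rule bij_betw_Pow)
  then have "(\<Sum>J\<in>Pow {..<?n}. (-1) ^ (?n - card J) * measure lebesgue (\<Sum>j\<in>J. Ks ! j))
     = (\<Sum>J\<in>Pow {..<?n}. (-1) ^ (?n - card (p ` J)) * measure lebesgue (\<Sum>j\<in>p ` J. Ks ! j))"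
    by (rule sum.reindex_bij_betw[symmetric])
  also have "\<dots> = (\<Sum>J\<in>Pow {..<?n}. (-1) ^ (?n - card J) * measure lebesgue (\<Sum>j\<in>J. Ls ! j))"
  proof (rule sum.cong[OF refl])
    fix J assume J: "J \<in> Pow {..<?n}"
    then have "inj_on p J" using inj inj_on_subset by blast
    moreover have "(\<Sum>j\<in>J. Ls ! j) = (\<Sum>j\<in>J. Ks ! p j)"
      using J assms(3) by (intro sum.cong) auto
    ultimately show "(-1) ^ (?n - card (p ` J)) * measure lebesgue (\<Sum>j\<in>p ` J. Ks ! j)
        = (-1) ^ (?n - card J) * measure lebesgue (\<Sum>j\<in>J. Ls ! j)"
      by (simp add: card_image sum.reindex)
  qed
  finally show ?thesis by (simp add: mixed_volume_def assms(1))
qed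

lemma mixed_volume_swap: "mixed_volume (A # B # Ks) = mixed_volume (B # A # Ks)"
proof (rule mixed_volume_permute)
  let ?n = "length (B # A # Ks)"
  let ?p = "Transposition.transpose 0 (1::nat)"
  show "bij_betw ?p {..<?n} {..<?n}"
    by (rule bij_betwI[of _ _ _ ?p]) (auto simp: Transposition.transpose_def)
  show "(A # B # Ks) ! j = (B # A # Ks) ! Transposition.transpose 0 1 j" if "j < ?n" for j
    by (cases j rule: nat.exhaust[case_product nat.exhaust])
      (auto simp: Transposition.transpose_def nth_Cons split: nat.split)
qed simp

lemma ex_index_bij: "\<exists>ix j. bij_betw ix (UNIV :: 'n::finite set) {..<CARD('n)} \<and> ix j = 0"
proof -
  obtain ix where ix: "bij_betw ix (UNIV :: 'n set) {..<CARD('n)}"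
    using ex_bij_betw_finite_nat[of "UNIV :: 'n set"] by (auto simp: atLeast0LessThan)
  have "0 \<in> ix ` UNIV" using ix by (auto simp: bij_betw_def)
  then show ?thesis using ix by (auto intro!: exI[of _ ix])
qed

lemma mixed_volume_Cons_eq_polar_volume:
  assumes "bodies": "\<forall>K\<in>set Ks. convex_body (K :: (real^'n) set)" and len: "Suc (length Ks) = CARD('n)"
  obtains K :: "'n \<Rightarrow> (real^'n) set" and j where "\<And>i. convex_body (K i)"
    "\<And>L. mixed_volume (L # Ks) = polar_volume (K(j := L)) / fact CARD('n)"
proof -
  obtain ix j where ix: "bij_betw ix (UNIV :: 'n set) {..<CARD('n)}" "ix j = 0"
    using ex_index_bij by blast
  have inj: "ix i = 0 \<longleftrightarrow> i = j" for i
    using ix by (auto simp: bij_betw_def inj_def)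
  \<comment> \<open>Slot \<open>j\<close> holds a placeholder that is overwritten by the first
    body.\<close>
  define K where "K i = ({0} # Ks) ! ix i" for i
  have "convex_body (K i)" for i
  proof -
    have "ix i < Suc (length Ks)" using ix(1) len by (auto simp: bij_betw_def)
    then have "K i \<in> set ({0} # Ks)" unfolding K_def by (intro nth_mem) simp
    then show ?thesis using assms(1) by (auto simp: convex_body_sing)
  qed
  moreover have "mixed_volume (L # Ks) = polar_volume (K(j := L)) / fact CARD('n)" for L
  proof -
    have "(\<lambda>i. (L # Ks) ! ix i) = K(j := L)"
      by (rule ext) (auto simp: K_def nth_Cons inj ix(2) split: nat.split)
    then show ?thesis using mixed_volume_eq_polar_volume[of "L # Ks" ix] ix(1) len by simp
  qed
  ultimately show thesis by (rule that)
qed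

text \<open>The library proves the change-of-variables theorem only for well-ordered index types.\<close>
typedef 'a ord_copy = "UNIV :: 'a set" ..

lemma bij_Rep_ord_copy: "bij Rep_ord_copy"
  by (metis Abs_ord_copy_inverse Rep_ord_copy_inverse UNIV_I bijI')

instance ord_copy :: (finite) finite
proof
  have "inj (Rep_ord_copy :: 'a ord_copy \<Rightarrow> 'a)" using bij_Rep_ord_copy by (rule bij_is_inj)
  then show "finite (UNIV :: 'a ord_copy set)" by (rule finite_imageD[rotated]) simp
qed

definition ord_index :: "'a::finite \<Rightarrow> nat" where
  "ord_index = (SOME f. inj f)"

lemma inj_ord_index: "inj ord_index"
proof -
  obtain f :: "'a \<Rightarrow> nat" where "inj f" using finite_imp_inj_to_nat_seg[of "UNIV :: 'a set"] by auto
  then show ?thesis unfolding ord_index_def by (rule someI[where P=inj])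
qed

instantiation ord_copy :: (finite) wellorder
begin
definition "x \<le> y \<longleftrightarrow> ord_index (Rep_ord_copy x) \<le> ord_index (Rep_ord_copy y)"
definition "x < y \<longleftrightarrow> ord_index (Rep_ord_copy x) < ord_index (Rep_ord_copy y)"
instance
proof
  fix x y :: "'a ord_copy"
  show "x \<le> y \<Longrightarrow> y \<le> x \<Longrightarrow> x = y"
    by (metis antisym injD inj_ord_index less_eq_ord_copy_def Rep_ord_copy_inject)
next
  fix P :: "'a ord_copy \<Rightarrow> bool" and a :: "'a ord_copy"
  assume hyp: "\<And>x. (\<And>y. y < x \<Longrightarrow> P y) \<Longrightarrow> P x"
  show "P a"
  proof (induction "ord_index (Rep_ord_copy a)" arbitrary: a rule: less_induct)
    case less
    show ?case by (rule hyp) (rule less, simp add: less_ord_copy_def)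
  qed
qed (auto simp: less_eq_ord_copy_def less_ord_copy_def)
end

lemma card_ord_copy: "CARD('n::finite ord_copy) = CARD('n)"
  using bij_betw_same_card[OF bij_Rep_ord_copy] by simp

definition to_ord :: "real^'n \<Rightarrow> real^'n ord_copy" where
  "to_ord x = (\<chi> i. x $ Rep_ord_copy i)"

definition of_ord :: "real^'n ord_copy \<Rightarrow> real^'n" where
  "of_ord x = (\<chi> i. x $ Abs_ord_copy i)"

lemma of_to_ord [simp]: "of_ord (to_ord x) = x" "to_ord (of_ord y) = y"
  by (simp_all add: of_ord_def to_ord_def vec_eq_iff Abs_ord_copy_inverse Rep_ord_copy_inverse)

lemma linear_to_ord: "linear to_ord"
  by (intro linearI) (auto simp: to_ord_def vec_eq_iff)

lemma to_ord_zero: "to_ord 0 = 0" and to_ord_add: "to_ord (x + y) = to_ord x + to_ord y"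
  using linear_0[OF linear_to_ord] linear_add[OF linear_to_ord] by auto

lemma to_ord_plus: "to_ord ` (A + B) = to_ord ` A + to_ord ` B"
proof
  show "to_ord ` (A + B) \<subseteq> to_ord ` A + to_ord ` B"
    by (auto elim!: set_plus_elim simp: to_ord_add intro!: set_plus_intro imageI)
  show "to_ord ` A + to_ord ` B \<subseteq> to_ord ` (A + B)"
  proof
    fix z assume "z \<in> to_ord ` A + to_ord ` B"
    then obtain a b where "z = to_ord (a + b)" "a \<in> A" "b \<in> B"
      by (auto elim!: set_plus_elim simp: to_ord_add)
    then show "z \<in> to_ord ` (A + B)" by blast
  qed
qed

lemma continuous_on_to_ord: "continuous_on S to_ord"
  using linear_to_ord by (intro linear_continuous_on) (simp add: linear_conv_bounded_linear)

text \<open>Relabelling coordinates maps boxes to boxes with the same edge lengths, and values on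
  boxes characterise Lebesgue measure.\<close>

lemma lborel_ord: "lborel = distr lborel borel (to_ord :: real^'n \<Rightarrow> _)"
proof (rule lborel_eqI)
  have m: "(to_ord :: real^'n \<Rightarrow> _) \<in> borel_measurable borel"
    by (intro borel_measurable_continuous_onI continuous_on_to_ord)
  fix l u :: "real^'n ord_copy" assume lu: "\<And>b. b \<in> Basis \<Longrightarrow> l \<bullet> b \<le> u \<bullet> b"
  have le: "l $ i \<le> u $ i" for i using lu[of "axis i 1"] by (simp add: inner_axis Basis_vec_def) blast
  have "to_ord -` box l u = box (of_ord l) (of_ord u)"
    by (auto simp: mem_box_cart to_ord_def of_ord_def) (metis Abs_ord_copy_inverse Rep_ord_copy_inverse UNIV_I)+
  then have "emeasure (distr lborel borel to_ord) (box l u) = emeasure lborel (box (of_ord l) (of_ord u))"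
    using m by (simp add: emeasure_distr)
  also have "\<dots> = ennreal (\<Prod>b\<in>Basis. (of_ord u - of_ord l) \<bullet> b)"
    using le by (subst emeasure_lborel_box) (auto simp: Basis_vec_def inner_axis of_ord_def)
  also have "(\<Prod>b\<in>(Basis::(real^'n) set). (of_ord u - of_ord l) \<bullet> b) = (\<Prod>i\<in>UNIV. (of_ord u - of_ord l) $ i)"
    by (simp add: Basis_vec_def cart_eq_inner_axis axis_eq_axis prod.UNION_disjoint)
  also have "\<dots> = (\<Prod>i\<in>UNIV. (u - l) $ i)"
    using prod.reindex_bij_betw[OF bij_Rep_ord_copy, of "\<lambda>i. (of_ord u - of_ord l) $ i"]
    by (simp add: of_ord_def Rep_ord_copy_inverse)
  also have "\<dots> = (\<Prod>b\<in>Basis. (u - l) \<bullet> b)"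
    by (simp add: Basis_vec_def cart_eq_inner_axis axis_eq_axis prod.UNION_disjoint)
  finally show "emeasure (distr lborel borel to_ord) (box l u) = ennreal (\<Prod>b\<in>Basis. (u - l) \<bullet> b)" .
qed simp

lemma measure_to_ord:
  fixes S :: "(real^'n) set"
  assumes "compact S"
  shows "measure lebesgue (to_ord ` S) = measure lebesgue S"
proof -
  have m: "(to_ord :: real^'n \<Rightarrow> _) \<in> borel_measurable borel"
    by (intro borel_measurable_continuous_onI continuous_on_to_ord)
  have c: "compact (to_ord ` S)" by (intro compact_continuous_image continuous_on_to_ord assms)
  have "to_ord -` (to_ord ` S) = S" using of_to_ord(1) by (metis inj_on_inverseI inj_vimage_image_eq)
  then have "measure (distr lborel borel to_ord) (to_ord ` S) = measure lborel S"
    using m c by (subst measure_distr) (auto simp: borel_compact)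
  then have "measure lborel (to_ord ` S) = measure lborel S"
    by (subst lborel_ord) 
  then show ?thesis using assms c by (simp add: measure_completion borel_compact)
qed

lemma mixed_volume_to_ord:
  fixes Ks :: "(real^'n) set list"
  assumes "\<forall>K\<in>set Ks. convex_body K"
  shows "mixed_volume (map ((`) to_ord) Ks) = mixed_volume Ks"
proof -
  have "measure lebesgue (\<Sum>j\<in>J. map ((`) to_ord) Ks ! j) = measure lebesgue (\<Sum>j\<in>J. Ks ! j)"
    if J: "J \<subseteq> {..<length Ks}" for J
  proof -
    have "to_ord ` (\<Sum>j\<in>J. Ks ! j) = (\<Sum>j\<in>J. ((`) to_ord \<circ> (!) Ks) j)"
      by (subst sum_set_linear) (auto simp: to_ord_zero to_ord_plus)
    also have "\<dots> = (\<Sum>j\<in>J. map ((`) to_ord) Ks ! j)"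
      using J by (intro sum.cong) auto
    finally have "(\<Sum>j\<in>J. map ((`) to_ord) Ks ! j) = to_ord ` (\<Sum>j\<in>J. Ks ! j)" ..
    moreover have "convex_body (\<Sum>j\<in>J. Ks ! j)"
      using J assms by (intro convex_body_sum) (meson lessThan_iff nth_mem subsetD)
    ultimately show ?thesis using measure_to_ord[of "\<Sum>j\<in>J. Ks ! j"] unfolding convex_body_def by metis
  qed
  then show ?thesis by (auto simp: mixed_volume_def intro!: sum.cong)
qed

lemma convex_body_to_ord: "convex_body K \<Longrightarrow> convex_body (to_ord ` K)"
  using linear_to_ord
  by (auto simp: convex_body_def intro: compact_continuous_image continuous_on_to_ord convex_linear_image)

section \<open>Multilinearity and monotonicity of \<open>mixed_volume\<close> in the first
  entry\<close>

context
  fixes Ks :: "(real^'n) set list"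
  assumes Ks: "\<forall>K\<in>set Ks. convex_body K" and len: "Suc (length Ks) = CARD('n)"
begin

lemma mixed_volume_Cons_ord:
  obtains K :: "'n ord_copy \<Rightarrow> (real^'n ord_copy) set" and j where "\<And>i. convex_body (K i)"
    "\<And>L :: (real^'n) set. convex_body L \<Longrightarrow> mixed_volume (L # Ks) = polar_volume (K(j := to_ord ` L)) / fact CARD('n)"
proof -
  have "\<forall>K\<in>set (map ((`) to_ord) Ks). convex_body K" "Suc (length (map ((`) to_ord) Ks)) = CARD('n ord_copy)"
    using Ks len by (auto intro: convex_body_to_ord simp: card_ord_copy)
  from mixed_volume_Cons_eq_polar_volume[OF this] obtain K :: "'n ord_copy \<Rightarrow> (real^'n ord_copy) set" and j where
    K: "\<And>i. convex_body (K i)"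
    "\<And>L. mixed_volume (L # map ((`) to_ord) Ks) = polar_volume (K(j := L)) / fact CARD('n ord_copy)" by blast
  show thesis
  proof (rule that[OF K(1)])
    fix L :: "(real^'n) set" assume "convex_body L"
    then show "mixed_volume (L # Ks) = polar_volume (K(j := to_ord ` L)) / fact CARD('n)"
      using mixed_volume_to_ord[of "L # Ks"] Ks K(2)[of "to_ord ` L"] by (simp add: card_ord_copy)
  qed
qed

lemma mixed_volume_add:
  assumes A: "convex_body A" and B: "convex_body B"
  shows "mixed_volume ((A + B) # Ks) = mixed_volume (A # Ks) + mixed_volume (B # Ks)"
proof -
  obtain K :: "'n ord_copy \<Rightarrow> (real^'n ord_copy) set" and j where K: "\<And>i. convex_body (K i)"
    "\<And>L :: (real^'n) set. convex_body L \<Longrightarrow> mixed_volume (L # Ks) = polar_volume (K(j := to_ord ` L)) / fact CARD('n)"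
    using mixed_volume_Cons_ord by blast
  show ?thesis
    using K(2)[OF A] K(2)[OF B] K(2)[OF convex_body_plus[OF A B]]
      polar_volume_add[OF K(1) convex_body_to_ord[OF A] convex_body_to_ord[OF B]]
    by (simp add: to_ord_plus add_divide_distrib)
qed

lemma mixed_volume_scaleR:
  assumes A: "convex_body A" and "t > 0"
  shows "mixed_volume ((*\<^sub>R) t ` A # Ks) = t * mixed_volume (A # Ks)"
proof -
  obtain K :: "'n ord_copy \<Rightarrow> (real^'n ord_copy) set" and j where K: "\<And>i. convex_body (K i)"
    "\<And>L :: (real^'n) set. convex_body L \<Longrightarrow> mixed_volume (L # Ks) = polar_volume (K(j := to_ord ` L)) / fact CARD('n)"
    using mixed_volume_Cons_ord by blast
  have "to_ord ` (*\<^sub>R) t ` A = (*\<^sub>R) t ` to_ord ` A"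
    by (simp add: image_image linear_scale[OF linear_to_ord])
  then show ?thesis
    using K(2)[OF A] K(2)[OF convex_body_scaleR[OF A]]
      polar_volume_scaleR[OF K(1) convex_body_to_ord[OF A] assms(2)] by simp
qed

lemma mixed_volume_mono:
  assumes A: "convex_body A" and B: "convex_body B" and "A \<subseteq> B"
  shows "mixed_volume (A # Ks) \<le> mixed_volume (B # Ks)"
proof -
  obtain K :: "'n ord_copy \<Rightarrow> (real^'n ord_copy) set" and j where K: "\<And>i. convex_body (K i)"
    "\<And>L :: (real^'n) set. convex_body L \<Longrightarrow> mixed_volume (L # Ks) = polar_volume (K(j := to_ord ` L)) / fact CARD('n)"
    using mixed_volume_Cons_ord by blast
  then show ?thesis
    using polar_volume_mono[OF K(1) convex_body_to_ord[OF A] convex_body_to_ord[OF B] image_mono[OF assms(3)]] A B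
    by (simp add: divide_right_mono)
qed

end

section \<open>Support functions\<close>

lemma inner_le_support_fun:
  assumes "convex_body K" "x \<in> K"
  shows "x \<bullet> u \<le> support_fun K u"
proof -
  have "compact ((\<lambda>x. x \<bullet> u) ` K)"
    using assms by (intro compact_continuous_image continuous_intros) (simp add: convex_body_def)
  then have "bdd_above ((\<lambda>x. x \<bullet> u) ` K)" by (intro bounded_imp_bdd_above compact_imp_bounded)
  then show ?thesis unfolding support_fun_def using assms by (intro cSup_upper) auto
qed

lemma support_fun_attained:
  assumes "convex_body K"
  obtains x where "x \<in> K" "x \<bullet> u = support_fun K u"
proof -
  have "compact K" "K \<noteq> {}" using assms by (auto simp: convex_body_def)
  moreover have "continuous_on K (\<lambda>x. x \<bullet> u)" by (intro continuous_intros)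
  ultimately obtain x where x: "x \<in> K" "\<And>y. y \<in> K \<Longrightarrow> y \<bullet> u \<le> x \<bullet> u"
    using continuous_attains_sup[of K "\<lambda>x. x \<bullet> u"] by auto
  have "support_fun K u = x \<bullet> u"
    unfolding support_fun_def using x by (intro cSup_eq_maximum) auto
  then show thesis using x by (intro that) auto
qed

lemma support_fun_eqI:
  assumes "convex_body K" "\<And>x. x \<in> K \<Longrightarrow> x \<bullet> u \<le> c" "x \<in> K" "x \<bullet> u = c"
  shows "support_fun K u = c"
  using assms(2) inner_le_support_fun[OF assms(1,3), of u] assms(4)
  by (metis assms(1) order_antisym support_fun_attained)

lemma support_fun_plus:
  assumes A: "convex_body A" and B: "convex_body B" and AB: "convex_body (A + B)"
  shows "support_fun (A + B) u = support_fun A u + support_fun B u"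
proof -
  obtain a where a: "a \<in> A" "a \<bullet> u = support_fun A u" using support_fun_attained[OF A] .
  obtain b where b: "b \<in> B" "b \<bullet> u = support_fun B u" using support_fun_attained[OF B] .
  show ?thesis
    by (rule support_fun_eqI[OF AB _ set_plus_intro[OF a(1) b(1)]])
      (auto elim!: set_plus_elim simp: inner_add_left a b intro!: add_mono inner_le_support_fun A B)
qed

lemma support_fun_scaleR:
  assumes A: "convex_body A" and "convex_body ((*\<^sub>R) t ` A)" and t: "t \<ge> 0"
  shows "support_fun ((*\<^sub>R) t ` A) u = t * support_fun A u"
proof -
  obtain a where a: "a \<in> A" "a \<bullet> u = support_fun A u" using support_fun_attained[OF A] .
  show ?thesis
    by (rule support_fun_eqI[OF assms(2) _ imageI[OF a(1)]])
      (auto simp: a intro!: mult_left_mono inner_le_support_fun A t)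
qed

lemma support_fun_homogeneous:
  assumes A: "convex_body A" and t: "t \<ge> 0"
  shows "support_fun A (t *\<^sub>R u) = t * support_fun A u"
proof -
  obtain a where a: "a \<in> A" "a \<bullet> u = support_fun A u" using support_fun_attained[OF A] .
  show ?thesis
    by (rule support_fun_eqI[OF A _ a(1)])
      (auto simp: a intro!: mult_left_mono inner_le_support_fun A t)
qed

lemma support_fun_subadd:
  assumes A: "convex_body A"
  shows "support_fun A (u + v) \<le> support_fun A u + support_fun A v"
proof -
  obtain a where a: "a \<in> A" "a \<bullet> (u + v) = support_fun A (u + v)" using support_fun_attained[OF A] .
  have "a \<bullet> (u + v) \<le> support_fun A u + support_fun A v"
    unfolding inner_add_right using a(1) by (intro add_mono inner_le_support_fun A)
  then show ?thesis using a by simp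
qed

lemma support_fun_sing: "support_fun {a} u = a \<bullet> u"
  by (simp add: support_fun_def)

lemma support_fun_cball:
  assumes "r \<ge> 0"
  shows "support_fun (cball 0 r) u = r * norm u"
proof (rule support_fun_eqI)
  show "convex_body (cball (0::'a) r)" using assms by (simp add: convex_body_def)
  show "x \<bullet> u \<le> r * norm u" if "x \<in> cball 0 r" for x
    using that norm_cauchy_schwarz[of x u] mult_right_mono[of "norm x" r "norm u"] by simp
  show "(r / norm u) *\<^sub>R u \<in> cball 0 r" using assms by simp
  show "(r / norm u) *\<^sub>R u \<bullet> u = r * norm u"
    by (cases "u = 0") (auto simp: power2_norm_eq_inner[symmetric] power2_eq_square)
qed

lemma convex_on_support_fun: "convex_body A \<Longrightarrow> convex_on UNIV (support_fun A)"
  using support_fun_subadd[of A] support_fun_homogeneous[of A]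
  by (intro convex_onI) (auto, metis diff_ge_0_iff_ge less_imp_le)

lemma continuous_on_support_fun: "convex_body A \<Longrightarrow> continuous_on S (support_fun A)"
  using convex_on_continuous[OF open_UNIV convex_on_support_fun] continuous_on_subset by blast

lemma subset_if_support_fun_le:
  assumes A: "convex_body A" and B: "convex_body B"
    and le: "\<And>u. norm u = 1 \<Longrightarrow> support_fun A u \<le> support_fun B u"
  shows "A \<subseteq> B"
proof
  fix x assume x: "x \<in> A"
  show "x \<in> B"
  proof (rule ccontr)
    assume "x \<notin> B"
    then obtain a b where ab: "a \<bullet> x < b" "\<And>y. y \<in> B \<Longrightarrow> a \<bullet> y > b"
      using separating_hyperplane_closed_point[of B x] B by (auto simp: convex_body_def compact_imp_closed)
    have "a \<noteq> 0" using ab B by (force simp: convex_body_def)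
    \<comment> \<open>The separating normal points from \<open>x\<close> towards \<open>B\<close>;
      reversing and normalising it gives a direction in which \<open>x\<close> exceeds the support
      function of \<open>B\<close>.\<close>
    define u where "u = (-1 / norm a) *\<^sub>R a"
    have u: "norm u = 1" using \<open>a \<noteq> 0\<close> by (simp add: u_def)
    obtain y where y: "y \<in> B" "y \<bullet> u = support_fun B u" using support_fun_attained[OF B] .
    have "x \<bullet> u \<le> y \<bullet> u" using inner_le_support_fun[OF A x, of u] le[OF u] y by simp
    then have "a \<bullet> y \<le> a \<bullet> x"
      using \<open>a \<noteq> 0\<close> by (simp add: u_def inner_commute divide_le_cancel)
    then show False using ab y(1) by force
  qed
qed

lemma support_fun_mono:
  assumes "convex_body A" "convex_body B" "A \<subseteq> B"
  shows "support_fun A u \<le> support_fun B u"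
  using assms by (metis inner_le_support_fun subsetD support_fun_attained)

lemma support_fun_inject:
  assumes "convex_body A" "convex_body B" "\<And>u. norm u = 1 \<Longrightarrow> support_fun A u = support_fun B u"
  shows "A = B"
  using assms by (intro antisym subset_if_support_fun_le) auto

lemma convex_body_hull_Un: "convex_body A \<Longrightarrow> convex_body B \<Longrightarrow> convex_body (convex hull (A \<union> B))"
  by (auto simp: convex_body_def intro: compact_convex_hull)

lemma support_fun_hull_Un:
  assumes A: "convex_body A" and B: "convex_body B"
  shows "support_fun (convex hull (A \<union> B)) u = max (support_fun A u) (support_fun B u)"
proof (rule antisym)
  let ?H = "convex hull (A \<union> B)"
  have H: "convex_body ?H" by (rule convex_body_hull_Un[OF A B])
  obtain x where x: "x \<in> ?H" "x \<bullet> u = support_fun ?H u" using support_fun_attained[OF H] .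
  have "?H \<subseteq> {x. u \<bullet> x \<le> max (support_fun A u) (support_fun B u)}"
    using inner_le_support_fun[OF A, of _ u] inner_le_support_fun[OF B, of _ u]
    by (intro hull_minimal convex_halfspace_le) (auto simp: inner_commute le_max_iff_disj)
  then show "support_fun ?H u \<le> max (support_fun A u) (support_fun B u)"
    using x by (auto simp: inner_commute)
  show "max (support_fun A u) (support_fun B u) \<le> support_fun ?H u"
    using support_fun_mono[OF A H] support_fun_mono[OF B H] hull_subset[of "A \<union> B" convex] by auto
qed

section \<open>Representation of positive functionals\<close>

text \<open>A Daniell-type setting: \<open>D\<close> is a vector lattice with constants whose
  positivity sets generate the Borel sets, and it need not contain all continuous functions.
  Differences of support functions on the sphere are such a lattice.\<close>

locale positive_functional =
  fixes X :: "'a::heine_borel set" and D :: "('a \<Rightarrow> real) set" and \<Lambda> :: "('a \<Rightarrow> real) \<Rightarrow> real"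
  assumes compact_X: "compact X"
    and cont: "\<phi> \<in> D \<Longrightarrow> continuous_on X \<phi>"
    and D_const: "(\<lambda>_. c) \<in> D"
    and D_add: "\<phi> \<in> D \<Longrightarrow> \<psi> \<in> D \<Longrightarrow> (\<lambda>x. \<phi> x + \<psi> x) \<in> D"
    and D_scale: "\<phi> \<in> D \<Longrightarrow> (\<lambda>x. c * \<phi> x) \<in> D"
    and D_max: "\<phi> \<in> D \<Longrightarrow> \<psi> \<in> D \<Longrightarrow> (\<lambda>x. max (\<phi> x) (\<psi> x)) \<in> D"
    and D_borel: "sets (restrict_space borel X) = sigma_sets X ((\<lambda>\<phi>. {x \<in> X. \<phi> x > 0}) ` D)"
    and add: "\<phi> \<in> D \<Longrightarrow> \<psi> \<in> D \<Longrightarrow> \<Lambda> (\<lambda>x. \<phi> x + \<psi> x) = \<Lambda> \<phi> + \<Lambda> \<psi>"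
    and scale: "\<phi> \<in> D \<Longrightarrow> \<Lambda> (\<lambda>x. c * \<phi> x) = c * \<Lambda> \<phi>"
    and pos: "\<phi> \<in> D \<Longrightarrow> (\<And>x. x \<in> X \<Longrightarrow> \<phi> x \<ge> 0) \<Longrightarrow> \<Lambda> \<phi> \<ge> 0"
begin

lemma D_diff: "\<phi> \<in> D \<Longrightarrow> \<psi> \<in> D \<Longrightarrow> (\<lambda>x. \<phi> x - \<psi> x) \<in> D"
  using D_add[of \<phi> "\<lambda>x. (-1) * \<psi> x"] D_scale[of \<psi> "-1"] by simp

lemma D_min: "\<phi> \<in> D \<Longrightarrow> \<psi> \<in> D \<Longrightarrow> (\<lambda>x. min (\<phi> x) (\<psi> x)) \<in> D"
proof -
  assume "\<phi> \<in> D" "\<psi> \<in> D"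
  then have "(\<lambda>x. (-1) * max ((-1) * \<phi> x) ((-1) * \<psi> x)) \<in> D" by (intro D_scale D_max)
  moreover have "(\<lambda>x. (-1) * max ((-1) * \<phi> x) ((-1) * \<psi> x)) = (\<lambda>x. min (\<phi> x) (\<psi> x))" by auto
  ultimately show ?thesis by simp
qed

lemma diff: "\<phi> \<in> D \<Longrightarrow> \<psi> \<in> D \<Longrightarrow> \<Lambda> (\<lambda>x. \<phi> x - \<psi> x) = \<Lambda> \<phi> - \<Lambda> \<psi>"
  using add[of \<phi> "\<lambda>x. (-1) * \<psi> x"] D_scale[of \<psi> "-1"] scale[of \<psi> "-1"] by simp

lemma mono: "\<phi> \<in> D \<Longrightarrow> \<psi> \<in> D \<Longrightarrow> (\<And>x. x \<in> X \<Longrightarrow> \<phi> x \<le> \<psi> x) \<Longrightarrow> \<Lambda> \<phi> \<le> \<Lambda> \<psi>"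
  using pos[of "\<lambda>x. \<psi> x - \<phi> x"] D_diff diff by simp

lemma cong: "\<phi> \<in> D \<Longrightarrow> \<psi> \<in> D \<Longrightarrow> (\<And>x. x \<in> X \<Longrightarrow> \<phi> x = \<psi> x) \<Longrightarrow> \<Lambda> \<phi> = \<Lambda> \<psi>"
  by (intro antisym mono) auto

lemma D_sum: "(\<And>i. i \<in> I \<Longrightarrow> \<phi> i \<in> D) \<Longrightarrow> (\<lambda>x. \<Sum>i\<in>I. \<phi> i x) \<in> D"
  by (induction I rule: infinite_finite_induct) (auto intro: D_const D_add)

lemma const: "\<Lambda> (\<lambda>_. c) = c * \<Lambda> (\<lambda>_. 1)"
  using scale[OF D_const, of c 1] by simp

lemma sum: "(\<And>i. i \<in> I \<Longrightarrow> \<phi> i \<in> D) \<Longrightarrow> \<Lambda> (\<lambda>x. \<Sum>i\<in>I. \<phi> i x) = (\<Sum>i\<in>I. \<Lambda> (\<phi> i))"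
proof (induction I rule: infinite_finite_induct)
  case (insert i I)
  then show ?case using add[of "\<phi> i" "\<lambda>x. \<Sum>i\<in>I. \<phi> i x"] D_sum[of I \<phi>] by simp
qed (use const[of 0] in auto)

text \<open>By Dini's theorem the convergence is uniform.\<close>
lemma decreasing_tendsto_0:
  assumes D: "\<And>n. \<phi> n \<in> D" and dec: "\<And>n x. x \<in> X \<Longrightarrow> \<phi> (Suc n) x \<le> \<phi> n x"
    and lim: "\<And>x. x \<in> X \<Longrightarrow> (\<lambda>n. \<phi> n x) \<longlonglongrightarrow> 0"
  shows "(\<lambda>n. \<Lambda> (\<phi> n)) \<longlonglongrightarrow> 0"
proof (rule LIMSEQ_I)
  fix r :: real assume r: "r > 0"
  have antimono: "\<phi> n x \<le> \<phi> m x" if "m \<le> n" "x \<in> X" for m n x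
    using that(1) by (induction rule: dec_induct) (use dec[OF that(2)] in \<open>auto intro: order_trans\<close>)
  have nn: "\<phi> n x \<ge> 0" if "x \<in> X" for n x
    using lim[OF that] antimono[OF _ that] by (intro LIMSEQ_le_const2) auto
  have L1: "\<Lambda> (\<lambda>_. 1) \<ge> 0" by (rule pos[OF D_const]) simp
  define e where "e = r / (\<Lambda> (\<lambda>_. 1) + 1)"
  have e: "e > 0" using r L1 by (simp add: e_def)
  define F where "F n = {x \<in> X. \<phi> n x \<ge> e}" for n
  have "\<exists>N. F N = {}"
  proof (rule ccontr)
    assume "\<not> ?thesis"
    moreover have "compact (F n)" for n
    proof -
      have "closedin (top_of_set X) (X \<inter> \<phi> n -` {e..})"
        using cont[OF D] by (intro continuous_closedin_preimage) auto
      moreover have "X \<inter> \<phi> n -` {e..} = F n" by (auto simp: F_def)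
      ultimately show ?thesis using closedin_compact[OF compact_X] by simp
    qed
    moreover have "F n \<subseteq> F m" if "m \<le> n" for m n
      using antimono[OF that] by (force simp: F_def)
    ultimately have "\<Inter> (range F) \<noteq> {}" by (metis compact_nest)
    then obtain x where x: "\<And>n. x \<in> F n" by auto
    then have "x \<in> X" by (auto simp: F_def)
    from LIMSEQ_D[OF lim[OF this] e] obtain n where "\<bar>\<phi> n x\<bar> < e" by auto
    then show False using x[of n] by (auto simp: F_def)
  qed
  then obtain N where N: "F N = {}" ..
  have "norm (\<Lambda> (\<phi> n) - 0) < r" if "n \<ge> N" for n
  proof -
    have "\<phi> n x \<le> e" if "x \<in> X" for x
      using N antimono[OF \<open>n \<ge> N\<close> that] that by (force simp: F_def)
    then have "\<Lambda> (\<phi> n) \<le> e * \<Lambda> (\<lambda>_. 1)"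
      using mono[OF D D_const, of n e] const[of e] by simp
    also have "\<dots> < r" using r L1 by (simp add: e_def field_simps)
    finally show ?thesis using pos[OF D nn, of n] by simp
  qed
  then show "\<exists>N. \<forall>n\<ge>N. norm (\<Lambda> (\<phi> n) - 0) < r" by blast
qed

section \<open>Regions between graphs and their Caratheodory extension\<close>

definition region :: "('a \<Rightarrow> real) \<Rightarrow> ('a \<Rightarrow> real) \<Rightarrow> ('a \<times> real) set" where
  "region \<phi> \<psi> = {(x, t). x \<in> X \<and> \<phi> x \<le> t \<and> t < \<psi> x}"

definition ordered :: "('a \<Rightarrow> real) \<Rightarrow> ('a \<Rightarrow> real) \<Rightarrow> bool" where
  "ordered \<phi> \<psi> \<longleftrightarrow> \<phi> \<in> D \<and> \<psi> \<in> D \<and> (\<forall>x\<in>X. \<phi> x \<le> \<psi> x)"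

text \<open>Half-open fibres keep differences of regions inside the class: removing one interval
  from another leaves a lower and an upper interval. The additional \<open>max\<close> and
  \<open>min\<close> keep the bounding functions ordered over points where an interval is
  empty.\<close>

lemma semiring_region: "semiring_of_sets (X \<times> UNIV) {region \<phi> \<psi> |\<phi> \<psi>. ordered \<phi> \<psi>}"
proof
  let ?M = "{region \<phi> \<psi> |\<phi> \<psi>. ordered \<phi> \<psi>}"
  show "?M \<subseteq> Pow (X \<times> UNIV)" by (auto simp: region_def)
  show "{} \<in> ?M"
    by (rule CollectI, rule exI[of _ "\<lambda>_. 0"], rule exI[of _ "\<lambda>_. 0"])
      (auto simp: region_def ordered_def D_const)
  fix a b assume "a \<in> ?M" "b \<in> ?M"
  then obtain \<phi> \<psi> \<phi>' \<psi>' where *: "a = region \<phi> \<psi>" "b = region \<phi>' \<psi>'" "ordered \<phi> \<psi>" "ordered \<phi>' \<psi>'"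
    by auto
  have D: "\<phi> \<in> D" "\<psi> \<in> D" "\<phi>' \<in> D" "\<psi>' \<in> D" using * by (auto simp: ordered_def)
  let ?m = "\<lambda>x. max (\<phi> x) (\<phi>' x)"
  have "a \<inter> b = region ?m (\<lambda>x. max (?m x) (min (\<psi> x) (\<psi>' x)))"
    by (auto simp: * region_def)
  moreover have "ordered ?m (\<lambda>x. max (?m x) (min (\<psi> x) (\<psi>' x)))"
    by (auto simp: ordered_def intro!: D_max D_min D)
  ultimately show "a \<inter> b \<in> ?M" by blast
  let ?u = "\<lambda>x. max (\<phi> x) (min (\<psi> x) (\<phi>' x))" and ?v = "\<lambda>x. min (\<psi> x) (max (\<phi> x) (\<psi>' x))"
  have "a - b = \<Union> {region \<phi> ?u, region ?v \<psi>}"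
    using *(3,4) by (auto simp: * region_def ordered_def)
  moreover have "region \<phi> ?u \<inter> region ?v \<psi> = {}"
  proof -
    have False if "(x, t) \<in> region \<phi> ?u" "(x, t) \<in> region ?v \<psi>" for x t
    proof -
      have "x \<in> X" "t < \<phi>' x" "\<psi>' x \<le> t" using that by (auto simp: region_def)
      moreover from this(1) have "\<phi>' x \<le> \<psi>' x" using *(4) by (simp add: ordered_def)
      ultimately show False by simp
    qed
    then show ?thesis by auto
  qed
  then have "disjoint {region \<phi> ?u, region ?v \<psi>}"
    by (simp add: pairwise_insert disjnt_def Int_commute)
  moreover have "ordered \<phi> ?u" "ordered ?v \<psi>"
    by (auto simp: ordered_def intro!: D_max D_min D)
  ultimately show "\<exists>C\<subseteq>?M. finite C \<and> disjoint C \<and> a - b = \<Union> C"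
    by (intro exI[of _ "{region \<phi> ?u, region ?v \<psi>}"]) auto
qed

lemma region_subset: "region \<phi> \<psi> \<subseteq> X \<times> UNIV"
  by (auto simp: region_def)

lemma region_fibre: "x \<in> X \<Longrightarrow> {t. (x, t) \<in> region \<phi> \<psi>} = {\<phi> x..<\<psi> x}"
  by (auto simp: region_def)

lemma region_length:
  assumes "ordered \<phi> \<psi>" "x \<in> X"
  shows "emeasure lborel {t. (x, t) \<in> region \<phi> \<psi>} = ennreal (\<psi> x - \<phi> x)"
  using assms by (simp add: region_fibre ordered_def)

text \<open>Over each point the lengths of the fibres add up by countable additivity of Lebesgue
  measure. The remainders of the series are functions in \<open>D\<close> that decrease to 0, so
  \<open>decreasing_tendsto_0\<close> carries the identity over to \<open>\<Lambda>\<close>.\<close>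

lemma region_sum:
  assumes ord: "\<And>n. ordered (A n) (B n)" "ordered \<phi> \<psi>" and dis: "disjoint_family (\<lambda>n. region (A n) (B n))"
    and un: "(\<Union>n. region (A n) (B n)) = region \<phi> \<psi>"
  shows "(\<Sum>n. ennreal (\<Lambda> (\<lambda>x. B n x - A n x))) = ennreal (\<Lambda> (\<lambda>x. \<psi> x - \<phi> x))"
proof -
  have D: "A n \<in> D" "B n \<in> D" "\<phi> \<in> D" "\<psi> \<in> D" for n using ord by (auto simp: ordered_def)
  have nn: "B n x - A n x \<ge> 0" if "x \<in> X" for n x using ord that by (auto simp: ordered_def)
  have sums: "(\<lambda>n. B n x - A n x) sums (\<psi> x - \<phi> x)" if x: "x \<in> X" for x
  proof -
    let ?F = "\<lambda>n. {t. (x, t) \<in> region (A n) (B n)}"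
    have "(\<Sum>n. emeasure lborel (?F n)) = emeasure lborel (\<Union>n. ?F n)"
    proof (rule suminf_emeasure)
      show "range ?F \<subseteq> sets lborel" using region_fibre[OF x] by auto
      show "disjoint_family ?F" using dis by (auto simp: disjoint_family_on_def)
    qed
    moreover have "(\<Union>n. ?F n) = {t. (x, t) \<in> region \<phi> \<psi>}" using un by auto
    ultimately have "(\<Sum>n. ennreal (B n x - A n x)) = ennreal (\<psi> x - \<phi> x)"
      using region_length[OF ord(1) x] region_length[OF ord(2) x] by simp
    then have "(\<lambda>n. ennreal (B n x - A n x)) sums ennreal (\<psi> x - \<phi> x)"
      using summable_sums[OF summableI, of "\<lambda>n. ennreal (B n x - A n x)"] by simp
    then show ?thesis using nn[OF x] ord(2) x by (subst (asm) sums_ennreal) (auto simp: ordered_def)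
  qed
  have "(\<lambda>n. \<Lambda> (\<lambda>x. (\<psi> x - \<phi> x) - (\<Sum>i<n. B i x - A i x))) \<longlonglongrightarrow> 0"
  proof (rule decreasing_tendsto_0)
    show "(\<lambda>n. (\<psi> x - \<phi> x) - (\<Sum>i<n. B i x - A i x)) \<longlonglongrightarrow> 0" if "x \<in> X" for x
      using tendsto_diff[OF tendsto_const sums[OF that, unfolded sums_def], of "\<psi> x - \<phi> x"] by simp
  qed (use nn in \<open>auto intro!: D_diff D_sum D\<close>)
  moreover have "\<Lambda> (\<lambda>x. (\<psi> x - \<phi> x) - (\<Sum>i<n. B i x - A i x))
      = \<Lambda> (\<lambda>x. \<psi> x - \<phi> x) - (\<Sum>i<n. \<Lambda> (\<lambda>x. B i x - A i x))" for n
    by (subst diff) (auto intro!: D_diff D_sum D sum)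
  ultimately have lim: "(\<lambda>n. \<Lambda> (\<lambda>x. \<psi> x - \<phi> x) - (\<Sum>i<n. \<Lambda> (\<lambda>x. B i x - A i x))) \<longlonglongrightarrow> 0" by simp
  have "(\<lambda>n. \<Lambda> (\<lambda>x. B n x - A n x)) sums \<Lambda> (\<lambda>x. \<psi> x - \<phi> x)"
    using tendsto_diff[OF tendsto_const lim, of "\<Lambda> (\<lambda>x. \<psi> x - \<phi> x)"] by (simp add: sums_def)
  moreover have "\<Lambda> (\<lambda>x. B n x - A n x) \<ge> 0" "\<Lambda> (\<lambda>x. \<psi> x - \<phi> x) \<ge> 0" for n
    using nn ord(2) by (auto intro!: pos D_diff D simp: ordered_def)
  ultimately have "(\<lambda>n. ennreal (\<Lambda> (\<lambda>x. B n x - A n x))) sums ennreal (\<Lambda> (\<lambda>x. \<psi> x - \<phi> x))"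
    by simp
  then show ?thesis by (rule sums_unique[symmetric])
qed

definition region_measure :: "('a \<times> real) measure" where
  "region_measure = extend_measure (X \<times> UNIV) {(\<phi>, \<psi>). ordered \<phi> \<psi>} (\<lambda>(\<phi>, \<psi>). region \<phi> \<psi>)
     (\<lambda>(\<phi>, \<psi>). ennreal (\<Lambda> (\<lambda>x. \<psi> x - \<phi> x)))"

text \<open>The value assigned to a region does not depend on the bounding functions that describe
  it, since its fibre lengths determine their difference on \<open>X\<close>; with
  \<open>region_sum\<close> this is what the Caratheodory extension asks for.\<close>

lemma emeasure_region:
  assumes "ordered \<phi> \<psi>"
  shows "emeasure region_measure (region \<phi> \<psi>) = ennreal (\<Lambda> (\<lambda>x. \<psi> x - \<phi> x))"
proof (rule extend_measure_caratheodory_pair[OF region_measure_def])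
  show "ordered \<phi> \<psi>" by fact
  show "semiring_of_sets (X \<times> UNIV) {region a b |a b. ordered a b}" by (rule semiring_region)
  fix \<phi> \<psi> assume 1: "ordered \<phi> \<psi>"
  show "0 \<le> ennreal (\<Lambda> (\<lambda>x. \<psi> x - \<phi> x))" by simp
  have eq: "\<Lambda> (\<lambda>x. \<psi> x - \<phi> x) = \<Lambda> (\<lambda>x. \<psi>' x - \<phi>' x)"
    if 2: "ordered \<phi>' \<psi>'" and "region \<phi> \<psi> = region \<phi>' \<psi>'" for \<phi>' \<psi>'
  proof (rule cong)
    show "(\<lambda>x. \<psi> x - \<phi> x) \<in> D" "(\<lambda>x. \<psi>' x - \<phi>' x) \<in> D"
      using 1 2 by (auto simp: ordered_def intro: D_diff)
    fix x assume x: "x \<in> X"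
    have "ennreal (\<psi> x - \<phi> x) = ennreal (\<psi>' x - \<phi>' x)"
      using region_length[OF 1 x] region_length[OF 2 x] that(2) by simp
    then show "\<psi> x - \<phi> x = \<psi>' x - \<phi>' x" using 1 2 x by (simp add: ordered_def)
  qed
  then show "ordered \<phi>' \<psi>' \<Longrightarrow> region \<phi> \<psi> = region \<phi>' \<psi>' \<Longrightarrow>
      ennreal (\<Lambda> (\<lambda>x. \<psi> x - \<phi> x)) = ennreal (\<Lambda> (\<lambda>x. \<psi>' x - \<phi>' x))" for \<phi>' \<psi>' by simp
  assume "region \<phi> \<psi> = {}"
  then have "region \<phi> \<psi> = region (\<lambda>_. 0) (\<lambda>_. 0)" by (auto simp: region_def)
  then have "\<Lambda> (\<lambda>x. \<psi> x - \<phi> x) = \<Lambda> (\<lambda>x. 0 - 0)"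
    by (rule eq[rotated]) (simp add: ordered_def D_const)
  then show "ennreal (\<Lambda> (\<lambda>x. \<psi> x - \<phi> x)) = 0" using const[of 0] by simp
qed (rule region_sum)

lemma space_region_measure: "space region_measure = X \<times> UNIV"
  unfolding region_measure_def by (subst space_extend_measure) (auto simp: region_def)

lemma region_in_sets: "ordered \<phi> \<psi> \<Longrightarrow> region \<phi> \<psi> \<in> sets region_measure"
  unfolding region_measure_def
  by (subst sets_extend_measure) (use region_subset in \<open>auto intro!: sigma_sets.Basic\<close>)

lemma ordered_cut: "\<phi> \<in> D \<Longrightarrow> ordered (\<lambda>_. 0) (\<lambda>x. max 0 (min 1 (c * \<phi> x)))"
  by (auto simp: ordered_def intro!: D_max D_min D_scale D_const)

lemma ordered_01: "ordered (\<lambda>_. 0) (\<lambda>_. 1)"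
  by (auto simp: ordered_def D_const)

section \<open>Projection to a measure on \<open>X\<close> and the representation formula\<close>

definition strip :: "('a \<times> real) measure" where
  "strip = restrict_space region_measure (region (\<lambda>_. 0) (\<lambda>_. 1))"

text \<open>A set receives the region measure of the cylinder of unit height over it.\<close>

definition riesz_measure :: "'a measure" where
  "riesz_measure = distr strip (restrict_space borel X) fst"

lemma space_strip: "space strip = X \<times> {0..<1}"
  by (auto simp: strip_def space_restrict_space space_region_measure region_def)

lemma fst_measurable: "fst \<in> measurable strip (restrict_space borel X)"
proof (rule measurable_sigma_sets[OF D_borel])
  show "(\<lambda>\<phi>. {x \<in> X. \<phi> x > 0}) ` D \<subseteq> Pow X" by auto
  show "fst \<in> space strip \<rightarrow> X" by (auto simp: space_strip)
  fix E assume "E \<in> (\<lambda>\<phi>. {x \<in> X. \<phi> x > 0}) ` D"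
  then obtain \<phi> where \<phi>: "\<phi> \<in> D" "E = {x \<in> X. \<phi> x > 0}" by auto
  \<comment> \<open>Truncations at height 1 of the multiples of \<open>\<phi>\<close> exhaust the
    cylinder over the set where \<open>\<phi>\<close> is positive.\<close>
  have "fst -` E \<inter> space strip
      = (\<Union>n::nat. region (\<lambda>_. 0) (\<lambda>x. max 0 (min 1 (real n * \<phi> x))) \<inter> region (\<lambda>_. 0) (\<lambda>_. 1))" (is "?L = ?R")
  proof
    show "?R \<subseteq> ?L"
    proof clarify
      fix x t and n :: nat
      assume "(x, t) \<in> region (\<lambda>_. 0) (\<lambda>x. max 0 (min 1 (real n * \<phi> x)))" "(x, t) \<in> region (\<lambda>_. 0) (\<lambda>_. 1)"
      then have *: "x \<in> X" "0 \<le> t" "t < 1" "0 < real n * \<phi> x" by (auto simp: region_def)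
      then show "(x, t) \<in> fst -` E \<inter> space strip"
        by (auto simp: \<phi> space_strip zero_less_mult_iff)
    qed
    show "?L \<subseteq> ?R"
    proof clarify
      fix x t assume "(x, t) \<in> space strip" "fst (x, t) \<in> E"
      then have *: "x \<in> X" "\<phi> x > 0" "0 \<le> t" "t < 1" by (auto simp: \<phi> space_strip)
      then obtain n where "t < real n * \<phi> x" using reals_Archimedean3[of "\<phi> x"] by blast
      then show "(x, t) \<in> ?R" using * by (auto simp: region_def intro!: exI[of _ n])
    qed
  qed
  also have "\<dots> \<in> sets strip"
  proof -
    have "region (\<lambda>_. 0) (\<lambda>x. max 0 (min 1 (real n * \<phi> x))) \<inter> region (\<lambda>_. 0) (\<lambda>_. 1) \<in> sets strip" for n :: nat
      unfolding strip_def sets_restrict_space using region_in_sets[OF ordered_cut[OF \<phi>(1), of "real n"]] by blast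
    then show ?thesis by blast
  qed
  finally show "fst -` E \<inter> space strip \<in> sets strip" .
qed

lemma space_riesz_measure: "space riesz_measure = X"
  and sets_riesz_measure: "sets riesz_measure = sets (restrict_space borel X)"
  by (auto simp: riesz_measure_def space_restrict_space)

lemma emeasure_riesz_measure:
  assumes "E \<in> sets riesz_measure"
  shows "E \<times> {0..<1} \<in> sets region_measure" and "emeasure riesz_measure E = emeasure region_measure (E \<times> {0..<1})"
proof -
  have E: "E \<in> sets (restrict_space borel X)" "E \<subseteq> X"
    using assms sets.sets_into_space[OF assms] by (auto simp: sets_riesz_measure space_riesz_measure)
  have eq: "fst -` E \<inter> space strip = E \<times> {0..<1}" using E by (auto simp: space_strip)
  have r: "region (\<lambda>_. 0) (\<lambda>_. 1) \<inter> space region_measure \<in> sets region_measure"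
    using region_in_sets[OF ordered_01] by simp
  have "E \<times> {0..<1} \<in> sets strip" using measurable_sets[OF fst_measurable E(1)] eq by simp
  then show 1: "E \<times> {0..<1} \<in> sets region_measure"
    unfolding strip_def using sets_restrict_space_iff[OF r] by simp
  have "E \<times> {0..<1} \<subseteq> region (\<lambda>_. 0) (\<lambda>_. 1)" using E by (auto simp: region_def)
  then have "emeasure strip (E \<times> {0..<1}) = emeasure region_measure (E \<times> {0..<1})"
    unfolding strip_def using r by (subst emeasure_restrict_space) auto
  then show "emeasure riesz_measure E = emeasure region_measure (E \<times> {0..<1})"
    unfolding riesz_measure_def using emeasure_distr[OF fst_measurable E(1)] eq by simp
qed

lemma emeasure_riesz_space: "emeasure riesz_measure X = ennreal (\<Lambda> (\<lambda>_. 1))"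
proof -
  have "X \<times> {0..<1} = region (\<lambda>_. 0) (\<lambda>_. 1)" by (auto simp: region_def)
  then show ?thesis
    using emeasure_riesz_measure(2)[of X] emeasure_region[OF ordered_01] sets.top[of riesz_measure]
    by (simp add: space_riesz_measure)
qed

lemma finite_riesz_measure: "finite_measure riesz_measure"
  by (rule finite_measureI) (simp add: space_riesz_measure emeasure_riesz_space)

text \<open>The region below \<open>\<theta>\<close> lies in the unit cylinder over
  \<open>E\<close>. Together with \<open>riesz_measure_le\<close>, where the inclusion is reversed,
  this compares \<open>\<Lambda>\<close> with measures of sets before any integral is
  computed.\<close>

lemma riesz_measure_ge:
  assumes \<theta>: "\<theta> \<in> D" "\<And>x. x \<in> X \<Longrightarrow> 0 \<le> \<theta> x" "\<And>x. x \<in> X \<Longrightarrow> \<theta> x \<le> 1"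
    and E: "E \<in> sets riesz_measure" "\<And>x. x \<in> X \<Longrightarrow> \<theta> x > 0 \<Longrightarrow> x \<in> E"
  shows "\<Lambda> \<theta> \<le> measure riesz_measure E"
proof -
  interpret finite_measure riesz_measure by (rule finite_riesz_measure)
  have o: "ordered (\<lambda>_. 0) \<theta>" using \<theta> by (auto simp: ordered_def D_const)
  have "ennreal (\<Lambda> \<theta>) = emeasure region_measure (region (\<lambda>_. 0) \<theta>)"
    using emeasure_region[OF o] by simp
  also have "\<dots> \<le> emeasure region_measure (E \<times> {0..<1})"
    using \<theta> E emeasure_riesz_measure(1)[OF E(1)] by (intro emeasure_mono) (force simp: region_def)+
  also have "\<dots> = emeasure riesz_measure E" by (rule emeasure_riesz_measure(2)[OF E(1), symmetric])
  finally show ?thesis by (simp add: emeasure_eq_measure)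
qed

lemma riesz_measure_le:
  assumes \<theta>: "\<theta> \<in> D" "\<And>x. x \<in> X \<Longrightarrow> 0 \<le> \<theta> x"
    and E: "E \<in> sets riesz_measure" "\<And>x. x \<in> E \<Longrightarrow> \<theta> x \<ge> 1"
  shows "measure riesz_measure E \<le> \<Lambda> \<theta>"
proof -
  interpret finite_measure riesz_measure by (rule finite_riesz_measure)
  have o: "ordered (\<lambda>_. 0) \<theta>" using \<theta> by (auto simp: ordered_def D_const)
  have EX: "E \<subseteq> X" using sets.sets_into_space[OF E(1)] by (simp add: space_riesz_measure)
  have "emeasure riesz_measure E = emeasure region_measure (E \<times> {0..<1})" by (rule emeasure_riesz_measure(2)[OF E(1)])
  also have "\<dots> \<le> emeasure region_measure (region (\<lambda>_. 0) \<theta>)"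
    using E EX region_in_sets[OF o] by (intro emeasure_mono) (force simp: region_def)+
  also have "\<dots> = ennreal (\<Lambda> \<theta>)" using emeasure_region[OF o] by simp
  finally show ?thesis using pos[OF \<theta>] by (simp add: emeasure_eq_measure)
qed

lemma D_measurable: "\<phi> \<in> D \<Longrightarrow> \<phi> \<in> borel_measurable riesz_measure"
  using borel_measurable_continuous_on_restrict[OF cont] measurable_cong_sets[OF sets_riesz_measure refl] by blast

lemma D_bounded: "\<phi> \<in> D \<Longrightarrow> \<exists>B. \<forall>x\<in>X. \<bar>\<phi> x\<bar> \<le> B"
  using compact_imp_bounded[OF compact_continuous_image[OF cont compact_X]] by (auto simp: bounded_iff)

lemma D_integrable: 
  assumes "\<phi> \<in> D"
  shows "integrable riesz_measure \<phi>"
proof -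
  interpret finite_measure riesz_measure by (rule finite_riesz_measure)
  obtain B where "\<forall>x\<in>X. \<bar>\<phi> x\<bar> \<le> B" using D_bounded[OF assms] by blast
  then show ?thesis
    using D_measurable[OF assms] by (intro integrable_const_bound[of _ B]) (auto simp: space_riesz_measure)
qed

text \<open>Layer-cake argument. N times \<open>\<phi>\<close> is cut into \<open>N\<close> slices
  of height 1; both the integral and \<open>\<Lambda>\<close> of slice \<open>k\<close> lie between
  the measures of \<open>E (Suc k)\<close> and \<open>E k\<close>. The differences telescope, and
  after division by \<open>N\<close> the total error is at most the total mass over
  \<open>N\<close>.\<close>

lemma riesz_integral_unit:
  assumes \<phi>: "\<phi> \<in> D" "\<And>x. x \<in> X \<Longrightarrow> 0 \<le> \<phi> x" "\<And>x. x \<in> X \<Longrightarrow> \<phi> x \<le> 1"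
  shows "(\<integral>x. \<phi> x \<partial>riesz_measure) = \<Lambda> \<phi>"
proof -
  interpret finite_measure riesz_measure by (rule finite_riesz_measure)
  let ?\<mu> = "measure riesz_measure"
  have bound: "\<bar>(\<integral>x. \<phi> x \<partial>riesz_measure) - \<Lambda> \<phi>\<bar> \<le> ?\<mu> X / real N" if N: "N > 0" for N :: nat
  proof -
    define \<theta> where "\<theta> k x = min (max (real N * \<phi> x - real k) 0) 1" for k x
    define E where "E k = {x \<in> X. real N * \<phi> x > real k}" for k :: nat
    have \<theta>D: "\<theta> k \<in> D" for k
      unfolding \<theta>_def by (intro D_min D_max D_diff D_scale D_const \<phi>)
    have ED: "E k \<in> sets riesz_measure" for k
    proof -
      have "{x \<in> space riesz_measure. real N * \<phi> x > real k} \<in> sets riesz_measure"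
        using D_measurable[OF \<phi>(1)] by measurable
      then show ?thesis by (simp add: E_def space_riesz_measure)
    qed
    have E01: "indicat_real (E (Suc k)) x \<le> \<theta> k x" "\<theta> k x \<le> indicat_real (E k) x" if "x \<in> X" for k x
      using that by (auto simp: \<theta>_def E_def indicator_def)
    have \<Lambda>1: "?\<mu> (E (Suc k)) \<le> \<Lambda> (\<theta> k)" for k
      by (rule riesz_measure_le[OF \<theta>D _ ED]) (auto simp: \<theta>_def E_def)
    have \<Lambda>2: "\<Lambda> (\<theta> k) \<le> ?\<mu> (E k)" for k
      by (rule riesz_measure_ge[OF \<theta>D _ _ ED]) (auto simp: \<theta>_def E_def)
    have int: "?\<mu> (E (Suc k)) \<le> (\<integral>x. \<theta> k x \<partial>riesz_measure)" "(\<integral>x. \<theta> k x \<partial>riesz_measure) \<le> ?\<mu> (E k)" for k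
    proof -
      have i: "integrable riesz_measure (indicat_real (E k))" "(\<integral>x. indicat_real (E k) x \<partial>riesz_measure) = ?\<mu> (E k)" for k
        using ED[of k] sets.sets_into_space[OF ED[of k]] by (auto simp: Int_absorb2 emeasure_eq_measure)
      show "?\<mu> (E (Suc k)) \<le> (\<integral>x. \<theta> k x \<partial>riesz_measure)" "(\<integral>x. \<theta> k x \<partial>riesz_measure) \<le> ?\<mu> (E k)"
        using integral_mono[OF i(1)[of "Suc k"] D_integrable[OF \<theta>D[of k]]]
          integral_mono[OF D_integrable[OF \<theta>D[of k]] i(1)[of k]] E01[of _ k]
        unfolding i(2) space_riesz_measure by blast+
    qed
    have layer: "real N * \<phi> x = (\<Sum>k<N. \<theta> k x)" if "x \<in> X" for x
    proof -
      have "(\<Sum>k<m. min (max (s - real k) 0) 1) = min s (real m)" if "s \<ge> 0" for s :: real and m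
        using that by (induction m) (auto simp: min_def max_def)
      moreover have "real N * \<phi> x \<le> real N" using \<phi>(3)[OF that] by (simp add: mult_left_le)
      ultimately show ?thesis
        using \<phi>(2)[OF that] by (simp add: \<theta>_def min_absorb1)
    qed
    have "real N * (\<integral>x. \<phi> x \<partial>riesz_measure) = (\<integral>x. (\<Sum>k<N. \<theta> k x) \<partial>riesz_measure)"
      unfolding integral_mult_right_zero[symmetric]
      by (rule Bochner_Integration.integral_cong) (auto simp: layer space_riesz_measure)
    also have "\<dots> = (\<Sum>k<N. \<integral>x. \<theta> k x \<partial>riesz_measure)"
      by (rule Bochner_Integration.integral_sum) (simp add: D_integrable \<theta>D)
    finally have 1: "real N * (\<integral>x. \<phi> x \<partial>riesz_measure) = (\<Sum>k<N. \<integral>x. \<theta> k x \<partial>riesz_measure)" .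
    have "real N * \<Lambda> \<phi> = \<Lambda> (\<lambda>x. \<Sum>k<N. \<theta> k x)"
      unfolding scale[OF \<phi>(1), symmetric] by (rule cong) (auto intro: D_scale \<phi> D_sum \<theta>D layer)
    also have "\<dots> = (\<Sum>k<N. \<Lambda> (\<theta> k))" by (rule sum) (rule \<theta>D)
    finally have 2: "real N * \<Lambda> \<phi> = (\<Sum>k<N. \<Lambda> (\<theta> k))" .
    have "\<bar>real N * (\<integral>x. \<phi> x \<partial>riesz_measure) - real N * \<Lambda> \<phi>\<bar> \<le> (\<Sum>k<N. \<bar>(\<integral>x. \<theta> k x \<partial>riesz_measure) - \<Lambda> (\<theta> k)\<bar>)"
      unfolding 1 2 sum_subtractf[symmetric] by (rule sum_abs)
    also have "\<dots> \<le> (\<Sum>k<N. ?\<mu> (E k) - ?\<mu> (E (Suc k)))"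
      using \<Lambda>1 \<Lambda>2 int by (intro sum_mono) (smt (verit, best))
    also have "\<dots> = ?\<mu> (E 0) - ?\<mu> (E N)" by (rule sum_lessThan_telescope')
    also have "\<dots> \<le> ?\<mu> (E 0)" by simp
    also have "\<dots> \<le> ?\<mu> X" using bounded_measure[of "E 0"] by (simp add: space_riesz_measure)
    finally have "real N * \<bar>(\<integral>x. \<phi> x \<partial>riesz_measure) - \<Lambda> \<phi>\<bar> \<le> ?\<mu> X"
      by (simp add: abs_mult flip: right_diff_distrib)
    then show ?thesis using N by (simp add: field_simps)
  qed
  have "(\<lambda>N. ?\<mu> X / real (Suc N)) \<longlonglongrightarrow> 0"
    by (rule LIMSEQ_Suc[OF lim_const_over_n])
  then have "\<bar>(\<integral>x. \<phi> x \<partial>riesz_measure) - \<Lambda> \<phi>\<bar> \<le> 0"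
    by (rule LIMSEQ_le_const) (use bound[OF zero_less_Suc] in blast)
  then show ?thesis by simp
qed

lemma riesz_integral:
  assumes \<phi>: "\<phi> \<in> D"
  shows "(\<integral>x. \<phi> x \<partial>riesz_measure) = \<Lambda> \<phi>"
proof -
  interpret finite_measure riesz_measure by (rule finite_riesz_measure)
  obtain B0 where B0: "\<forall>x\<in>X. \<bar>\<phi> x\<bar> \<le> B0" using D_bounded[OF \<phi>] by blast
  \<comment> \<open>The added 1 makes \<open>B\<close> positive, so that \<open>\<phi>\<close> can
    be rescaled affinely into the unit interval.\<close>
  define B where "B = \<bar>B0\<bar> + 1"
  have B: "B > 0" "\<And>x. x \<in> X \<Longrightarrow> \<bar>\<phi> x\<bar> \<le> B" using B0 by (fastforce simp: B_def)+
  let ?\<psi> = "\<lambda>x. (1 / (2 * B)) * (\<phi> x + B)"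
  have D: "(\<lambda>x. \<phi> x + B) \<in> D" by (intro D_add D_const \<phi>)
  have "(\<integral>x. ?\<psi> x \<partial>riesz_measure) = \<Lambda> ?\<psi>"
  proof (rule riesz_integral_unit)
    show "?\<psi> \<in> D" by (intro D_scale D)
  qed (use B in \<open>force simp: field_simps abs_le_iff\<close>)+
  then have "(\<integral>x. \<phi> x + B \<partial>riesz_measure) = \<Lambda> \<phi> + B * \<Lambda> (\<lambda>_. 1)"
    using B scale[OF D, of "1 / (2 * B)"] add[OF \<phi> D_const, of B] const[of B] by simp
  moreover have "measure riesz_measure X = \<Lambda> (\<lambda>_. 1)"
    using emeasure_riesz_space pos[OF D_const, of 1] by (simp add: measure_def)
  ultimately show ?thesis
    using D_integrable[OF \<phi>] by (simp add: space_riesz_measure)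
qed

end

section \<open>Mixed area measures\<close>

definition supp_diff :: "('a::euclidean_space \<Rightarrow> real) \<Rightarrow> bool" where
  "supp_diff f \<longleftrightarrow> (\<exists>K L. convex_body K \<and> convex_body L \<and>
     (\<forall>x\<in>sphere 0 1. f x = support_fun K x - support_fun L x))"

lemma dsfI:
  "convex_body K \<Longrightarrow> convex_body L \<Longrightarrow> (\<And>x. norm x = 1 \<Longrightarrow> f x = support_fun K x - support_fun L x) \<Longrightarrow> supp_diff f"
  by (auto simp: supp_diff_def)

lemma dsfE:
  assumes "supp_diff f"
  obtains K L where "convex_body K" "convex_body L" "\<And>x. norm x = 1 \<Longrightarrow> f x = support_fun K x - support_fun L x"
  using assms by (auto simp: supp_diff_def)

lemma supp_diff_support_fun: "convex_body K \<Longrightarrow> supp_diff (support_fun K)"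
  by (rule dsfI[of K "{0}"]) (auto simp: support_fun_sing convex_body_sing)

lemma supp_diff_const: "supp_diff (\<lambda>_. c)"
proof (rule dsfI)
  show "convex_body (cball 0 \<bar>c\<bar>)" "convex_body (cball 0 (\<bar>c\<bar> - c))" by (auto intro: convex_body_cball)
qed (auto simp: support_fun_cball)

lemma supp_diff_inner: "supp_diff (\<lambda>x. a \<bullet> x)"
  by (rule dsfI[of "{a}" "{0}"]) (auto simp: support_fun_sing convex_body_sing)

lemma supp_diff_add: assumes "supp_diff f" "supp_diff g" shows "supp_diff (\<lambda>x. f x + g x)"
proof -
  obtain K L where 1: "convex_body K" "convex_body L" "\<And>x. norm x = 1 \<Longrightarrow> f x = support_fun K x - support_fun L x"
    using dsfE[OF assms(1)] by blast
  obtain K' L' where 2: "convex_body K'" "convex_body L'" "\<And>x. norm x = 1 \<Longrightarrow> g x = support_fun K' x - support_fun L' x"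
    using dsfE[OF assms(2)] by blast
  show ?thesis
    by (rule dsfI[OF convex_body_plus[OF 1(1) 2(1)] convex_body_plus[OF 1(2) 2(2)]])
      (simp add: support_fun_plus 1 2 convex_body_plus)
qed

lemma supp_diff_scale: assumes "supp_diff f" shows "supp_diff (\<lambda>x. c * f x)"
proof -
  obtain K L where 1: "convex_body K" "convex_body L" "\<And>x. norm x = 1 \<Longrightarrow> f x = support_fun K x - support_fun L x"
    using dsfE[OF assms(1)] by blast
  show ?thesis
  proof (cases "c \<ge> 0")
    case True
    then show ?thesis
      by (intro dsfI[OF convex_body_scaleR[OF 1(1), of c] convex_body_scaleR[OF 1(2), of c]])
        (simp add: support_fun_scaleR 1 convex_body_scaleR right_diff_distrib)
  next
    case False
    then show ?thesis
      by (intro dsfI[OF convex_body_scaleR[OF 1(2), of "-c"] convex_body_scaleR[OF 1(1), of "-c"]])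
        (subst (1 2) support_fun_scaleR; simp add: 1 convex_body_scaleR right_diff_distrib del: scaleR_minus_left)
  qed
qed

text \<open>max(a - b, a' - b') = max(a + b', a' + b) - (b + b'), and a maximum of two support
  functions is the support function of the hull of the union.\<close>

lemma supp_diff_max: assumes "supp_diff f" "supp_diff g" shows "supp_diff (\<lambda>x. max (f x) (g x))"
proof -
  obtain K L where 1: "convex_body K" "convex_body L" "\<And>x. norm x = 1 \<Longrightarrow> f x = support_fun K x - support_fun L x"
    using dsfE[OF assms(1)] by blast
  obtain K' L' where 2: "convex_body K'" "convex_body L'" "\<And>x. norm x = 1 \<Longrightarrow> g x = support_fun K' x - support_fun L' x"
    using dsfE[OF assms(2)] by blast
  note b = convex_body_plus[OF 1(1) 2(2)] convex_body_plus[OF 2(1) 1(2)] convex_body_plus[OF 1(2) 2(2)]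
  show ?thesis
    by (rule dsfI[OF convex_body_hull_Un[OF b(1,2)] b(3)])
      (simp add: support_fun_hull_Un[OF b(1,2)] support_fun_plus 1 2 b)
qed

lemma supp_diff_min: assumes "supp_diff f" "supp_diff g" shows "supp_diff (\<lambda>x. min (f x) (g x))"
proof -
  have "supp_diff (\<lambda>x. (-1) * max ((-1) * f x) ((-1) * g x))" using assms by (intro supp_diff_scale supp_diff_max)
  moreover have "(\<lambda>x. (-1) * max ((-1) * f x) ((-1) * g x)) = (\<lambda>x. min (f x) (g x))" by auto
  ultimately show ?thesis by simp
qed

lemma supp_diff_continuous: assumes "supp_diff f" shows "continuous_on (sphere 0 1) f"
proof -
  obtain K L where 1: "convex_body K" "convex_body L" "\<And>x. norm x = 1 \<Longrightarrow> f x = support_fun K x - support_fun L x"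
    using dsfE[OF assms(1)] by blast
  have "continuous_on (sphere 0 1) (\<lambda>x. support_fun K x - support_fun L x)"
    by (intro continuous_intros continuous_on_support_fun 1)
  then show ?thesis by (rule continuous_on_eq) (auto simp: 1)
qed

section \<open>Borel sets of the sphere and linear relations between measures\<close>

definition cap :: "'a::euclidean_space \<Rightarrow> real \<Rightarrow> 'a \<Rightarrow> real" where
  "cap x r y = x \<bullet> y + (r\<^sup>2 / 2 - 1)"

lemma supp_diff_cap: "supp_diff (cap x r)"
  unfolding cap_def by (intro supp_diff_add supp_diff_inner supp_diff_const)

text \<open>For unit vectors \<open>cap x r y\<close> equals (r^2 - |x - y|^2)/2: an affine function
  whose positivity set on the sphere is a metric ball.\<close>

lemma cap_pos_iff:
  assumes "norm x = 1" "norm y = 1" "r > 0"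
  shows "cap x r y > 0 \<longleftrightarrow> y \<in> ball x r"
proof -
  have "(dist x y)\<^sup>2 = 2 - 2 * (x \<bullet> y)"
    using assms by (simp add: dist_norm power2_norm_eq_inner inner_diff_left inner_diff_right inner_commute norm_eq_1)
  then have "cap x r y > 0 \<longleftrightarrow> (dist x y)\<^sup>2 < r\<^sup>2" by (auto simp: cap_def)
  also have "\<dots> \<longleftrightarrow> dist x y < r" using assms(3) power2_less_imp_less[of "dist x y" r] power_strict_mono[of "dist x y" r 2] by auto
  finally show ?thesis by simp
qed

text \<open>By the Lindeloef property an open set meets the sphere in a countable union of balls
  centred on the sphere, and each of these is the positivity set of a \<open>cap\<close>
  function.\<close>

lemma sets_sphere_supp_diff:
  "sets (restrict_space borel (sphere 0 1)) =
     sigma_sets (sphere 0 1) ((\<lambda>f. {x \<in> sphere 0 (1::real). f x > 0}) ` Collect (supp_diff :: ('a::euclidean_space \<Rightarrow> real) \<Rightarrow> bool))"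
  (is "?L = sigma_sets ?S ?G")
proof
  have G: "?G \<subseteq> Pow ?S" by auto
  have "?G \<subseteq> ?L"
  proof clarify
    fix f :: "'a \<Rightarrow> real" assume "supp_diff f"
    then have "f \<in> borel_measurable (restrict_space borel ?S)"
      by (intro borel_measurable_continuous_on_restrict supp_diff_continuous)
    then have "{x \<in> space (restrict_space borel ?S). f x > 0} \<in> ?L" by measurable
    then show "{x \<in> ?S. f x > 0} \<in> ?L" by (simp add: space_restrict_space)
  qed
  then show "sigma_sets ?S ?G \<subseteq> ?L"
    using sets.sigma_sets_subset[of ?G "restrict_space borel ?S"] by (simp add: space_restrict_space)
  have meas: "(\<lambda>x. x) \<in> measurable (sigma ?S ?G) borel"
  proof (rule borel_measurableI)
    fix U :: "'a set" assume U: "open U"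
    define \<F> where "\<F> = {ball x r |x r. x \<in> ?S \<and> r > 0 \<and> ball x r \<subseteq> U}"
    have "\<And>B. B \<in> \<F> \<Longrightarrow> open B" by (auto simp: \<F>_def)
    then obtain \<F>' where F': "\<F>' \<subseteq> \<F>" "countable \<F>'" "\<Union>\<F>' = \<Union>\<F>" by (rule Lindelof)
    have "U \<inter> ?S = \<Union>\<F> \<inter> ?S"
    proof
      show "U \<inter> ?S \<subseteq> \<Union>\<F> \<inter> ?S"
      proof
        fix x assume x: "x \<in> U \<inter> ?S"
        then obtain r where "r > 0" "ball x r \<subseteq> U" using U openE by blast
        then have "ball x r \<in> \<F>" "x \<in> ball x r" using x by (auto simp: \<F>_def)
        then show "x \<in> \<Union>\<F> \<inter> ?S" using x by blast
      qed
    qed (auto simp: \<F>_def)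
    then have "U \<inter> ?S = (\<Union>B\<in>\<F>'. B \<inter> ?S)" using F'(3) by auto
    also have "\<dots> \<in> sigma_sets ?S ?G"
    proof (rule sigma_sets_UNION)
      show "countable ((\<lambda>B. B \<inter> ?S) ` \<F>')" using F'(2) by simp
      fix B assume "B \<in> (\<lambda>B. B \<inter> ?S) ` \<F>'"
      then obtain x r where xr: "x \<in> ?S" "r > 0" "B = ball x r \<inter> ?S" using F'(1) by (auto simp: \<F>_def)
      then have "B = {y \<in> ?S. cap x r y > 0}" using cap_pos_iff[of x _ r] by auto
      then show "B \<in> sigma_sets ?S ?G" using supp_diff_cap by blast
    qed
    finally show "(\<lambda>x. x) -` U \<inter> space (sigma ?S ?G) \<in> sets (sigma ?S ?G)"
      using G by (simp add: sets_measure_of space_measure_of)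
  qed
  have "B \<inter> ?S \<in> sigma_sets ?S ?G" if "B \<in> sets borel" for B
    using measurable_sets[OF meas that] unfolding sets_measure_of[OF G] space_measure_of[OF G] vimage_ident .
  then show "?L \<subseteq> sigma_sets ?S ?G"
    by (auto simp: sets_restrict_space Int_commute)
qed

lemma supp_diff_integrable:
  assumes M: "finite_measure M" "space M = sphere 0 1" "sets M = sets (restrict_space borel (sphere 0 1))" and f: "supp_diff f"
  shows "integrable M f"
proof -
  interpret finite_measure M by fact
  have "bounded (f ` sphere 0 1)"
    by (intro compact_imp_bounded compact_continuous_image supp_diff_continuous f) simp
  then obtain B where B: "\<forall>x\<in>sphere 0 1. norm (f x) \<le> B" by (auto simp: bounded_iff)
  have "f \<in> borel_measurable M"
    using borel_measurable_continuous_on_restrict[OF supp_diff_continuous[OF f]] measurable_cong_sets[OF M(3) refl] by blast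
  then show ?thesis using B M(2) by (intro integrable_const_bound[of _ B]) auto
qed

text \<open>The truncations tend pointwise to the indicator of the set and are themselves
  differences of support functions, so integrals of such differences determine the measures of
  positivity sets.\<close>

lemma measure_pos_set_limit:
  assumes M: "finite_measure M" "space M = sphere 0 1" "sets M = sets (restrict_space borel (sphere 0 1))" and f: "supp_diff f"
  shows "(\<lambda>m::nat. \<integral>x. min 1 (real m * max 0 (f x)) \<partial>M) \<longlonglongrightarrow> measure M {x \<in> sphere 0 1. f x > 0}"
proof -
  interpret finite_measure M by fact
  let ?E = "{x \<in> sphere 0 1. f x > 0}"
  have E: "?E \<in> sets M"
    unfolding M(3) sets_sphere_supp_diff using f by blast
  have "(\<lambda>m. \<integral>x. min 1 (real m * max 0 (f x)) \<partial>M) \<longlonglongrightarrow> (\<integral>x. indicat_real ?E x \<partial>M)"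
  proof (rule integral_dominated_convergence[where w="\<lambda>_. 1"])
    show "indicat_real ?E \<in> borel_measurable M" using E by simp
    show "(\<lambda>x. min 1 (real m * max 0 (f x))) \<in> borel_measurable M" for m
      by (intro borel_measurable_integrable supp_diff_integrable M supp_diff_min supp_diff_const supp_diff_scale supp_diff_max f)
    show "AE x in M. (\<lambda>m. min 1 (real m * max 0 (f x))) \<longlonglongrightarrow> indicat_real ?E x"
    proof (rule AE_I2)
      fix x assume x: "x \<in> space M"
      show "(\<lambda>m. min 1 (real m * max 0 (f x))) \<longlonglongrightarrow> indicat_real ?E x"
      proof (cases "f x > 0")
        case True
        then obtain N where N: "1 < real N * f x" using reals_Archimedean3[of "f x"] by blast
        have "min 1 (real m * max 0 (f x)) = 1" if "m \<ge> N" for m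
        proof -
          have "real N * f x \<le> real m * f x" using that True by simp
          then have "1 \<le> real m * f x" using N by linarith
          then show ?thesis using True by (simp add: min_absorb1)
        qed
        then have "eventually (\<lambda>m. min 1 (real m * max 0 (f x)) = 1) sequentially"
          by (auto simp: eventually_sequentially)
        then show ?thesis using True x M(2) by (simp add: tendsto_eventually)
      qed (simp add: max_absorb1)
    qed
  qed auto
  then show ?thesis using E sets.sets_into_space[OF E] by (simp add: Int_absorb2)
qed

text \<open>A pi-lambda argument for linear relations between measures. Arbitrary coefficients and a
  localising function \<open>u\<close> make uniqueness, additivity, homogeneity and locality of
  mixed area measures instances of it; \<open>u\<close> identically 1 gives the relation on the
  whole sphere.\<close>

lemma sphere_measures_lincomb:
  fixes M :: "'i \<Rightarrow> 'a::euclidean_space measure" and c :: "'i \<Rightarrow> real"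
  assumes I: "finite I" and M: "\<And>i. i \<in> I \<Longrightarrow> finite_measure (M i)" "\<And>i. i \<in> I \<Longrightarrow> space (M i) = sphere 0 1"
      "\<And>i. i \<in> I \<Longrightarrow> sets (M i) = sets (restrict_space borel (sphere 0 1))"
    and u: "supp_diff u"
    and int: "\<And>g. supp_diff g \<Longrightarrow> (\<And>x. norm x = 1 \<Longrightarrow> g x \<ge> 0) \<Longrightarrow> (\<And>x. norm x = 1 \<Longrightarrow> u x \<le> 0 \<Longrightarrow> g x = 0) \<Longrightarrow>
      (\<Sum>i\<in>I. c i * (\<integral>x. g x \<partial>M i)) = 0"
    and A: "A \<in> sets (restrict_space borel (sphere 0 1))"
  shows "(\<Sum>i\<in>I. c i * measure (M i) (A \<inter> {x \<in> sphere 0 1. u x > 0})) = 0"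
proof -
  let ?S = "sphere 0 1 :: 'a set"
  let ?U = "{x \<in> ?S. u x > 0}"
  let ?G = "(\<lambda>f. {x \<in> ?S. f x > 0}) ` Collect supp_diff"
  have inM: "B \<inter> ?U \<in> sets (M i)" if "i \<in> I" "B \<in> sigma_sets ?S ?G" for i B
  proof -
    have "?U \<in> sets (restrict_space borel ?S)" "B \<in> sets (restrict_space borel ?S)"
      unfolding sets_sphere_supp_diff using u that(2) by blast+
    then show ?thesis unfolding M(3)[OF that(1)] by (intro sets.Int)
  qed
  have G: "(\<Sum>i\<in>I. c i * measure (M i) (B \<inter> ?U)) = 0" if B: "B \<in> ?G" for B
  proof -
    obtain f where f: "supp_diff f" "B = {x \<in> ?S. f x > 0}" using B by blast
    \<comment> \<open>Intersecting with the set where \<open>u\<close> is positive stays in the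
      lattice, and the truncations built from \<open>?h\<close> vanish where \<open>u\<close> is
      nonpositive, as the hypothesis \<open>int\<close> requires.\<close>
    let ?h = "\<lambda>x. min (f x) (u x)"
    have h: "supp_diff ?h" by (intro supp_diff_min f u)
    have "B \<inter> ?U = {x \<in> ?S. ?h x > 0}" by (auto simp: f)
    then have "(\<lambda>m. \<Sum>i\<in>I. c i * (\<integral>x. min 1 (real m * max 0 (?h x)) \<partial>M i))
        \<longlonglongrightarrow> (\<Sum>i\<in>I. c i * measure (M i) (B \<inter> ?U))"
      using measure_pos_set_limit[OF M h] by (intro tendsto_intros) auto
    moreover have "(\<Sum>i\<in>I. c i * (\<integral>x. min 1 (real m * max 0 (?h x)) \<partial>M i)) = 0" for m
      by (rule int) (auto intro!: supp_diff_min supp_diff_const supp_diff_scale supp_diff_max f u)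
    ultimately show ?thesis by (simp add: LIMSEQ_const_iff)
  qed
  have S: "?S \<in> ?G" using supp_diff_const[of 1] by (intro image_eqI[of _ _ "\<lambda>_. 1"]) auto
  have "Int_stable ?G"
  proof (rule Int_stableI_image)
    fix f g :: "'a \<Rightarrow> real" assume "f \<in> Collect supp_diff" "g \<in> Collect supp_diff"
    then show "\<exists>h\<in>Collect supp_diff. {x \<in> ?S. f x > 0} \<inter> {x \<in> ?S. g x > 0} = {x \<in> ?S. h x > 0}"
      by (intro bexI[of _ "\<lambda>x. min (f x) (g x)"]) (auto intro: supp_diff_min)
  qed
  moreover have "?G \<subseteq> Pow ?S" by auto
  moreover have "A \<in> sigma_sets ?S ?G" using A by (simp only: sets_sphere_supp_diff)
  ultimately show ?thesis
  proof (induction rule: sigma_sets_induct_disjoint)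
    case (basic B)
    then show ?case by (rule G)
  next
    case (compl B)
    have "measure (M i) ((?S - B) \<inter> ?U) = measure (M i) (?S \<inter> ?U) - measure (M i) (B \<inter> ?U)" if i: "i \<in> I" for i
    proof -
      interpret finite_measure "M i" using M(1)[OF i] .
      have eq: "(?S - B) \<inter> ?U = (?S \<inter> ?U) - (B \<inter> ?U)" by blast
      show ?thesis
        unfolding eq by (rule finite_measure_Diff[OF inM[OF i sigma_sets.Basic[OF S]] inM[OF i compl(1)]]) blast
    qed
    then show ?case using compl.IH G[OF S] by (simp add: right_diff_distrib sum_subtractf)
  next
    case (union B)
    have "(\<lambda>k. measure (M i) (B k \<inter> ?U)) sums measure (M i) ((\<Union>k. B k) \<inter> ?U)" if i: "i \<in> I" for i
    proof -
      interpret finite_measure "M i" using M(1)[OF i] .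
      have "(\<lambda>k. measure (M i) (B k \<inter> ?U)) sums measure (M i) (\<Union>k. B k \<inter> ?U)"
        using inM[OF i] union(1,2) by (intro finite_measure_UNION) (auto simp: disjoint_family_on_def)
      then show ?thesis by simp
    qed
    then have "(\<lambda>k. \<Sum>i\<in>I. c i * measure (M i) (B k \<inter> ?U)) sums (\<Sum>i\<in>I. c i * measure (M i) ((\<Union>k. B k) \<inter> ?U))"
      by (intro sums_sum sums_mult)
    then show ?case using union.IH sums_unique2[OF _ sums_zero] by fastforce
  qed simp
qed

section \<open>Existence and uniqueness of mixed area measures\<close>

definition mixed_functional :: "(real^'n) set list \<Rightarrow> (real^'n \<Rightarrow> real) \<Rightarrow> real" where
  "mixed_functional Ks f = (SOME v. \<exists>K L. convex_body K \<and> convex_body L \<and>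
     (\<forall>x\<in>sphere 0 1. f x = support_fun K x - support_fun L x) \<and>
     v = real CARD('n) * (mixed_volume (K # Ks) - mixed_volume (L # Ks)))"

context
  fixes Ks :: "(real^'n) set list"
  assumes Ks: "\<forall>K\<in>set Ks. convex_body K" and len: "Suc (length Ks) = CARD('n)"
begin

text \<open>Two representations of \<open>f\<close> give \<open>K + L' = K' + L\<close> because
  support functions determine bodies; additivity of the mixed volume then equates the two values, so
  the choice in \<open>mixed_functional\<close> is harmless.\<close>

lemma mixed_functional_eq:
  assumes K: "convex_body K" and L: "convex_body L"
    and f: "\<And>x. norm x = 1 \<Longrightarrow> f x = support_fun K x - support_fun L x"
  shows "mixed_functional Ks f = real CARD('n) * (mixed_volume (K # Ks) - mixed_volume (L # Ks))"
  unfolding mixed_functional_def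
proof (rule some_equality)
  fix v assume "\<exists>K L. convex_body K \<and> convex_body L \<and>
     (\<forall>x\<in>sphere 0 1. f x = support_fun K x - support_fun L x) \<and>
     v = real CARD('n) * (mixed_volume (K # Ks) - mixed_volume (L # Ks))"
  then obtain K' L' where *: "convex_body K'" "convex_body L'"
     "\<And>x. norm x = 1 \<Longrightarrow> f x = support_fun K' x - support_fun L' x"
     "v = real CARD('n) * (mixed_volume (K' # Ks) - mixed_volume (L' # Ks))" by auto
  have "K + L' = K' + L"
  proof (rule support_fun_inject)
    show "support_fun (K + L') u = support_fun (K' + L) u" if "norm u = 1" for u
      using f[OF that] *(3)[OF that] by (simp add: support_fun_plus K L * convex_body_plus)
  qed (intro convex_body_plus K L *)+
  then have "mixed_volume (K # Ks) + mixed_volume (L' # Ks) = mixed_volume (K' # Ks) + mixed_volume (L # Ks)"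
    using mixed_volume_add[OF Ks len K *(2)] mixed_volume_add[OF Ks len *(1) L] by simp
  then have "mixed_volume (K' # Ks) - mixed_volume (L' # Ks) = mixed_volume (K # Ks) - mixed_volume (L # Ks)"
    by simp
  then show "v = real CARD('n) * (mixed_volume (K # Ks) - mixed_volume (L # Ks))" using *(4) by simp
qed (use assms in auto)

lemma mixed_volume_zero: "mixed_volume ({0} # Ks) = 0"
  using mixed_volume_add[OF Ks len convex_body_sing[of 0] convex_body_sing[of 0]] by simp

text \<open>Positivity is where monotonicity enters: a nonnegative difference of support functions
  means that \<open>L\<close> is contained in \<open>K\<close>.\<close>

lemma positive_functional_mixed: "positive_functional (sphere 0 1) (Collect supp_diff) (mixed_functional Ks)"
proof
  show "sets (restrict_space borel (sphere 0 1)) = sigma_sets (sphere 0 1) ((\<lambda>\<phi>. {x \<in> sphere 0 (1::real). 0 < \<phi> x}) ` Collect (supp_diff :: (real^'n \<Rightarrow> real) \<Rightarrow> bool))"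
    by (rule sets_sphere_supp_diff)
  fix f :: "real^'n \<Rightarrow> real" assume "f \<in> Collect supp_diff"
  then obtain K L where 1: "convex_body K" "convex_body L" "\<And>x. norm x = 1 \<Longrightarrow> f x = support_fun K x - support_fun L x"
    using dsfE[of f] by blast
  show "mixed_functional Ks (\<lambda>x. c * f x) = c * mixed_functional Ks f" for c
  proof -
    consider "c = 0" | "c > 0" | "c < 0" by linarith
    then show ?thesis
    proof cases
      case 1
      then show ?thesis using mixed_functional_eq[of "{0}" "{0}" "\<lambda>x. 0"] by (simp add: convex_body_sing)
    next
      case 2
      then have "mixed_functional Ks (\<lambda>x. c * f x)
          = CARD('n) * (mixed_volume ((*\<^sub>R) c ` K # Ks) - mixed_volume ((*\<^sub>R) c ` L # Ks))"
        by (intro mixed_functional_eq convex_body_scaleR 1)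
          (simp add: support_fun_scaleR 1 convex_body_scaleR right_diff_distrib)
      then show ?thesis
        using 2 by (simp add: mixed_volume_scaleR[OF Ks len] 1 mixed_functional_eq[OF 1] algebra_simps)
    next
      case 3
      then have "mixed_functional Ks (\<lambda>x. c * f x)
          = CARD('n) * (mixed_volume ((*\<^sub>R) (-c) ` L # Ks) - mixed_volume ((*\<^sub>R) (-c) ` K # Ks))"
        by (intro mixed_functional_eq convex_body_scaleR 1)
          (subst (1 2) support_fun_scaleR; simp add: 1 convex_body_scaleR right_diff_distrib del: scaleR_minus_left)
      then show ?thesis
        using 3 mixed_volume_scaleR[OF Ks len 1(1), of "-c"] mixed_volume_scaleR[OF Ks len 1(2), of "-c"]
        by (simp add: mixed_functional_eq[OF 1] algebra_simps)
    qed
  qed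
  show "mixed_functional Ks f \<ge> 0" if nn: "\<And>x. x \<in> sphere 0 1 \<Longrightarrow> f x \<ge> 0"
  proof -
    have "L \<subseteq> K" using 1(3) nn by (intro subset_if_support_fun_le 1) force
    then show ?thesis
      using mixed_volume_mono[OF Ks len 1(2,1)] by (simp add: mixed_functional_eq[OF 1])
  qed
  fix g :: "real^'n \<Rightarrow> real" assume "g \<in> Collect supp_diff"
  then obtain K' L' where 2: "convex_body K'" "convex_body L'" "\<And>x. norm x = 1 \<Longrightarrow> g x = support_fun K' x - support_fun L' x"
    using dsfE[of g] by blast
  have "mixed_functional Ks (\<lambda>x. f x + g x) = CARD('n) * (mixed_volume ((K + K') # Ks) - mixed_volume ((L + L') # Ks))"
    by (intro mixed_functional_eq convex_body_plus 1 2) (simp add: support_fun_plus 1 2 convex_body_plus)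
  then show "mixed_functional Ks (\<lambda>x. f x + g x) = mixed_functional Ks f + mixed_functional Ks g"
    by (simp add: mixed_functional_eq[OF 1] mixed_functional_eq[OF 2] mixed_volume_add[OF Ks len] 1 2 algebra_simps)
qed (auto intro: supp_diff_continuous supp_diff_const supp_diff_add supp_diff_scale supp_diff_max)

text \<open>Existence comes from the representation theorem, uniqueness from
  \<open>sphere_measures_lincomb\<close> with coefficients 1 and -1; together they give the definite
  description its meaning.\<close>

lemma is_mixed_area_measure: "is_mixed_area_measure Ks (mixed_area_measure Ks)"
proof -
  interpret positive_functional "sphere 0 1" "Collect supp_diff" "mixed_functional Ks"
    by (rule positive_functional_mixed)
  have ex: "is_mixed_area_measure Ks riesz_measure"
    unfolding is_mixed_area_measure_def
  proof (intro conjI allI impI)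
    fix L :: "(real^'n) set" assume L: "convex_body L"
    show "integrable riesz_measure (support_fun L)" by (rule D_integrable) (simp add: supp_diff_support_fun L)
    have "(\<integral>u. support_fun L u \<partial>riesz_measure) = mixed_functional Ks (support_fun L)"
      by (rule riesz_integral) (simp add: supp_diff_support_fun L)
    also have "\<dots> = real DIM(real^'n) * mixed_volume (L # Ks)"
      using mixed_functional_eq[OF L convex_body_sing[of 0], of "support_fun L"]
      by (simp add: support_fun_sing mixed_volume_zero)
    finally show "(\<integral>u. support_fun L u \<partial>riesz_measure) = real DIM(real^'n) * mixed_volume (L # Ks)" .
  qed (simp_all add: space_riesz_measure sets_riesz_measure finite_riesz_measure)
  have uniq: "M = N" if M: "is_mixed_area_measure Ks M" and N: "is_mixed_area_measure Ks N" for M N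
  proof (rule measure_eqI)
    show "sets M = sets N" using M N by (simp add: is_mixed_area_measure_def)
    fix A assume A: "A \<in> sets M"
    let ?P = "\<lambda>i. if i then M else N" and ?c = "\<lambda>i. if i then 1 else - 1 :: real"
    have P: "is_mixed_area_measure Ks (?P i)" for i using M N by simp
    have "(\<Sum>i\<in>UNIV. ?c i * measure (?P i) (A \<inter> {x \<in> sphere 0 1. 1 > (0::real)})) = 0"
    proof (rule sphere_measures_lincomb)
      fix g :: "real^'n \<Rightarrow> real" assume "supp_diff g"
      then obtain K L where 1: "convex_body K" "convex_body L" "\<And>x. norm x = 1 \<Longrightarrow> g x = support_fun K x - support_fun L x"
        using dsfE[of g] by blast
      have "(\<integral>x. g x \<partial>?P i) = real CARD('n) * (mixed_volume (K # Ks) - mixed_volume (L # Ks))" for i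
      proof -
        have "(\<integral>x. g x \<partial>?P i) = (\<integral>x. support_fun K x - support_fun L x \<partial>?P i)"
          using P[of i] by (intro Bochner_Integration.integral_cong) (auto simp: is_mixed_area_measure_def 1)
        then show ?thesis
          using P[of i] 1 by (simp add: is_mixed_area_measure_def right_diff_distrib)
      qed
      then show "(\<Sum>i\<in>UNIV. ?c i * (\<integral>x. g x \<partial>?P i)) = 0" by (simp add: UNIV_bool)
    qed (use P A M in \<open>auto simp: is_mixed_area_measure_def intro: supp_diff_const\<close>)
    moreover have "A \<inter> {x \<in> sphere 0 1. 1 > (0::real)} = A"
      using A M sets.sets_into_space[OF A] by (auto simp: is_mixed_area_measure_def)
    ultimately have "measure M A = measure N A" by (simp only: UNIV_bool) simp
    moreover have "finite_measure M" "finite_measure N" using M N by (auto simp: is_mixed_area_measure_def)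
    ultimately show "emeasure M A = emeasure N A" by (simp add: finite_measure.emeasure_eq_measure)
  qed
  show ?thesis unfolding mixed_area_measure_def 
    by (rule theI[where P="is_mixed_area_measure Ks", OF ex]) (rule uniq[OF _ ex])
qed

lemma space_mixed_area_measure: "space (mixed_area_measure Ks) = sphere 0 1"
  and sets_mixed_area_measure: "sets (mixed_area_measure Ks) = sets (restrict_space borel (sphere 0 1))"
  and finite_mixed_area_measure: "finite_measure (mixed_area_measure Ks)"
  using is_mixed_area_measure by (auto simp: is_mixed_area_measure_def)

lemma integrable_mixed_area_measure: "supp_diff f \<Longrightarrow> integrable (mixed_area_measure Ks) f"
  by (intro supp_diff_integrable finite_mixed_area_measure space_mixed_area_measure sets_mixed_area_measure)

lemma integral_mixed_area_measure:
  assumes "convex_body K" "convex_body L" "\<And>x. norm x = 1 \<Longrightarrow> f x = support_fun K x - support_fun L x"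
  shows "(\<integral>x. f x \<partial>mixed_area_measure Ks) = real CARD('n) * (mixed_volume (K # Ks) - mixed_volume (L # Ks))"
proof -
  have "(\<integral>x. f x \<partial>mixed_area_measure Ks) = (\<integral>x. support_fun K x - support_fun L x \<partial>mixed_area_measure Ks)"
    by (intro Bochner_Integration.integral_cong) (auto simp: space_mixed_area_measure assms(3))
  then show ?thesis
    using is_mixed_area_measure assms(1,2) by (simp add: is_mixed_area_measure_def right_diff_distrib)
qed

end

section \<open>Locality\<close>

lemma measure_Un_Int_compact:
  assumes "compact A" "compact (B :: 'a::euclidean_space set)"
  shows "measure lebesgue (A \<union> B) + measure lebesgue (A \<inter> B) = measure lebesgue A + measure lebesgue B"
  using measure_Un3[OF lmeasurable_compact[OF assms(1)] lmeasurable_compact[OF assms(2)]] by simp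

text \<open>If the minimum of two support functions is again a support function, then the union of the
  two bodies is convex: a point of the hull outside both would be separated from them in two
  directions \<open>u\<close>, \<open>v\<close>, and on the segment from \<open>u\<close> to \<open>v\<close> there is a direction in which both support
  functions agree.\<close>
lemma Un_Int_of_min_support:
  assumes P: "convex_body P" and Q: "convex_body Q" and U: "convex_body U" and I: "convex_body I"
    and max: "\<And>u. norm u = 1 \<Longrightarrow> support_fun U u = max (support_fun P u) (support_fun Q u)"
    and min: "\<And>u. norm u = 1 \<Longrightarrow> support_fun I u = min (support_fun P u) (support_fun Q u)"
  shows "P \<union> Q = U" and "P \<inter> Q = I"
proof -
  have ext: "F u = G u" if hom: "\<And>t v. t \<ge> 0 \<Longrightarrow> F (t *\<^sub>R v) = t * F v" "\<And>t v. t \<ge> 0 \<Longrightarrow> G (t *\<^sub>R v) = t * G v"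
    and eq: "\<And>u. norm u = 1 \<Longrightarrow> F u = G u" for F G :: "'a \<Rightarrow> real" and u
  proof (cases "u = 0")
    case True
    then show ?thesis using hom[of 0 0] by simp
  next
    case False
    then have "norm ((1 / norm u) *\<^sub>R u) = 1" by simp
    from eq[OF this] have "(1 / norm u) * F u = (1 / norm u) * G u" using hom by (metis divide_nonneg_nonneg norm_ge_zero zero_le_one)
    then show ?thesis using False by simp
  qed
  have max': "support_fun U u = max (support_fun P u) (support_fun Q u)" for u
    by (rule ext[OF _ _ max]) (auto simp: support_fun_homogeneous P Q U max_mult_distrib_left)
  have min': "support_fun I u = min (support_fun P u) (support_fun Q u)" for u
    by (rule ext[OF _ _ min]) (auto simp: support_fun_homogeneous P Q I min_mult_distrib_left)
  show "P \<inter> Q = I"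
  proof
    show "I \<subseteq> P \<inter> Q" using subset_if_support_fun_le[OF I P] subset_if_support_fun_le[OF I Q] min by auto
    show "P \<inter> Q \<subseteq> I"
    proof
      fix x assume "x \<in> P \<inter> Q"
      then have "x \<bullet> u \<le> support_fun I u" for u
        using inner_le_support_fun[OF P, of x u] inner_le_support_fun[OF Q, of x u] by (simp add: min')
      then have "{x} \<subseteq> I" by (intro subset_if_support_fun_le convex_body_sing I) (simp add: support_fun_sing)
      then show "x \<in> I" by simp
    qed
  qed
  show "P \<union> Q = U"
  proof
    show "P \<union> Q \<subseteq> U" using subset_if_support_fun_le[OF P U] subset_if_support_fun_le[OF Q U] max by auto
    show "U \<subseteq> P \<union> Q"
    proof (rule ccontr)
      assume "\<not> U \<subseteq> P \<union> Q"
      then obtain x where x: "x \<in> U" "x \<notin> P" "x \<notin> Q" by auto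
      have sep: "\<exists>u. support_fun A u < x \<bullet> u" if A: "convex_body A" "x \<notin> A" for A
      proof (rule ccontr)
        assume "\<nexists>u. support_fun A u < x \<bullet> u"
        then have "{x} \<subseteq> A"
          by (intro subset_if_support_fun_le convex_body_sing A) (auto simp: support_fun_sing not_less)
        then show False using A by simp
      qed
      obtain u where u: "support_fun P u < x \<bullet> u" using sep[OF P x(2)] by blast
      obtain v where v: "support_fun Q v < x \<bullet> v" using sep[OF Q x(3)] by blast
      define w where "w t = (1 - t) *\<^sub>R u + t *\<^sub>R v" for t :: real
      define d where "d t = support_fun P (w t) - support_fun Q (w t)" for t
      have U': "x \<bullet> y \<le> max (support_fun P y) (support_fun Q y)" for y
        using inner_le_support_fun[OF U x(1), of y] by (simp add: max')
      have "d 0 \<le> 0" "0 \<le> d 1" using U'[of u] U'[of v] u v by (auto simp: d_def w_def)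
      moreover have "continuous_on {0..1} d"
        unfolding d_def w_def
        by (intro continuous_intros continuous_on_compose2[OF continuous_on_support_fun[OF P, of UNIV]]
            continuous_on_compose2[OF continuous_on_support_fun[OF Q, of UNIV]]) auto
      ultimately obtain t where t: "0 \<le> t" "t \<le> 1" "d t = 0"
        using IVT'[of d 0 0 1] by auto
      \<comment> \<open>At \<open>w t\<close> both support functions agree, so \<open>U'\<close>
        bounds x . w t by \<open>support_fun I (w t)\<close>; sublinearity of the latter along the
        segment gives the opposite strict inequality.\<close>
      have "support_fun I (w t) \<le> support_fun I ((1 - t) *\<^sub>R u) + support_fun I (t *\<^sub>R v)"
        unfolding w_def by (rule support_fun_subadd[OF I])
      also have "\<dots> = (1 - t) * support_fun I u + t * support_fun I v"
        using t by (simp add: support_fun_homogeneous I)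
      also have "\<dots> < (1 - t) * (x \<bullet> u) + t * (x \<bullet> v)"
      proof -
        have "support_fun I u < x \<bullet> u" "support_fun I v < x \<bullet> v" using u v by (auto simp: min')
        then show ?thesis
        proof (cases "t = 0")
          case False
          then show ?thesis using t \<open>support_fun I u < x \<bullet> u\<close> \<open>support_fun I v < x \<bullet> v\<close>
            by (intro add_le_less_mono mult_left_mono mult_strict_left_mono) auto
        qed simp
      qed
      also have "\<dots> = x \<bullet> w t" by (simp add: w_def inner_add_right)
      also have "\<dots> \<le> max (support_fun P (w t)) (support_fun Q (w t))" by (rule U')
      finally show False using t(3) by (simp add: min' d_def)
    qed
  qed
qed

text \<open>In each direction one of the two increments vanishes. Hence the support functions of the
  two mixed combinations have that of \<open>L + K + M\<close> as maximum and that of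
  \<open>L' + K' + M\<close> as minimum; these bodies are the union and the intersection, and volume
  is a valuation.\<close>

lemma volume_local:
  fixes L L' K K' M :: "'a::euclidean_space set"
  assumes b: "convex_body L" "convex_body L'" "convex_body K" "convex_body K'" "convex_body M"
    and le: "\<And>u. norm u = 1 \<Longrightarrow> support_fun L' u \<le> support_fun L u"
      "\<And>u. norm u = 1 \<Longrightarrow> support_fun K' u \<le> support_fun K u"
    and eq: "\<And>u. norm u = 1 \<Longrightarrow> support_fun L' u = support_fun L u \<or> support_fun K' u = support_fun K u"
  shows "measure lebesgue (L + K + M) + measure lebesgue (L' + K' + M)
    = measure lebesgue (L + K' + M) + measure lebesgue (L' + K + M)"
proof -
  have c: "convex_body (X + Y + M)" "convex_body (X + Y)" if "convex_body X" "convex_body Y" for X Y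
    using that b(5) by (auto intro: convex_body_plus)
  have s: "support_fun (X + Y + M) u = support_fun X u + support_fun Y u + support_fun M u"
    if "convex_body X" "convex_body Y" for X Y u
    using that b(5) c by (simp add: support_fun_plus)
  have m: "support_fun (L + K + M) u = max (support_fun (L + K' + M) u) (support_fun (L' + K + M) u)"
    "support_fun (L' + K' + M) u = min (support_fun (L + K' + M) u) (support_fun (L' + K + M) u)"
    if u: "norm u = 1" for u
    using eq[OF u] le[OF u] by (auto simp: s b max_def min_def)
  note bodies = c(1)[OF b(1,4)] c(1)[OF b(2,3)] c(1)[OF b(1,3)] c(1)[OF b(2,4)]
  have *: "(L + K' + M) \<union> (L' + K + M) = L + K + M"
    by (rule Un_Int_of_min_support(1)[OF bodies]) (rule m, assumption)+
  have **: "(L + K' + M) \<inter> (L' + K + M) = L' + K' + M"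
    by (rule Un_Int_of_min_support(2)[OF bodies]) (rule m, assumption)+
  have "compact (L + K' + M)" "compact (L' + K + M)" using c b by (auto simp: convex_body_def)
  from measure_Un_Int_compact[OF this] show ?thesis unfolding * ** by simp
qed

text \<open>The second difference V(L - L', K - K', Cs) vanishes when the increments have disjoint
  supports. In the polarization formula, subsets that omit one of the two slots cancel trivially,
  and the others are covered by \<open>volume_local\<close>.\<close>

lemma mixed_volume_local:
  fixes L L' K K' :: "(real^'n) set"
  assumes b: "convex_body L" "convex_body L'" "convex_body K" "convex_body K'" and Cs: "\<forall>C\<in>set Cs. convex_body C"
    and le: "\<And>u. norm u = 1 \<Longrightarrow> support_fun L' u \<le> support_fun L u"
      "\<And>u. norm u = 1 \<Longrightarrow> support_fun K' u \<le> support_fun K u"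
    and eq: "\<And>u. norm u = 1 \<Longrightarrow> support_fun L' u = support_fun L u \<or> support_fun K' u = support_fun K u"
  shows "mixed_volume (L # K # Cs) + mixed_volume (L' # K' # Cs)
    = mixed_volume (L # K' # Cs) + mixed_volume (L' # K # Cs)"
proof -
  define N where "N = Suc (Suc (length Cs))"
  define v where "v X Y J = measure lebesgue (\<Sum>j\<in>J. (X # Y # Cs) ! j)" for X Y J
  have "v L K J + v L' K' J = v L K' J + v L' K J" if J: "J \<subseteq> {..<N}" for J
  proof -
    consider "0 \<notin> J" | "1 \<notin> J" | "0 \<in> J" "1 \<in> J" by blast
    then show ?thesis
    proof cases
      case 1
      have "(\<Sum>j\<in>J. (X # Y # Cs) ! j) = (\<Sum>j\<in>J. (X' # Y # Cs) ! j)" for X X' Y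
        using 1 by (intro sum.cong refl) (auto simp: nth_Cons split: nat.split)
      then have "v X Y J = v X' Y J" for X X' Y unfolding v_def by metis
      then show ?thesis by (metis add.commute)
    next
      case 2
      have "(\<Sum>j\<in>J. (X # Y # Cs) ! j) = (\<Sum>j\<in>J. (X # Y' # Cs) ! j)" for X Y Y'
        using 2 by (intro sum.cong refl) (auto simp: nth_Cons split: nat.split)
      then have "v X Y J = v X Y' J" for X Y Y' unfolding v_def by metis
      then show ?thesis by metis
    next
      case 3
      have fin: "finite J" using J finite_subset by blast
      \<comment> \<open>The remaining bodies are gathered into one; the shift by 2 skips the two
        leading slots.\<close>
      define M where "M = (\<Sum>j\<in>J - {0, 1}. Cs ! (j - 2))"
      have "convex_body M"
        unfolding M_def
      proof (rule convex_body_sum)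
        fix j assume "j \<in> J - {0, 1}"
        then have "j < N" "j \<noteq> 0" "j \<noteq> 1" using J by auto
        then have "j - 2 < length Cs" by (auto simp: N_def)
        then show "convex_body (Cs ! (j - 2))" using Cs by auto
      qed
      moreover have "(\<Sum>j\<in>J. (X # Y # Cs) ! j) = X + Y + M" for X Y
      proof -
        have "(\<Sum>j\<in>J - {0, 1}. (X # Y # Cs) ! j) = M"
          unfolding M_def by (intro sum.cong refl) (auto simp: nth_Cons numeral_2_eq_2 split: nat.split)
        moreover have "(\<Sum>j\<in>J. (X # Y # Cs) ! j) = (\<Sum>j\<in>J - {0, 1}. (X # Y # Cs) ! j) + (\<Sum>j\<in>{0,1}. (X # Y # Cs) ! j)"
          by (rule sum.subset_diff) (use fin 3 in auto)
        moreover have "(\<Sum>j\<in>{0,1}. (X # Y # Cs) ! j) = X + Y" by simp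
        ultimately show ?thesis by (simp only: add.commute)
      qed
      ultimately show ?thesis unfolding v_def using volume_local[OF b _ le eq] by simp
    qed
  qed
  then have "(\<Sum>J\<in>Pow {..<N}. (-1) ^ (N - card J) * (v L K J + v L' K' J))
      = (\<Sum>J\<in>Pow {..<N}. (-1) ^ (N - card J) * (v L K' J + v L' K J))"
    by (intro sum.cong) auto
  then show ?thesis
    by (simp add: mixed_volume_def v_def N_def distrib_left sum.distrib add_divide_distrib[symmetric])
qed

text \<open>The hull of the gradients serves as \<open>K\<close>: \<open>le\<close> says that each
  tangent plane stays below \<open>F\<close>, and \<open>eq\<close> is Euler's relation for a
  degree-one function. It is applied both on the whole sphere and on a small neighbourhood in
  it.\<close>

lemma gradient_hull_support_fun:
  fixes T :: "'a::euclidean_space set"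
  assumes T: "compact T" "T \<noteq> {}" and g: "continuous_on T g"
    and le: "\<And>y z. y \<in> T \<Longrightarrow> z \<in> T \<Longrightarrow> g z \<bullet> y \<le> F y" and eq: "\<And>y. y \<in> T \<Longrightarrow> g y \<bullet> y = F y"
  obtains K where "convex_body K" "\<And>y. y \<in> T \<Longrightarrow> support_fun K y = F y"
proof -
  let ?K = "convex hull (g ` T)"
  have K: "convex_body ?K"
    using T g by (auto simp: convex_body_def intro!: compact_convex_hull compact_continuous_image)
  have "support_fun ?K y = F y" if y: "y \<in> T" for y
  proof (rule support_fun_eqI[OF K])
    have "?K \<subseteq> {p. y \<bullet> p \<le> F y}"
      using le[OF y] by (intro hull_minimal convex_halfspace_le) (auto simp: inner_commute)
    then show "x \<bullet> y \<le> F y" if "x \<in> ?K" for x using that by (auto simp: inner_commute)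
    show "g y \<in> ?K" using y by (intro hull_inc) auto
    show "g y \<bullet> y = F y" by (rule eq[OF y])
  qed
  with K show thesis by (rule that)
qed

section \<open>Second-order calculus on the sphere\<close>

definition outer2 :: "real^'n \<Rightarrow> real^'n \<Rightarrow> real^'n^'n" where
  "outer2 a b = (\<chi> i j. a $ i * b $ j)"

lemma vector_matrix_outer2: "v v* outer2 a b = (a \<bullet> v) *\<^sub>R b"
  by (simp add: outer2_def vector_matrix_mult_def vec_eq_iff inner_vec_def sum_distrib_left sum_distrib_right mult_ac)

lemma vector_matrix_add: "v v* (A + B) = v v* A + v v* B" for A B :: "real^'n^'m"
  by (simp add: vector_matrix_mult_def vec_eq_iff distrib_left distrib_right sum.distrib)

lemma vector_matrix_scaleR: "v v* (c *\<^sub>R A) = c *\<^sub>R (v v* A)" for A :: "real^'n^'m"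
  by (simp add: vector_matrix_mult_def vec_eq_iff sum_distrib_left mult_ac)

lemma vector_matrix_inner: "(v v* A) \<bullet> w = v \<bullet> (A *v w)" for A :: "real^'n^'m"
  by (simp add: vector_matrix_mult_def matrix_vector_mult_def inner_vec_def sum_distrib_left sum_distrib_right mult_ac)
    (rule sum.swap)

lemma vector_matrix_nth: "(v v* A) $ j = v \<bullet> (\<chi> i. A $ i $ j)" for A :: "real^'n^'m"
  by (simp add: vector_matrix_mult_def inner_vec_def mult.commute)

text \<open>The Hessian acts on row vectors because \<open>hessian F x $ i $ j\<close> differentiates the \<open>j\<close>-th
  component of the gradient in direction \<open>i\<close>.\<close>
definition has_hess :: "(real^'n \<Rightarrow> real) \<Rightarrow> (real^'n \<Rightarrow> real^'n) \<Rightarrow> (real^'n \<Rightarrow> real^'n^'n) \<Rightarrow> bool" where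
  "has_hess F g H \<longleftrightarrow> (\<forall>x. x \<noteq> 0 \<longrightarrow> (F has_derivative (\<lambda>v. g x \<bullet> v)) (at x) \<and>
     (g has_derivative (\<lambda>v. v v* H x)) (at x)) \<and> continuous_on (- {0}) H"

lemma has_hessD:
  assumes "has_hess F g H"
  shows "x \<noteq> 0 \<Longrightarrow> (F has_derivative (\<lambda>v. g x \<bullet> v)) (at x)"
    and "x \<noteq> 0 \<Longrightarrow> (g has_derivative (\<lambda>v. v v* H x)) (at x)"
    and "continuous_on (- {0}) H"
  using assms by (auto simp: has_hess_def)

lemma has_hess_cong:
  assumes "has_hess F g H" "\<And>x. x \<noteq> 0 \<Longrightarrow> F' x = F x"
  shows "has_hess F' g H"
proof -
  have "(F' has_derivative (\<lambda>v. g x \<bullet> v)) (at x)" if "x \<noteq> 0" for x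
    using has_derivative_transform_within_open[OF has_hessD(1)[OF assms(1) that], of "- {0}"] assms(2) that by (auto simp: open_Compl)
  then show ?thesis using assms(1) by (auto simp: has_hess_def)
qed

lemma has_hess_continuous:
  assumes "has_hess F g H"
  shows "continuous_on (- {0}) F" "continuous_on (- {0}) g"
  using has_hessD[OF assms] has_derivative_continuous continuous_at_imp_continuous_on
  by (metis ComplD singletonI)+

lemma has_hess_add:
  assumes "has_hess F g H" "has_hess F' g' H'"
  shows "has_hess (\<lambda>x. F x + F' x) (\<lambda>x. g x + g' x) (\<lambda>x. H x + H' x)"
  using has_hessD[OF assms(1)] has_hessD[OF assms(2)]
  by (auto simp: has_hess_def inner_add_left vector_matrix_add intro!: has_derivative_add continuous_on_add)

lemma has_hess_scale:
  assumes "has_hess F g H"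
  shows "has_hess (\<lambda>x. c * F x) (\<lambda>x. c *\<^sub>R g x) (\<lambda>x. c *\<^sub>R H x)"
  using has_hessD[OF assms]
  by (auto simp: has_hess_def vector_matrix_scaleR intro!: has_derivative_mult_right has_derivative_scaleR_right continuous_intros)

lemma has_hess_mult:
  fixes F F' :: "real^'n \<Rightarrow> real"
  assumes F: "has_hess F g H" and F': "has_hess F' g' H'"
  shows "has_hess (\<lambda>x. F x * F' x) (\<lambda>x. F x *\<^sub>R g' x + F' x *\<^sub>R g x)
    (\<lambda>x. F x *\<^sub>R H' x + outer2 (g x) (g' x) + (F' x *\<^sub>R H x + outer2 (g' x) (g x)))"
  unfolding has_hess_def
proof (intro conjI allI impI)
  fix x :: "real^'n" assume x: "x \<noteq> 0"
  show "((\<lambda>x. F x * F' x) has_derivative (\<lambda>v. (F x *\<^sub>R g' x + F' x *\<^sub>R g x) \<bullet> v)) (at x)"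
    using has_derivative_mult[OF has_hessD(1)[OF F x] has_hessD(1)[OF F' x]]
    by (simp add: inner_add_left mult.commute)
  show "((\<lambda>x. F x *\<^sub>R g' x + F' x *\<^sub>R g x) has_derivative
      (\<lambda>v. v v* (F x *\<^sub>R H' x + outer2 (g x) (g' x) + (F' x *\<^sub>R H x + outer2 (g' x) (g x))))) (at x)"
    using has_derivative_add[OF has_derivative_scaleR[OF has_hessD(1)[OF F x] has_hessD(2)[OF F' x]]
        has_derivative_scaleR[OF has_hessD(1)[OF F' x] has_hessD(2)[OF F x]]]
    by (simp add: vector_matrix_add vector_matrix_scaleR vector_matrix_outer2)
next
  show "continuous_on (- {0}) (\<lambda>x. F x *\<^sub>R H' x + outer2 (g x) (g' x) + (F' x *\<^sub>R H x + outer2 (g' x) (g x)))"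
    unfolding outer2_def
    by (intro continuous_intros has_hess_continuous[OF F] has_hess_continuous[OF F'] has_hessD(3)[OF F] has_hessD(3)[OF F'])
qed

lemma has_hess_quadratic:
  fixes M :: "real^'n^'n"
  shows "has_hess (\<lambda>x. x \<bullet> (M *v x)) (\<lambda>x. M *v x + transpose M *v x) (\<lambda>_. M + transpose M)"
  unfolding has_hess_def
proof (intro conjI allI impI)
  fix x :: "real^'n"
  have b: "bounded_linear ((*v) M)" "bounded_linear ((*v) (transpose M))"
    by (auto simp: linear_conv_bounded_linear[symmetric])
  have "((\<lambda>x. x \<bullet> (M *v x)) has_derivative (\<lambda>v. x \<bullet> (M *v v) + v \<bullet> (M *v x))) (at x)"
    by (intro has_derivative_inner has_derivative_ident bounded_linear.has_derivative[OF b(1)])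
  moreover have "x \<bullet> (M *v v) = (transpose M *v x) \<bullet> v" for v
    unfolding transpose_matrix_vector vector_matrix_inner ..
  ultimately show "((\<lambda>x. x \<bullet> (M *v x)) has_derivative (\<lambda>v. (M *v x + transpose M *v x) \<bullet> v)) (at x)"
    by (simp add: inner_add_left inner_add_right inner_commute add.commute)
  have "((\<lambda>x. M *v x + transpose M *v x) has_derivative (\<lambda>v. M *v v + transpose M *v v)) (at x)"
    by (intro has_derivative_add bounded_linear.has_derivative[OF b(1)] bounded_linear.has_derivative[OF b(2)] has_derivative_ident)
  moreover have "v v* (M + transpose M) = M *v v + transpose M *v v" for v
    by (simp add: vector_matrix_add transpose_matrix_vector vector_transpose_matrix add.commute)
  ultimately show "((\<lambda>x. M *v x + transpose M *v x) has_derivative (\<lambda>v. v v* (M + transpose M))) (at x)"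
    by simp
qed simp

text \<open>A product of two degree-one functions, like a quadratic form, has degree two;
  multiplication by the inverse norm brings it back to degree one. Hence this Hessian enters every
  computation of \<open>D2\<close> for products.\<close>

lemma has_hess_inverse_norm:
  "has_hess (\<lambda>x. inverse (norm x)) (\<lambda>x. (- (inverse (norm x) ^ 3)) *\<^sub>R x)
     (\<lambda>x. (- (inverse (norm x) ^ 3)) *\<^sub>R mat 1 + (3 * inverse (norm x) ^ 5) *\<^sub>R outer2 x (x :: real^'n))"
proof -
  have 1: "((\<lambda>x. inverse (norm x)) has_derivative (\<lambda>v. - (inverse (norm x) ^ 3) * (x \<bullet> v))) (at x)" if "x \<noteq> 0" for x :: "real^'n"
  proof -
    have "(norm has_derivative (\<lambda>v. v \<bullet> sgn x)) (at x)" by (rule has_derivative_norm[OF that])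
    from Deriv.has_derivative_inverse[OF _ this] that
    have "((\<lambda>x. inverse (norm x)) has_derivative (\<lambda>v. - (inverse (norm x) * (v \<bullet> sgn x) * inverse (norm x)))) (at x)"
      by simp
    moreover have "- (inverse (norm x) * (v \<bullet> sgn x) * inverse (norm x)) = - (inverse (norm x) ^ 3) * (x \<bullet> v)" for v
      by (simp add: sgn_div_norm power3_eq_cube inner_commute)
    ultimately show ?thesis by simp
  qed
  have 2: "((\<lambda>x. - (inverse (norm x) ^ 3)) has_derivative (\<lambda>v. 3 * inverse (norm x) ^ 5 * (x \<bullet> v))) (at x)" if "x \<noteq> 0" for x :: "real^'n"
  proof -
    have "((\<lambda>x. - (inverse (norm x) ^ 3)) has_derivative
       (\<lambda>v. - (of_nat 3 * (- (inverse (norm x) ^ 3) * (x \<bullet> v)) * inverse (norm x) ^ (3 - 1)))) (at x)"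
      by (intro has_derivative_minus has_derivative_power 1 that)
    then show ?thesis
      by (rule has_derivative_eq_rhs) (auto simp: fun_eq_iff power_numeral_reduce)
  qed
  show ?thesis
    unfolding has_hess_def
  proof (intro conjI allI impI)
    fix x :: "real^'n" assume x: "x \<noteq> 0"
    show "((\<lambda>x. inverse (norm x)) has_derivative (\<lambda>v. ((- (inverse (norm x) ^ 3)) *\<^sub>R x) \<bullet> v)) (at x)"
      using 1[OF x] by simp
    have "((\<lambda>x. (- (inverse (norm x) ^ 3)) *\<^sub>R x) has_derivative
        (\<lambda>v. (- (inverse (norm x) ^ 3)) *\<^sub>R v + (3 * inverse (norm x) ^ 5 * (x \<bullet> v)) *\<^sub>R x)) (at x)"
      by (rule has_derivative_scaleR[OF 2[OF x] has_derivative_ident])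
    moreover have "v v* mat 1 = v" for v :: "real^'n"
      by (simp add: vector_matrix_mul_rid)
    ultimately show "((\<lambda>x. (- (inverse (norm x) ^ 3)) *\<^sub>R x) has_derivative
        (\<lambda>v. v v* ((- (inverse (norm x) ^ 3)) *\<^sub>R mat 1 + (3 * inverse (norm x) ^ 5) *\<^sub>R outer2 x x))) (at x)"
      by (simp only: vector_matrix_add vector_matrix_scaleR vector_matrix_outer2 scaleR_scaleR)
  next
    show "continuous_on (- {0}) (\<lambda>x. (- (inverse (norm x) ^ 3)) *\<^sub>R mat 1 + (3 * inverse (norm x) ^ 5) *\<^sub>R outer2 x (x :: real^'n))"
      unfolding outer2_def by (auto intro!: continuous_intros)
  qed
qed

lemma linear_eq_inner_axis:
  fixes f :: "real^'n \<Rightarrow> real"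
  assumes "linear f"
  shows "f v = (\<chi> i. f (axis i 1)) \<bullet> v"
proof -
  have "f v = f (\<Sum>i\<in>UNIV. (v $ i) *\<^sub>R axis i 1)"
    using basis_expansion[of v] by (simp add: scalar_mult_eq_scaleR)
  also have "\<dots> = (\<Sum>i\<in>UNIV. v $ i * f (axis i 1))"
    by (simp add: linear_sum[OF assms] linear_scale[OF assms])
  finally show ?thesis by (simp add: inner_vec_def mult.commute)
qed

lemma grad_eqI:
  assumes "(F has_derivative (\<lambda>v. g \<bullet> v)) (at x)"
  shows "grad F x = g"
  by (simp add: grad_def vec_eq_iff inner_axis flip: frechet_derivative_at[OF assms])

lemma has_hess_components:
  assumes "has_hess F g H" "x \<noteq> 0"
  shows "((\<lambda>y. grad F y $ j) has_derivative (\<lambda>v. (v v* H x) $ j)) (at x)"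
proof -
  have "((\<lambda>y. g y $ j) has_derivative (\<lambda>v. (v v* H x) $ j)) (at x)"
    using bounded_linear.has_derivative[OF bounded_linear_vec_nth has_hessD(2)[OF assms]] .
  then show ?thesis
    by (rule has_derivative_transform_within_open[of _ _ _ _ "- {0}"])
      (use assms grad_eqI[OF has_hessD(1)[OF assms(1)]] in auto)
qed

lemma has_hess_unique:
  assumes "has_hess F g H" "x \<noteq> 0"
  shows "grad F x = g x" "hessian F x = H x"
proof -
  show "grad F x = g x" by (rule grad_eqI[OF has_hessD(1)[OF assms]])
  have "frechet_derivative (\<lambda>y. grad F y $ j) (at x) (axis i 1) = H x $ i $ j" for i j
    using frechet_derivative_at[OF has_hess_components[OF assms, of j], symmetric]
    by (simp add: vector_matrix_nth inner_axis')
  then show "hessian F x = H x" by (simp add: hessian_def vec_eq_iff)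
qed

lemma C2_sphere_if_has_hess:
  assumes "has_hess (hom_ext f) g H"
  shows "C2_sphere f"
proof -
  have "continuous_on (- {0}) (hessian (hom_ext f))"
    using has_hessD(3)[OF assms] by (rule continuous_on_eq) (simp add: has_hess_unique[OF assms])
  then show ?thesis
    using has_hessD(1)[OF assms] has_hess_components[OF assms]
    unfolding C2_sphere_def Let_def by (auto intro: differentiableI)
qed

lemma has_hess_if_C2_sphere:
  assumes "C2_sphere f"
  shows "has_hess (hom_ext f) (grad (hom_ext f)) (D2 f)"
  unfolding has_hess_def
proof (intro conjI allI impI)
  let ?F = "hom_ext f"
  have 1: "?F differentiable (at x)" "(\<lambda>y. grad ?F y $ j) differentiable (at x)" if "x \<noteq> 0" for x j
    using assms that by (auto simp: C2_sphere_def Let_def)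
  show "continuous_on (- {0}) (D2 f)" using assms by (simp add: C2_sphere_def Let_def D2_def[abs_def])
  fix x :: "real^'a" assume x: "x \<noteq> 0"
  have "(?F has_derivative frechet_derivative ?F (at x)) (at x)"
    using 1(1)[OF x] by (simp add: frechet_derivative_works)
  moreover from this have "frechet_derivative ?F (at x) = (\<lambda>v. grad ?F x \<bullet> v)"
    unfolding grad_def by (intro ext linear_eq_inner_axis has_derivative_linear)
  ultimately show "(?F has_derivative (\<lambda>v. grad ?F x \<bullet> v)) (at x)" by simp
  have comp: "((\<lambda>y. grad ?F y $ j) has_derivative (\<lambda>v. (v v* D2 f x) $ j)) (at x)" for j
  proof -
    let ?D = "frechet_derivative (\<lambda>y. grad ?F y $ j) (at x)"
    have D: "((\<lambda>y. grad ?F y $ j) has_derivative ?D) (at x)"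
      using 1(2)[OF x] by (simp add: frechet_derivative_works)
    have "?D v = (v v* D2 f x) $ j" for v
      unfolding linear_eq_inner_axis[OF has_derivative_linear[OF D], of v]
      by (simp add: vector_matrix_mult_def D2_def hessian_def inner_vec_def mult.commute)
    then have "?D = (\<lambda>v. (v v* D2 f x) $ j)" by (rule ext)
    then show ?thesis using D by simp
  qed
  show "(grad ?F has_derivative (\<lambda>v. v v* D2 f x)) (at x)"
    unfolding has_derivative_componentwise_within[of "grad ?F"]
    using comp by (auto simp: Basis_vec_def inner_axis)
qed

section \<open>Homogeneity identities for the degree-one extension\<close>

lemma hom_ext_cong:
  fixes f g :: "real^'n \<Rightarrow> real"
  shows "(\<And>x. norm x = 1 \<Longrightarrow> f x = g x) \<Longrightarrow> hom_ext f = hom_ext g"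
proof
  fix y :: "real^'n" assume "\<And>x. norm x = 1 \<Longrightarrow> f x = g x"
  then show "hom_ext f y = hom_ext g y" by (cases "y = 0") (auto simp: hom_ext_def)
qed

lemma hom_ext_sphere: "norm x = 1 \<Longrightarrow> hom_ext f x = f x"
  by (simp add: hom_ext_def)

lemma hom_ext_scaleR:
  assumes "t > 0"
  shows "hom_ext f (t *\<^sub>R x) = t * hom_ext f x"
proof -
  have eq: "inverse t * inverse (norm x) * t = inverse (norm x)" using assms by (simp add: field_simps)
  have "(t *\<^sub>R x) /\<^sub>R norm (t *\<^sub>R x) = (inverse t * inverse (norm x) * t) *\<^sub>R x" using assms by simp
  then have "(t *\<^sub>R x) /\<^sub>R norm (t *\<^sub>R x) = x /\<^sub>R norm x" unfolding eq .
  then show ?thesis unfolding hom_ext_def using assms by (metis abs_of_pos mult.assoc norm_scaleR)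
qed

context
  fixes f :: "real^'n \<Rightarrow> real"
  assumes C2: "C2_sphere f"
begin

lemmas hh = has_hess_if_C2_sphere[OF C2]

lemma grad_scaleR:
  assumes "x \<noteq> 0" "t > 0"
  shows "grad (hom_ext f) (t *\<^sub>R x) = grad (hom_ext f) x"
proof -
  let ?F = "hom_ext f"
  have "((\<lambda>y. ?F (t *\<^sub>R y)) has_derivative (\<lambda>v. grad ?F (t *\<^sub>R x) \<bullet> (t *\<^sub>R v))) (at x)"
    by (rule has_derivative_compose[OF has_derivative_scaleR_right[OF has_derivative_ident] has_hessD(1)[OF hh]])
      (use assms in auto)
  then have "((\<lambda>y. t * ?F y) has_derivative (\<lambda>v. (t *\<^sub>R grad ?F (t *\<^sub>R x)) \<bullet> v)) (at x)"
    using assms by (simp add: hom_ext_scaleR)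
  moreover have "((\<lambda>y. t * ?F y) has_derivative (\<lambda>v. (t *\<^sub>R grad ?F x) \<bullet> v)) (at x)"
    using has_derivative_mult_right[OF has_hessD(1)[OF hh assms(1)], of t] by simp
  ultimately have "t *\<^sub>R grad ?F (t *\<^sub>R x) = t *\<^sub>R grad ?F x" using grad_eqI by metis
  then show ?thesis using assms by simp
qed

lemma ray_derivative:
  assumes "x \<noteq> 0" "(G has_derivative G') (at x)"
  shows "((\<lambda>t::real. G (t *\<^sub>R x)) has_derivative (\<lambda>t. G' (t *\<^sub>R x))) (at 1)"
  by (rule has_derivative_compose[OF has_derivative_scaleR_left[OF has_derivative_ident]])
    (use assms in simp)

lemma euler_grad:
  assumes "x \<noteq> 0"
  shows "grad (hom_ext f) x \<bullet> x = hom_ext f x"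
proof -
  let ?F = "hom_ext f"
  have "((\<lambda>t. ?F (t *\<^sub>R x)) has_derivative (\<lambda>t. grad ?F x \<bullet> (t *\<^sub>R x))) (at 1)"
    by (rule ray_derivative[OF assms has_hessD(1)[OF hh assms]])
  then have "((\<lambda>t. t * ?F x) has_derivative (\<lambda>t. grad ?F x \<bullet> (t *\<^sub>R x))) (at 1)"
    by (rule has_derivative_transform_within_open[of _ _ _ _ "{0<..}"]) (auto simp: hom_ext_scaleR)
  moreover have "((\<lambda>t. t * ?F x) has_derivative (\<lambda>t. t * ?F x)) (at 1)"
    by (auto intro!: derivative_eq_intros)
  ultimately have "(\<lambda>t. grad ?F x \<bullet> (t *\<^sub>R x)) = (\<lambda>t. t * ?F x)" by (rule has_derivative_unique)
  from fun_cong[OF this, of 1] show ?thesis by simp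
qed

text \<open>The gradient of a degree-one function is constant along rays, so its derivative in the
  radial direction vanishes.\<close>

lemma D2_left_zero:
  assumes "x \<noteq> 0"
  shows "x v* D2 f x = 0"
proof -
  let ?g = "grad (hom_ext f)"
  have "((\<lambda>t. ?g (t *\<^sub>R x)) has_derivative (\<lambda>t. (t *\<^sub>R x) v* D2 f x)) (at 1)"
    by (rule ray_derivative[OF assms has_hessD(2)[OF hh assms]])
  then have "((\<lambda>t. ?g x) has_derivative (\<lambda>t. (t *\<^sub>R x) v* D2 f x)) (at (1::real))"
    by (rule has_derivative_transform_within_open[of _ _ _ _ "{0<..}"]) (auto simp: grad_scaleR assms)
  moreover have "((\<lambda>t. ?g x) has_derivative (\<lambda>t. 0)) (at (1::real))" by simp
  ultimately have "(\<lambda>t. (t *\<^sub>R x) v* D2 f x) = (\<lambda>t::real. 0)" by (rule has_derivative_unique)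
  from fun_cong[OF this, of 1] show ?thesis by simp
qed

text \<open>Differentiating Euler's relation yields the right kernel independently of the left
  one.\<close>

lemma D2_right_zero:
  assumes "x \<noteq> 0"
  shows "D2 f x *v x = 0"
proof -
  let ?F = "hom_ext f" and ?g = "grad (hom_ext f)"
  have "((\<lambda>y. ?g y \<bullet> y) has_derivative (\<lambda>v. ?g x \<bullet> v + (v v* D2 f x) \<bullet> x)) (at x)"
    by (intro has_derivative_inner has_hessD(2)[OF hh assms] has_derivative_ident)
  then have "(?F has_derivative (\<lambda>v. ?g x \<bullet> v + (v v* D2 f x) \<bullet> x)) (at x)"
    by (rule has_derivative_transform_within_open[of _ _ _ _ "- {0}"]) (auto simp: euler_grad assms)
  then have "(\<lambda>v. ?g x \<bullet> v + (v v* D2 f x) \<bullet> x) = (\<lambda>v. ?g x \<bullet> v)"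
    using has_hessD(1)[OF hh assms] by (rule has_derivative_unique)
  then have "v \<bullet> (D2 f x *v x) = 0" for v
    by (simp add: fun_eq_iff vector_matrix_inner)
  then show ?thesis by (metis inner_eq_zero_iff)
qed

lemma D2_quadratic_tangential: "x \<noteq> 0 \<Longrightarrow> (v + a *\<^sub>R x) \<bullet> (D2 f x *v (v + a *\<^sub>R x)) = v \<bullet> (D2 f x *v v)"
  using D2_left_zero[of x] vector_matrix_inner[of x "D2 f x" v]
  by (simp add: matrix_vector_right_distrib matrix_vector_mult_scaleR D2_right_zero inner_add_left)

text \<open>By Euler's relation the first-order Taylor polynomial at \<open>z\<close> reduces to the
  linear function given by the gradient at \<open>z\<close>, so the left-hand side is a pure
  second-order term. The segment must avoid the origin, where the extension need not be
  differentiable.\<close>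

lemma taylor2:
  assumes seg: "\<And>t. 0 \<le> t \<Longrightarrow> t \<le> 1 \<Longrightarrow> z + t *\<^sub>R (y - z) \<noteq> 0"
  obtains t where "0 < t" "t < 1"
    "hom_ext f y - grad (hom_ext f) z \<bullet> y
       = (y - z) \<bullet> (D2 f (z + t *\<^sub>R (y - z)) *v (y - z)) / 2"
proof -
  let ?F = "hom_ext f" and ?g = "grad (hom_ext f)"
  define d where "d = y - z"
  define w where "w t = z + t *\<^sub>R d" for t
  have dw: "(w has_derivative (\<lambda>s. s *\<^sub>R d)) (at t)" for t
    unfolding w_def[abs_def] by (auto intro!: derivative_eq_intros)
  have w0: "w t \<noteq> 0" if "0 \<le> t" "t \<le> 1" for t using seg[OF that] by (simp add: w_def d_def)
  define \<phi> where "\<phi> m t = (if m = 0 then ?F (w t) else if m = 1 then ?g (w t) \<bullet> d else d \<bullet> (D2 f (w t) *v d))" for m :: nat and t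
  have "DERIV (\<phi> m) t :> \<phi> (Suc m) t" if "m < 2 \<and> 0 \<le> t \<and> t \<le> 1" for m t
  proof (cases "m = 0")
    case True
    have "((\<lambda>t. ?F (w t)) has_derivative (\<lambda>s. ?g (w t) \<bullet> (s *\<^sub>R d))) (at t)"
      by (rule has_derivative_compose[OF dw has_hessD(1)[OF hh w0]]) (use that in auto)
    then show ?thesis using True by (simp add: \<phi>_def[abs_def] has_field_derivative_def mult_commute_abs)
  next
    case False
    then have m: "m = 1" using that by simp
    have "((\<lambda>t. ?g (w t)) has_derivative (\<lambda>s. (s *\<^sub>R d) v* D2 f (w t))) (at t)"
      by (rule has_derivative_compose[OF dw has_hessD(2)[OF hh w0]]) (use that in auto)
    from has_derivative_inner_left[OF this, of d] show ?thesis
      using m by (simp add: \<phi>_def[abs_def] has_field_derivative_def vector_matrix_inner mult_commute_abs)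
  qed
  then obtain t where t: "0 < t" "t < 1" "\<phi> 0 1 = (\<Sum>m<2. \<phi> m 0 / fact m * (1 - 0) ^ m) + \<phi> 2 t / fact 2 * (1 - 0) ^ 2"
    using Taylor_up[of 2 \<phi> "\<phi> 0" 0 1 0] by auto
  then have "?F y = ?F z + ?g z \<bullet> d + d \<bullet> (D2 f (w t) *v d) / 2"
    by (simp add: \<phi>_def w_def d_def numeral_2_eq_2)
  moreover have "z \<noteq> 0" using seg[of 0] by simp
  ultimately have "?F y - ?g z \<bullet> y = d \<bullet> (D2 f (w t) *v d) / 2"
    by (simp add: d_def inner_diff_right euler_grad)
  then show thesis using t(1,2) that by (simp add: w_def d_def)
qed

end

section \<open>From second-order bounds to support functions\<close>

lemma norm_matrix_vector_le: "norm (A *v x) \<le> norm A * norm x" for A :: "real^'n^'m"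
proof -
  have "norm (A *v x) = L2_set (\<lambda>i. \<bar>A $ i \<bullet> x\<bar>) UNIV"
    by (simp add: norm_vec_def matrix_vector_mult_def inner_vec_def)
  also have "\<dots> \<le> L2_set (\<lambda>i. norm (A $ i) * norm x) UNIV"
    by (intro L2_set_mono) (auto simp: Cauchy_Schwarz_ineq2)
  also have "\<dots> = norm A * norm x" by (simp add: L2_set_left_distrib norm_vec_def)
  finally show ?thesis .
qed

lemma abs_quadratic_le: "\<bar>v \<bullet> (A *v v)\<bar> \<le> norm A * (norm v)\<^sup>2" for A :: "real^'n^'n"
proof -
  have "\<bar>v \<bullet> (A *v v)\<bar> \<le> norm v * norm (A *v v)" by (rule Cauchy_Schwarz_ineq2)
  also have "\<dots> \<le> norm v * (norm A * norm v)" by (intro mult_left_mono norm_matrix_vector_le) auto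
  finally show ?thesis by (simp add: power2_eq_square mult_ac)
qed

text \<open>Adding \<open>c\<close> adds c(1 - z . y) = (c/2)|y - z|^2 to the gap between
  \<open>f\<close> and its tangent plane at \<open>z\<close>. For close points this absorbs the
  Taylor remainder, for distant points it beats crude bounds on values and gradients. The hull of
  the gradients is then the body.\<close>

lemma C2_sphere_support_fun:
  fixes f :: "real^'n \<Rightarrow> real"
  assumes C2: "C2_sphere f"
  obtains c0 where "c0 \<ge> 0" "\<And>c. c \<ge> c0 \<Longrightarrow> \<exists>K. convex_body K \<and> (\<forall>x\<in>sphere 0 1. support_fun K x = f x + c)"
proof -
  let ?F = "hom_ext f" and ?g = "grad (hom_ext f)"
  note hh = has_hess_if_C2_sphere[OF C2]
  let ?S = "sphere 0 1 :: (real^'n) set"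
  have sub: "?S \<subseteq> - {0}" by auto
  \<comment> \<open>The second derivatives are bounded on this annulus, which contains the segments
    between unit vectors at distance at most 1.\<close>
  define T where "T = cball (0 :: real^'n) 1 - ball 0 (1/2)"
  have "compact T" unfolding T_def by (intro compact_diff) auto
  then have "bounded (D2 f ` T)"
    by (intro compact_imp_bounded compact_continuous_image continuous_on_subset[OF has_hessD(3)[OF hh]]) (auto simp: T_def)
  then obtain B where B: "\<And>x. x \<in> T \<Longrightarrow> norm (D2 f x) \<le> B" by (auto simp: bounded_iff)
  have bd: "bounded (?g ` ?S)" "bounded (?F ` ?S)"
    by (intro compact_imp_bounded compact_continuous_image continuous_on_subset[OF has_hess_continuous(2)[OF hh] sub]
        continuous_on_subset[OF has_hess_continuous(1)[OF hh] sub]; simp)+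
  obtain B1 where "\<forall>x\<in>?S. norm (?g x) \<le> B1" using bd(1) by (auto simp: bounded_iff)
  moreover obtain B2 where "\<forall>x\<in>?S. \<bar>?F x\<bar> \<le> B2" using bd(2) by (auto simp: bounded_iff)
  ultimately have B12: "norm (?g x) \<le> B1" "\<bar>?F x\<bar> \<le> B2" if "norm x = 1" for x using that by auto
  \<comment> \<open>The first term serves close points; the second serves points at distance greater
    than 1, where c0/2 must reach the bound for gradient plus value.\<close>
  define c0 where "c0 = \<bar>B\<bar> + 2 * (\<bar>B1\<bar> + \<bar>B2\<bar>)"
  have key: "?g z \<bullet> y \<le> ?F y + c0 / 2 * (norm (y - z))\<^sup>2" if yz: "norm y = 1" "norm z = 1" for y z
  proof (cases "norm (y - z) \<le> 1")
    case True
    have inT: "z + t *\<^sub>R (y - z) \<in> T" if t: "0 \<le> t" "t \<le> 1" for t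
    proof -
      have eq: "z + t *\<^sub>R (y - z) = (1 - t) *\<^sub>R z + t *\<^sub>R y" by (simp add: algebra_simps)
      have "norm ((1 - t) *\<^sub>R z + t *\<^sub>R y) \<le> (1 - t) + t"
        using norm_triangle_ineq[of "(1 - t) *\<^sub>R z" "t *\<^sub>R y"] t yz by simp
      then have le: "norm (z + t *\<^sub>R (y - z)) \<le> 1" unfolding eq by simp
      have "norm (z + t *\<^sub>R (y - z)) \<ge> 1 / 2"
      proof (cases "t \<le> 1 / 2")
        case True
        have "norm (t *\<^sub>R (y - z)) \<le> 1 / 2 * 1"
          using mult_mono[of t "1 / 2" "norm (y - z)" 1] True t \<open>norm (y - z) \<le> 1\<close> by simp
        then show ?thesis using norm_triangle_ineq2[of z "- (t *\<^sub>R (y - z))"] yz by simp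
      next
        case False
        have "norm ((1 - t) *\<^sub>R (y - z)) \<le> 1 / 2 * 1"
          using mult_mono[of "1 - t" "1 / 2" "norm (y - z)" 1] False t \<open>norm (y - z) \<le> 1\<close> by simp
        moreover have "z + t *\<^sub>R (y - z) = y - (1 - t) *\<^sub>R (y - z)" by (simp add: algebra_simps)
        ultimately show ?thesis using norm_triangle_ineq2[of y "(1 - t) *\<^sub>R (y - z)"] yz by simp
      qed
      then show ?thesis using le by (simp add: T_def)
    qed
    have "z + t *\<^sub>R (y - z) \<noteq> 0" if "0 \<le> t" "t \<le> 1" for t using inT[OF that] by (auto simp: T_def)
    then obtain t where t: "0 < t" "t < 1"
      "?F y - ?g z \<bullet> y = (y - z) \<bullet> (D2 f (z + t *\<^sub>R (y - z)) *v (y - z)) / 2"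
      using taylor2[OF C2] by blast
    have "\<bar>(y - z) \<bullet> (D2 f (z + t *\<^sub>R (y - z)) *v (y - z))\<bar> \<le> norm (D2 f (z + t *\<^sub>R (y - z))) * (norm (y - z))\<^sup>2"
      by (rule abs_quadratic_le)
    also have "\<dots> \<le> c0 * (norm (y - z))\<^sup>2"
      using B[OF inT[of t]] t by (intro mult_right_mono) (auto simp: c0_def)
    finally show ?thesis using t(3) by (simp add: abs_le_iff field_simps)
  next
    case False
    have "?g z \<bullet> y \<le> norm (?g z) * norm y" by (rule norm_cauchy_schwarz)
    then have "?g z \<bullet> y - ?F y \<le> \<bar>B1\<bar> + \<bar>B2\<bar>" using B12(1)[OF yz(2)] B12(2)[OF yz(1)] yz by simp
    also have "\<dots> \<le> c0 / 2 * 1" by (simp add: c0_def)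
    also have "\<dots> \<le> c0 / 2 * (norm (y - z))\<^sup>2"
      using False by (intro mult_left_mono) (auto simp: c0_def one_le_power)
    finally show ?thesis by simp
  qed
  show thesis
  proof (rule that)
    show "c0 \<ge> 0" by (simp add: c0_def)
    fix c assume c: "c \<ge> c0"
    obtain K where "convex_body K" "\<And>y. y \<in> ?S \<Longrightarrow> support_fun K y = f y + c"
    proof (rule gradient_hull_support_fun[of ?S "\<lambda>z. ?g z + c *\<^sub>R z" "\<lambda>y. f y + c"])
      obtain e :: "real^'n" where "norm e = 1" using vector_choose_size[of 1] by auto
      then show "?S \<noteq> {}" by auto
      show "continuous_on ?S (\<lambda>z. ?g z + c *\<^sub>R z)"
        by (intro continuous_intros continuous_on_subset[OF has_hess_continuous(2)[OF hh] sub])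
      show "(?g y + c *\<^sub>R y) \<bullet> y = f y + c" if "y \<in> ?S" for y
      proof -
        have "y \<noteq> 0" using that by auto
        then show ?thesis using that euler_grad[OF C2, of y] hom_ext_sphere[of y f]
          by (simp add: inner_add_left norm_eq_1)
      qed
      show "(?g z + c *\<^sub>R z) \<bullet> y \<le> f y + c" if yz: "y \<in> ?S" "z \<in> ?S" for y z
      proof -
        have "(norm (y - z))\<^sup>2 = 2 - 2 * (z \<bullet> y)"
          using yz by (simp add: power2_norm_eq_inner inner_diff_left inner_diff_right inner_commute norm_eq_1)
        then have "c / 2 * (norm (y - z))\<^sup>2 = c * (1 - z \<bullet> y)" by simp
        moreover have "c0 / 2 * (norm (y - z))\<^sup>2 \<le> c / 2 * (norm (y - z))\<^sup>2" using c by (intro mult_right_mono) auto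
        moreover have "?g z \<bullet> y \<le> f y + c0 / 2 * (norm (y - z))\<^sup>2"
          using key[of y z] yz hom_ext_sphere[of y f] by simp
        ultimately have "?g z \<bullet> y \<le> f y + c * (1 - z \<bullet> y)" by linarith
        then show ?thesis by (simp add: inner_add_left algebra_simps)
      qed
    qed auto
    then show "\<exists>K. convex_body K \<and> (\<forall>x\<in>?S. support_fun K x = f x + c)" by blast
  qed
qed

lemma supp_diff_if_C2_sphere:
  assumes "C2_sphere f"
  shows "supp_diff f"
proof -
  obtain c0 where c0: "c0 \<ge> 0" "\<And>c. c \<ge> c0 \<Longrightarrow> \<exists>K. convex_body K \<and> (\<forall>x\<in>sphere 0 1. support_fun K x = f x + c)"
    using C2_sphere_support_fun[OF assms] by blast
  then obtain K where "convex_body K" "\<forall>x\<in>sphere 0 1. support_fun K x = f x + c0" by blast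
  then show ?thesis using c0(1)
    by (intro dsfI[OF _ convex_body_cball[of c0 0]]) (auto simp: support_fun_cball)
qed

definition posdef_at :: "(real^'n \<Rightarrow> real) \<Rightarrow> real^'n \<Rightarrow> bool" where
  "posdef_at f x \<longleftrightarrow> (\<forall>v. v \<noteq> 0 \<longrightarrow> v \<bullet> x = 0 \<longrightarrow> v \<bullet> (D2 f x *v v) > 0)"

text \<open>The Hessian is positive semidefinite on a whole ball about \<open>x0\<close>: uniform
  positivity transverse to the radial direction at \<open>x0\<close> survives small changes of both
  the Hessian and the radial direction. Taylor's formula then puts the tangent planes below
  \<open>f\<close>.\<close>

lemma posdef_at_local_support:
  fixes f :: "real^'n \<Rightarrow> real"
  assumes C2: "C2_sphere f" and x0: "norm x0 = 1" and pd: "posdef_at f x0"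
  obtains r where "r > 0" "\<And>y z. y \<in> sphere 0 1 \<inter> cball x0 r \<Longrightarrow> z \<in> sphere 0 1 \<inter> cball x0 r \<Longrightarrow>
    grad (hom_ext f) z \<bullet> y \<le> f y"
proof -
  note hh = has_hess_if_C2_sphere[OF C2]
  have x0': "x0 \<noteq> 0" using x0 by auto
  \<comment> \<open>The square compensates the radial kernel of \<open>D2\<close>, so that
    \<open>G\<close> is positive definite on the whole space and has a positive minimum
    \<open>m\<close> on the sphere.\<close>
  define G where "G w = w \<bullet> (D2 f x0 *v w) + (w \<bullet> x0)\<^sup>2" for w
  have "continuous_on (sphere 0 1) G"
    unfolding G_def by (intro continuous_intros linear_continuous_on[of "(*v) (D2 f x0)"]) (simp_all add: linear_conv_bounded_linear[symmetric])
  moreover have "sphere (0::real^'n) 1 \<noteq> {}" using x0 by auto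
  ultimately obtain w0 where w0: "norm w0 = 1" "\<And>w. norm w = 1 \<Longrightarrow> G w0 \<le> G w"
    using continuous_attains_inf[of "sphere (0::real^'n) 1" G] by auto
  define m where "m = G w0"
  have "m > 0"
  proof -
    define v where "v = w0 - (w0 \<bullet> x0) *\<^sub>R x0"
    have vx: "v \<bullet> x0 = 0" using x0 by (simp add: v_def inner_diff_left norm_eq_1)
    have "w0 = v + (w0 \<bullet> x0) *\<^sub>R x0" by (simp add: v_def)
    then have "m = v \<bullet> (D2 f x0 *v v) + (w0 \<bullet> x0)\<^sup>2"
      unfolding m_def G_def using D2_quadratic_tangential[OF C2 x0', of v "w0 \<bullet> x0"] by metis
    moreover have "v \<bullet> (D2 f x0 *v v) > 0" if "v \<noteq> 0" using pd that vx by (simp add: posdef_at_def)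
    moreover have "w0 \<bullet> x0 \<noteq> 0" if "v = 0" using w0(1) that by (auto simp: v_def)
    ultimately show ?thesis by (cases "v = 0") (auto intro: add_pos_nonneg)
  qed
  have Gm: "m * (norm w)\<^sup>2 \<le> G w" for w
  proof (cases "w = 0")
    case False
    have "G w = (norm w)\<^sup>2 * G ((1 / norm w) *\<^sub>R w)"
      using False by (simp add: G_def matrix_vector_mult_scaleR power2_eq_square field_simps)
    moreover have "m \<le> G ((1 / norm w) *\<^sub>R w)" unfolding m_def using False by (intro w0) simp
    ultimately show ?thesis 
      using mult_left_mono[of m "G ((1 / norm w) *\<^sub>R w)" "(norm w)\<^sup>2"] by (simp only: mult.commute[of m]) simp
  qed (simp add: G_def)
  have "isCont (D2 f) x0" 
    using has_hessD(3)[OF hh] x0' continuous_on_eq_continuous_at[of "- {0}" "D2 f"] by (auto simp: open_Compl)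
  then obtain r1 where r1: "r1 > 0" "\<And>y. dist y x0 < r1 \<Longrightarrow> dist (D2 f y) (D2 f x0) < m / 4"
    using \<open>m > 0\<close> by (metis continuous_at_eps_delta divide_pos_pos zero_less_numeral)
  \<comment> \<open>The bound 1/2 keeps the ball away from the origin, \<open>r1\<close> controls
    the change of the Hessian, and the bound by \<open>m\<close> limits the tilt between the tangent
    spaces at \<open>x0\<close> and at nearby points.\<close>
  define r where "r = min (min (1/2) (r1 / 2)) (m / 12)"
  have r: "r > 0" "r \<le> 1/2" "r < r1" "3 * r \<le> m / 4" using r1 \<open>m > 0\<close> by (auto simp: r_def min_def)
  have nz: "y \<noteq> 0" if "y \<in> cball x0 r" for y using that x0 r by auto
  have psd: "v \<bullet> (D2 f y *v v) \<ge> 0" if y: "y \<in> cball x0 r" for y v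
  proof -
    \<comment> \<open>\<open>a\<close> removes the radial part of \<open>v\<close> at
      \<open>y\<close>; only the tangential part \<open>w\<close> contributes to the quadratic form
      there.\<close>
    define a where "a = (v \<bullet> y) / (y \<bullet> y)"
    define w where "w = v - a *\<^sub>R y"
    have wy: "w \<bullet> y = 0" using nz[OF y] by (simp add: w_def a_def inner_diff_left)
    have "v = w + a *\<^sub>R y" by (simp add: w_def)
    then have eq: "v \<bullet> (D2 f y *v v) = w \<bullet> (D2 f y *v w)"
      using D2_quadratic_tangential[OF C2 nz[OF y], of w a] by simp
    have dist: "norm (x0 - y) \<le> r" using y by (simp add: dist_norm)
    have "\<bar>w \<bullet> ((D2 f y - D2 f x0) *v w)\<bar> \<le> norm (D2 f y - D2 f x0) * (norm w)\<^sup>2" by (rule abs_quadratic_le)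
    also have "\<dots> \<le> m / 4 * (norm w)\<^sup>2"
      using r1(2)[of y] dist r by (intro mult_right_mono) (auto simp: dist_norm norm_minus_commute)
    finally have 1: "w \<bullet> (D2 f x0 *v w) - m / 4 * (norm w)\<^sup>2 \<le> w \<bullet> (D2 f y *v w)"
      unfolding matrix_vector_mult_diff_rdistrib inner_diff_right by linarith
    have "(w \<bullet> x0)\<^sup>2 = (w \<bullet> (x0 - y))\<^sup>2" using wy by (simp add: inner_diff_right)
    also have "\<dots> \<le> (norm w * norm (x0 - y))\<^sup>2"
      using Cauchy_Schwarz_ineq2[of w "x0 - y"] abs_le_square_iff[of "w \<bullet> (x0 - y)" "norm w * norm (x0 - y)"] by simp
    also have "\<dots> \<le> (norm w * r)\<^sup>2" using dist by (intro power_mono mult_left_mono) auto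
    also have "\<dots> = r\<^sup>2 * (norm w)\<^sup>2" by (simp add: power_mult_distrib)
    also have "\<dots> \<le> m / 4 * (norm w)\<^sup>2"
    proof (rule mult_right_mono)
      have "r\<^sup>2 \<le> r * 1" using r by (simp add: power2_eq_square mult_left_mono del: mult_1_right)
      then show "r\<^sup>2 \<le> m / 4" using r by simp
    qed simp
    finally have 2: "(w \<bullet> x0)\<^sup>2 \<le> m / 4 * (norm w)\<^sup>2" .
    have "m * (norm w)\<^sup>2 \<le> w \<bullet> (D2 f x0 *v w) + (w \<bullet> x0)\<^sup>2" using Gm[of w] by (simp add: G_def)
    moreover have "m * (norm w)\<^sup>2 \<ge> 0" using \<open>m > 0\<close> by simp
    ultimately have "w \<bullet> (D2 f y *v w) \<ge> 0" using 1 2 by (simp add: field_simps)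
    then show ?thesis using eq by simp
  qed
  have "grad (hom_ext f) z \<bullet> y \<le> f y" if yz: "y \<in> sphere 0 1 \<inter> cball x0 r" "z \<in> sphere 0 1 \<inter> cball x0 r" for y z
  proof -
    have seg: "z + t *\<^sub>R (y - z) \<in> cball x0 r" if "0 \<le> t" "t \<le> 1" for t
    proof -
      have "(1 - t) *\<^sub>R z + t *\<^sub>R y \<in> cball x0 r"
        using yz that by (intro convexD[OF convex_cball]) auto
      then show ?thesis by (simp add: algebra_simps)
    qed
    then have "z + t *\<^sub>R (y - z) \<noteq> 0" if "0 \<le> t" "t \<le> 1" for t using nz that by blast
    then obtain t where t: "0 < t" "t < 1"
      "hom_ext f y - grad (hom_ext f) z \<bullet> y = (y - z) \<bullet> (D2 f (z + t *\<^sub>R (y - z)) *v (y - z)) / 2"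
      using taylor2[OF C2] by blast
    have "(y - z) \<bullet> (D2 f (z + t *\<^sub>R (y - z)) *v (y - z)) \<ge> 0" using t by (intro psd seg) auto
    then show ?thesis using t(3) yz hom_ext_sphere[of y f] by simp
  qed
  with r(1) show thesis by (rule that)
qed

section \<open>Sums, products and quadratic forms as C^2 functions on the sphere\<close>

lemma C2_sphere_add:
  assumes "C2_sphere f" "C2_sphere g"
  shows "C2_sphere (\<lambda>x. f x + g x)" and "x \<noteq> 0 \<Longrightarrow> D2 (\<lambda>x. f x + g x) x = D2 f x + D2 g x"
proof -
  have "hom_ext (\<lambda>x. f x + g x) = (\<lambda>x. hom_ext f x + hom_ext g x)" by (auto simp: hom_ext_def distrib_left)
  then have h: "has_hess (hom_ext (\<lambda>x. f x + g x)) (\<lambda>x. grad (hom_ext f) x + grad (hom_ext g) x) (\<lambda>x. D2 f x + D2 g x)"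
    using has_hess_add[OF has_hess_if_C2_sphere[OF assms(1)] has_hess_if_C2_sphere[OF assms(2)]] by simp
  then show "C2_sphere (\<lambda>x. f x + g x)" by (rule C2_sphere_if_has_hess)
  show "x \<noteq> 0 \<Longrightarrow> D2 (\<lambda>x. f x + g x) x = D2 f x + D2 g x" using has_hess_unique(2)[OF h] by (simp add: D2_def)
qed

lemma C2_sphere_scale:
  assumes "C2_sphere f"
  shows "C2_sphere (\<lambda>x. c * f x)" and "x \<noteq> 0 \<Longrightarrow> D2 (\<lambda>x. c * f x) x = c *\<^sub>R D2 f x"
proof -
  have "hom_ext (\<lambda>x. c * f x) = (\<lambda>x. c * hom_ext f x)" by (auto simp: hom_ext_def)
  then have h: "has_hess (hom_ext (\<lambda>x. c * f x)) (\<lambda>x. c *\<^sub>R grad (hom_ext f) x) (\<lambda>x. c *\<^sub>R D2 f x)"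
    using has_hess_scale[OF has_hess_if_C2_sphere[OF assms(1)]] by simp
  then show "C2_sphere (\<lambda>x. c * f x)" by (rule C2_sphere_if_has_hess)
  show "x \<noteq> 0 \<Longrightarrow> D2 (\<lambda>x. c * f x) x = c *\<^sub>R D2 f x" using has_hess_unique(2)[OF h] by (simp add: D2_def)
qed

text \<open>The Hessian of the inverse norm at a unit vector.\<close>

definition hess_inv_norm :: "real^'n \<Rightarrow> real^'n^'n" where
  "hess_inv_norm x = (- 1) *\<^sub>R mat 1 + 3 *\<^sub>R outer2 x x"

text \<open>The degree-one extension of a product is the product of the extensions divided by the
  norm, so the product rule is applied twice.\<close>

lemma C2_sphere_mult:
  fixes f g :: "real^'n \<Rightarrow> real"
  assumes "C2_sphere f" "C2_sphere g"
  shows "C2_sphere (\<lambda>x. f x * g x)"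
    and "norm x = 1 \<Longrightarrow> D2 (\<lambda>x. f x * g x) x =
      (f x * g x) *\<^sub>R hess_inv_norm x + outer2 (f x *\<^sub>R grad (hom_ext g) x + g x *\<^sub>R grad (hom_ext f) x) (- x) +
      ((f x *\<^sub>R D2 g x + outer2 (grad (hom_ext f) x) (grad (hom_ext g) x) +
         (g x *\<^sub>R D2 f x + outer2 (grad (hom_ext g) x) (grad (hom_ext f) x))) +
       outer2 (- x) (f x *\<^sub>R grad (hom_ext g) x + g x *\<^sub>R grad (hom_ext f) x))"
proof -
  note h = has_hess_mult[OF has_hess_mult[OF has_hess_if_C2_sphere[OF assms(1)] has_hess_if_C2_sphere[OF assms(2)]]
      has_hess_inverse_norm]
  have "hom_ext (\<lambda>x. f x * g x) x = hom_ext f x * hom_ext g x * inverse (norm x)" if "x \<noteq> 0" for x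
    using that by (simp add: hom_ext_def field_simps)
  note h' = has_hess_cong[OF h this]
  show "C2_sphere (\<lambda>x. f x * g x)" by (rule C2_sphere_if_has_hess[OF h'])
  assume x: "norm x = 1"
  then have "x \<noteq> 0" by auto
  from has_hess_unique(2)[OF h' this] x show "D2 (\<lambda>x. f x * g x) x =
      (f x * g x) *\<^sub>R hess_inv_norm x + outer2 (f x *\<^sub>R grad (hom_ext g) x + g x *\<^sub>R grad (hom_ext f) x) (- x) +
      ((f x *\<^sub>R D2 g x + outer2 (grad (hom_ext f) x) (grad (hom_ext g) x) +
         (g x *\<^sub>R D2 f x + outer2 (grad (hom_ext g) x) (grad (hom_ext f) x))) +
       outer2 (- x) (f x *\<^sub>R grad (hom_ext g) x + g x *\<^sub>R grad (hom_ext f) x))"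
    by (simp add: D2_def hom_ext_sphere hess_inv_norm_def)
qed

definition qf :: "real^'n^'n \<Rightarrow> real^'n \<Rightarrow> real" where
  "qf M x = x \<bullet> (M *v x)"

lemma outer2_quadratic: "v \<bullet> (outer2 a b *v v) = (a \<bullet> v) * (b \<bullet> v)" for v :: "real^'n"
  by (simp add: vector_matrix_outer2 flip: vector_matrix_inner)

text \<open>The extension is the quadratic form divided by the norm. On vectors orthogonal to
  \<open>x\<close> every term containing a factor \<open>x\<close> drops out, and the Hessian of the
  inverse norm leaves -|v|^2. These functions realise prescribed values of \<open>D2\<close> at a
  given point.\<close>

lemma C2_sphere_qf:
  fixes M :: "real^'n^'n"
  shows "C2_sphere (qf M)"
    and "norm x = 1 \<Longrightarrow> v \<bullet> x = 0 \<Longrightarrow> v \<bullet> (D2 (qf M) x *v v) = 2 * (v \<bullet> (M *v v)) - qf M x * (norm v)\<^sup>2"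
proof -
  note h = has_hess_mult[OF has_hess_quadratic[of M] has_hess_inverse_norm]
  have "hom_ext (qf M) x = x \<bullet> (M *v x) * inverse (norm x)" if "x \<noteq> 0" for x
    using that by (simp add: hom_ext_def qf_def matrix_vector_mult_scaleR field_simps)
  note h' = has_hess_cong[OF h this]
  show "C2_sphere (qf M)" by (rule C2_sphere_if_has_hess[OF h'])
  assume x: "norm x = 1" and vx: "v \<bullet> x = 0"
  then have "x \<noteq> 0" by auto
  have eq: "D2 (qf M) x = qf M x *\<^sub>R hess_inv_norm x + outer2 (M *v x + transpose M *v x) (- x) +
      (M + transpose M + outer2 (- x) (M *v x + transpose M *v x))"
    using has_hess_unique(2)[OF h' \<open>x \<noteq> 0\<close>] x by (simp add: D2_def qf_def hess_inv_norm_def)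
  have "v \<bullet> (transpose M *v v) = v \<bullet> (M *v v)"
    by (metis inner_commute transpose_matrix_vector vector_matrix_inner)
  then show "v \<bullet> (D2 (qf M) x *v v) = 2 * (v \<bullet> (M *v v)) - qf M x * (norm v)\<^sup>2"
    using x vx unfolding eq
    by (simp add: matrix_vector_mult_add_rdistrib inner_add_right outer2_quadratic inner_commute[of x v]
        hess_inv_norm_def matrix_vector_mult_diff_rdistrib inner_diff_right power2_norm_eq_inner
        flip: scaleR_matrix_vector_assoc)
qed

lemma qf_eq_sum: "qf M x = (\<Sum>i\<in>UNIV. \<Sum>j\<in>UNIV. M $ i $ j * (x $ i * x $ j))"
  by (simp add: qf_def inner_vec_def matrix_vector_mult_def sum_distrib_left mult_ac)

lemma const_eq_qf: "norm x = 1 \<Longrightarrow> qf (c *\<^sub>R mat 1) x = c"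
  by (simp add: qf_def norm_eq_1 flip: scaleR_matrix_vector_assoc)

lemma C2_sphere_const:
  shows "C2_sphere (\<lambda>_::real^'n. c)"
    and "norm x = 1 \<Longrightarrow> v \<bullet> x = 0 \<Longrightarrow> v \<bullet> (D2 (\<lambda>_::real^'n. c) x *v v) = c * (norm v)\<^sup>2"
proof -
  have eq: "hom_ext (\<lambda>_::real^'n. c) = hom_ext (qf (c *\<^sub>R mat 1))"
    by (rule hom_ext_cong) (simp add: const_eq_qf)
  then show "C2_sphere (\<lambda>_::real^'n. c)" using C2_sphere_qf(1)[of "c *\<^sub>R mat 1"] by (simp add: C2_sphere_def)
  assume "norm x = 1" "v \<bullet> x = 0"
  then show "v \<bullet> (D2 (\<lambda>_::real^'n. c) x *v v) = c * (norm v)\<^sup>2"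
    using C2_sphere_qf(2)[of x v "c *\<^sub>R mat 1"] eq
    by (simp add: D2_def const_eq_qf power2_norm_eq_inner flip: scaleR_matrix_vector_assoc)
qed

lemma trace_matrix_mult: "trace (A ** B) = (\<Sum>i\<in>UNIV. \<Sum>j\<in>UNIV. A $ i $ j * B $ j $ i)"
  by (simp add: trace_def matrix_matrix_mult_def)

lemma trace_mult_add: "trace (A ** (B + C)) = trace (A ** B) + trace (A ** C)" for A :: "real^'n^'n"
  by (simp add: trace_matrix_mult distrib_left sum.distrib)

lemma trace_mult_scaleR: "trace (A ** (c *\<^sub>R B)) = c * trace (A ** B)" for A :: "real^'n^'n"
  by (simp add: trace_matrix_mult sum_distrib_left mult_ac)

lemma trace_mult_outer2: "trace (A ** outer2 a b) = b \<bullet> (A *v a)" for A :: "real^'n^'n"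
  by (simp add: trace_matrix_mult outer2_def inner_vec_def matrix_vector_mult_def sum_distrib_left mult_ac)

lemma symmetric_inner_swap: "transpose A = A \<Longrightarrow> v \<bullet> (A *v w) = w \<bullet> (A *v v)" for A :: "real^'n^'n"
  by (metis inner_commute transpose_matrix_vector vector_matrix_inner)

text \<open>D^2 f is the covariant Hessian plus f times the identity. Since Tr A = 1, the first two
  terms on the right count f g twice, hence the correction -f g; the cross terms give twice the
  gradient pairing. Radial contributions vanish because A x = 0.\<close>

lemma trace_D2_mult:
  fixes f g :: "real^'n \<Rightarrow> real"
  assumes C2: "C2_sphere f" "C2_sphere g" and x: "norm x = 1"
    and A: "transpose A = A" "A *v x = 0" "trace A = 1"
  shows "trace (A ** D2 (\<lambda>x. f x * g x) x)
    = f x * trace (A ** D2 g x) + g x * trace (A ** D2 f x) - f x * g x + 2 * (sgrad f x \<bullet> (A *v sgrad g x))"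
proof -
  have xA: "x \<bullet> (A *v v) = 0" for v using symmetric_inner_swap[OF A(1), of x v] A(2) by simp
  have "sgrad f x \<bullet> (A *v sgrad g x) = grad (hom_ext f) x \<bullet> (A *v grad (hom_ext g) x)"
    by (simp add: sgrad_def matrix_vector_mult_diff_distrib matrix_vector_mult_scaleR A(2) inner_diff_left xA)
  moreover have "grad (hom_ext g) x \<bullet> (A *v grad (hom_ext f) x) = grad (hom_ext f) x \<bullet> (A *v grad (hom_ext g) x)"
    by (rule symmetric_inner_swap[OF A(1)])
  moreover have "A *v (- x) = 0" using A(2) by (metis matrix_vector_mult_scaleR scaleR_minus1_left scaleR_zero_right)
  ultimately show ?thesis
    unfolding C2_sphere_mult(2)[OF C2 x] hess_inv_norm_def trace_mult_add trace_mult_scaleR trace_mult_outer2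
    by (simp add: A xA matrix_vector_right_distrib matrix_vector_mult_scaleR inner_add_left inner_add_right)
qed

lemma borel_measurable_matrixI:
  assumes "\<And>i j. (\<lambda>x. A x $ i $ j :: real) \<in> borel_measurable M"
  shows "(A :: 'a \<Rightarrow> real^'n^'m) \<in> borel_measurable M"
  by (subst borel_measurable_euclidean_space) (auto simp: Basis_vec_def inner_axis assms)

lemma qf_single: "qf (axis i (axis j 1)) x = x $ i * x $ j"
proof -
  have "qf (axis i (axis j 1)) x = (\<Sum>k\<in>UNIV. if k = i then (\<Sum>l\<in>UNIV. if l = j then x $ i * x $ j else 0) else 0)"
    unfolding qf_eq_sum by (intro sum.cong refl) (auto simp: axis_def if_distrib[of "\<lambda>z. z * _"] cong: if_cong)
  then show ?thesis by simp
qed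

lemma matrix_vector_mult_minus: "(- A) *v v = - (A *v v)" for A :: "real^'n^'m"
  using scaleR_matrix_vector_assoc[of "-1" A v] by simp

lemma C2_sphere_coord: "C2_sphere (\<lambda>x. x $ i * x $ j)"
  using C2_sphere_qf(1)[of "axis i (axis j 1)"] by (simp add: qf_single[abs_def])

lemma abs_qf_le: "\<bar>qf M x\<bar> \<le> norm M * (norm x)\<^sup>2"
  unfolding qf_def by (rule abs_quadratic_le)

text \<open>With \<open>r i j\<close> the density belonging to the function
  \<open>x $ i * x $ j\<close>, this is the density belonging to \<open>qf M\<close>.\<close>

definition pairing :: "real^'n^'n \<Rightarrow> ('n \<Rightarrow> 'n \<Rightarrow> real) \<Rightarrow> real" where
  "pairing M r = (\<Sum>i\<in>UNIV. \<Sum>j\<in>UNIV. M $ i $ j * r i j)"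

lemma pairing_add: "pairing (M + N) r = pairing M r + pairing N r"
  by (simp add: pairing_def distrib_right sum.distrib)

lemma pairing_scaleR: "pairing (c *\<^sub>R M) r = c * pairing M r"
  by (simp add: pairing_def sum_distrib_left mult.assoc)

lemma pairing_axis: "pairing (axis i y) r = (\<Sum>j\<in>UNIV. y $ j * r i j)"
proof -
  have "pairing (axis i y) r = (\<Sum>k\<in>UNIV. if k = i then (\<Sum>j\<in>UNIV. y $ j * r i j) else 0)"
    unfolding pairing_def by (intro sum.cong refl) (auto simp: axis_def)
  then show ?thesis by simp
qed

lemma pairing_transpose: "(\<And>i j. r i j = r j i) \<Longrightarrow> pairing (transpose M) r = pairing M r"
  unfolding pairing_def transpose_def by (subst sum.swap) simp

definition orthogonal_weight :: "real^'n \<Rightarrow> real^'n^'n \<Rightarrow> bool" where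
  "orthogonal_weight x A \<longleftrightarrow> transpose A = A \<and> A *v x = 0 \<and> (\<forall>v. 0 \<le> v \<bullet> (A *v v)) \<and> trace A = 1"

text \<open>The normalised projection onto the orthogonal complement of \<open>x\<close> is the
  default value on the null set where the densities may fail to give an admissible matrix; its trace
  before normalisation is n - 1.\<close>

lemma orthogonal_weight_projection:
  fixes x :: "real^'n"
  assumes x: "norm x = 1" and n: "CARD('n) \<ge> 2"
  shows "orthogonal_weight x ((1 / (real CARD('n) - 1)) *\<^sub>R (mat 1 - outer2 x x))"
proof -
  have xx: "x \<bullet> x = 1" using x by (simp add: norm_eq_1)
  have o: "outer2 x x *v v = (x \<bullet> v) *\<^sub>R x" for v
    by (simp add: outer2_def matrix_vector_mult_def vec_eq_iff inner_vec_def sum_distrib_left sum_distrib_right mult_ac)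
  have nn: "0 \<le> v \<bullet> v - (x \<bullet> v) * (x \<bullet> v)" for v
    using Cauchy_Schwarz_ineq[of x v] xx by (simp add: power2_eq_square)
  have "trace (outer2 x x) = 1" using xx by (simp add: trace_def outer2_def inner_vec_def)
  moreover have "trace (mat 1 :: real^'n^'n) = real CARD('n)" by (simp add: trace_def mat_def)
  moreover have "trace (c *\<^sub>R A) = c * trace A" for c and A :: "real^'n^'n" by (simp add: trace_def sum_distrib_left)
  ultimately have "trace ((1 / (real CARD('n) - 1)) *\<^sub>R (mat 1 - outer2 x x)) = 1"
    using n by (simp add: trace_sub)
  moreover have "transpose ((1 / (real CARD('n) - 1)) *\<^sub>R (mat 1 - outer2 x x)) = (1 / (real CARD('n) - 1)) *\<^sub>R (mat 1 - outer2 x x)"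
    by (auto simp: transpose_def vec_eq_iff mat_def outer2_def mult.commute)
  moreover have P: "((1 / (real CARD('n) - 1)) *\<^sub>R (mat 1 - outer2 x x)) *v v = (1 / (real CARD('n) - 1)) *\<^sub>R (v - (x \<bullet> v) *\<^sub>R x)" for v
    by (simp only: scaleR_matrix_vector_assoc[symmetric] matrix_vector_mult_diff_rdistrib o matrix_vector_mul_lid)
  moreover have "0 \<le> v \<bullet> (((1 / (real CARD('n) - 1)) *\<^sub>R (mat 1 - outer2 x x)) *v v)" for v
    unfolding P inner_scaleR_right inner_diff_right inner_commute[of v x] using n nn[of v] by simp
  moreover have "((1 / (real CARD('n) - 1)) *\<^sub>R (mat 1 - outer2 x x)) *v x = 0"
    unfolding P xx by simp
  ultimately show ?thesis unfolding orthogonal_weight_def by blast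
qed

section \<open>The weight matrix\<close>

context
  fixes Cs :: "(real^'n) set list"
  assumes Cs: "\<forall>C\<in>set Cs. convex_body C" and len: "Suc (Suc (length Cs)) = CARD('n)"
begin

abbreviation (input) S :: "(real^'n) set \<Rightarrow> (real^'n) measure" where
  "S K \<equiv> mixed_area_measure (K # Cs)"

lemma S_props:
  assumes "convex_body K"
  shows "finite_measure (S K)" "space (S K) = sphere 0 1" "sets (S K) = sets (restrict_space borel (sphere 0 1))"
    "\<And>f. supp_diff f \<Longrightarrow> integrable (S K) f"
  using finite_mixed_area_measure[of "K # Cs"] space_mixed_area_measure[of "K # Cs"]
    sets_mixed_area_measure[of "K # Cs"] integrable_mixed_area_measure[of "K # Cs"] Cs len assms by auto

lemma integral_S:
  assumes "convex_body K" "convex_body A" "convex_body B" "\<And>x. norm x = 1 \<Longrightarrow> f x = support_fun A x - support_fun B x"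
  shows "(\<integral>x. f x \<partial>S K) = real CARD('n) * (mixed_volume (A # K # Cs) - mixed_volume (B # K # Cs))"
  by (rule integral_mixed_area_measure) (use assms Cs len in auto)

lemma mixed_volume_add2:
  assumes "convex_body A" "convex_body K" "convex_body L"
  shows "mixed_volume (A # (K + L) # Cs) = mixed_volume (A # K # Cs) + mixed_volume (A # L # Cs)"
  using mixed_volume_add[of "A # Cs" K L] assms Cs len by (simp add: mixed_volume_swap[of A])

lemma integral_S_add:
  assumes "convex_body K" "convex_body L" "supp_diff f"
  shows "(\<integral>x. f x \<partial>S (K + L)) = (\<integral>x. f x \<partial>S K) + (\<integral>x. f x \<partial>S L)"
proof -
  obtain A B where AB: "convex_body A" "convex_body B" "\<And>x. norm x = 1 \<Longrightarrow> f x = support_fun A x - support_fun B x"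
    using dsfE[OF assms(3)] by blast
  note i = integral_S[where f=f, OF _ AB]
  show ?thesis
    using i[OF assms(1)] i[OF assms(2)] i[OF convex_body_plus[OF assms(1,2)]] AB(1,2) assms(1,2)
    by (simp add: mixed_volume_add2 algebra_simps)
qed

lemma measure_S_add:
  assumes K: "convex_body K" and L: "convex_body L" and A: "A \<in> sets (restrict_space borel (sphere 0 1))"
  shows "measure (S (K + L)) A = measure (S K) A + measure (S L) A"
proof -
  define X where "X i = (if i = (0::nat) then K + L else if i = 1 then K else L)" for i
  have X: "convex_body (X i)" for i using K L by (auto simp: X_def convex_body_plus)
  define c where "c i = (if i = (0::nat) then 1 else - 1 :: real)" for i
  have "(\<Sum>i\<in>{0,1,2}. c i * measure (S (X i)) (A \<inter> {x \<in> sphere 0 1. 1 > (0::real)})) = 0"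
  proof (rule sphere_measures_lincomb)
    fix g :: "real^'n \<Rightarrow> real" assume "supp_diff g"
    then show "(\<Sum>i\<in>{0,1,2}. c i * (\<integral>x. g x \<partial>S (X i))) = 0"
      using integral_S_add[OF K L, of g] by (simp add: c_def X_def)
  qed (use A in \<open>auto simp: S_props[OF X] supp_diff_const\<close>)
  moreover have "A \<inter> {x \<in> sphere 0 1. 1 > (0::real)} = A"
    using sets.sets_into_space[OF A] by (auto simp: space_restrict_space)
  ultimately show ?thesis by (simp add: c_def X_def)
qed

text \<open>Nonnegative test functions that vanish where \<open>u\<close> is nonpositive see no
  difference between \<open>K\<close> and \<open>N\<close>: in no direction do both the two bodies
  representing the test function and the bodies \<open>N\<close>, \<open>K\<close> differ, so
  \<open>mixed_volume_local\<close> applies.\<close>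

lemma measure_S_local_le:
  assumes K: "convex_body K" and N: "convex_body N" and u: "supp_diff u"
    and le: "\<And>x. norm x = 1 \<Longrightarrow> support_fun K x \<le> support_fun N x"
    and eq: "\<And>x. norm x = 1 \<Longrightarrow> u x > 0 \<Longrightarrow> support_fun K x = support_fun N x"
    and A: "A \<in> sets (restrict_space borel (sphere 0 1))"
  shows "measure (S K) (A \<inter> {x \<in> sphere 0 1. u x > 0}) = measure (S N) (A \<inter> {x \<in> sphere 0 1. u x > 0})"
proof -
  define X where "X i = (if i then K else N)" for i
  define c where "c i = (if i then 1 else - 1 :: real)" for i
  have X: "convex_body (X i)" for i using K N by (auto simp: X_def)
  have "(\<Sum>i\<in>UNIV. c i * measure (S (X i)) (A \<inter> {x \<in> sphere 0 1. u x > 0})) = 0"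
  proof (rule sphere_measures_lincomb[OF _ _ _ _ u _ A])
    fix g :: "real^'n \<Rightarrow> real"
    assume g: "supp_diff g" "\<And>x. norm x = 1 \<Longrightarrow> g x \<ge> 0" "\<And>x. norm x = 1 \<Longrightarrow> u x \<le> 0 \<Longrightarrow> g x = 0"
    obtain L L' where L: "convex_body L" "convex_body L'" "\<And>x. norm x = 1 \<Longrightarrow> g x = support_fun L x - support_fun L' x"
      using dsfE[OF g(1)] by blast
    have "mixed_volume (L # N # Cs) + mixed_volume (L' # K # Cs)
        = mixed_volume (L # K # Cs) + mixed_volume (L' # N # Cs)"
    proof (rule mixed_volume_local[OF L(1,2) N K Cs])
      show "support_fun L' x \<le> support_fun L x" if "norm x = 1" for x using g(2)[OF that] L(3)[OF that] by simp
      show "support_fun L' x = support_fun L x \<or> support_fun K x = support_fun N x" if "norm x = 1" for x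
        using g(3)[OF that] L(3)[OF that] eq[OF that] by (cases "u x > 0") auto
    qed (rule le)
    then have "(\<integral>x. g x \<partial>S K) = (\<integral>x. g x \<partial>S N)"
      using integral_S[where f=g, OF K L] integral_S[where f=g, OF N L] by simp
    then show "(\<Sum>i\<in>UNIV. c i * (\<integral>x. g x \<partial>S (X i))) = 0" by (simp add: c_def X_def UNIV_bool)
  qed (auto simp: S_props[OF X])
  then show ?thesis by (simp add: c_def X_def UNIV_bool)
qed

text \<open>The order of \<open>K\<close> and \<open>N\<close> is removed by comparing both with the
  hull of their union, whose support function is the maximum and agrees with both on the given
  set.\<close>

lemma measure_S_local:
  assumes K: "convex_body K" and N: "convex_body N" and u: "supp_diff u"
    and eq: "\<And>x. norm x = 1 \<Longrightarrow> u x > 0 \<Longrightarrow> support_fun K x = support_fun N x"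
    and A: "A \<in> sets (restrict_space borel (sphere 0 1))"
  shows "measure (S K) (A \<inter> {x \<in> sphere 0 1. u x > 0}) = measure (S N) (A \<inter> {x \<in> sphere 0 1. u x > 0})"
proof -
  let ?H = "convex hull (K \<union> N)"
  have H: "convex_body ?H" by (rule convex_body_hull_Un[OF K N])
  have "measure (S K) (A \<inter> {x \<in> sphere 0 1. u x > 0}) = measure (S ?H) (A \<inter> {x \<in> sphere 0 1. u x > 0})"
    by (rule measure_S_local_le[OF K H u _ _ A]) (auto simp: support_fun_hull_Un K N eq)
  moreover have "measure (S N) (A \<inter> {x \<in> sphere 0 1. u x > 0}) = measure (S ?H) (A \<inter> {x \<in> sphere 0 1. u x > 0})"
    by (rule measure_S_local_le[OF N H u _ _ A]) (auto simp: support_fun_hull_Un K N eq)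
  ultimately show ?thesis by simp
qed

text \<open>The difference of the support functions is locally the support function of some body
  \<open>K2\<close>. Locality replaces \<open>K\<close> by \<open>K' + K2\<close>, and additivity
  leaves the nonnegative term from \<open>K2\<close>.\<close>

lemma measure_S_local_dominance:
  fixes g :: "real^'n \<Rightarrow> real^'n"
  assumes K: "convex_body K" and K': "convex_body K'" and x0: "norm x0 = 1" and r: "r > 0"
    and g: "continuous_on (sphere 0 1 \<inter> cball x0 r) g"
    and le: "\<And>y z. y \<in> sphere 0 1 \<inter> cball x0 r \<Longrightarrow> z \<in> sphere 0 1 \<inter> cball x0 r \<Longrightarrow>
      g z \<bullet> y \<le> support_fun K y - support_fun K' y"
    and eq: "\<And>y. y \<in> sphere 0 1 \<inter> cball x0 r \<Longrightarrow> g y \<bullet> y = support_fun K y - support_fun K' y"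
    and A: "A \<in> sets (restrict_space borel (sphere 0 1))" "A \<subseteq> ball x0 r"
  shows "measure (S K') A \<le> measure (S K) A"
proof -
  obtain K2 where K2: "convex_body K2"
    "\<And>y. y \<in> sphere 0 1 \<inter> cball x0 r \<Longrightarrow> support_fun K2 y = support_fun K y - support_fun K' y"
    by (rule gradient_hull_support_fun[of "sphere 0 1 \<inter> cball x0 r" g "\<lambda>y. support_fun K y - support_fun K' y"])
      (use x0 r g le eq in \<open>auto intro!: compact_Int\<close>)
  let ?U = "{x \<in> sphere 0 1. cap x0 r x > 0}"
  have "A \<subseteq> sphere 0 1" using sets.sets_into_space[OF A(1)] by (simp add: space_restrict_space)
  then have "norm x = 1 \<and> cap x0 r x > 0" if "x \<in> A" for x
  proof -
    have "x \<in> sphere 0 1" "x \<in> ball x0 r" using \<open>A \<subseteq> sphere 0 1\<close> A(2) that by blast+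
    then show ?thesis using cap_pos_iff[OF x0 _ r, of x] by simp
  qed
  then have AU: "A \<inter> ?U = A" by auto
  have "measure (S K) (A \<inter> ?U) = measure (S (K' + K2)) (A \<inter> ?U)"
  proof (rule measure_S_local[OF K convex_body_plus[OF K' K2(1)] supp_diff_cap _ A(1)])
    fix x :: "real^'n" assume x: "norm x = 1" "cap x0 r x > 0"
    then have "x \<in> sphere 0 1 \<inter> cball x0 r" using cap_pos_iff[OF x0 x(1) r] by auto
    then show "support_fun K x = support_fun (K' + K2) x"
      by (simp add: support_fun_plus K' K2 convex_body_plus)
  qed
  also have "\<dots> = measure (S K') A + measure (S K2) A"
    unfolding AU by (rule measure_S_add[OF K' K2(1) A(1)])
  finally show ?thesis unfolding AU by simp
qed

section \<open>Densities with respect to the measure of the unit ball\<close>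

abbreviation (input) \<mu> :: "(real^'n) measure" where
  "\<mu> \<equiv> mixed_area_measure (cball 0 1 # Cs)"

abbreviation (input) borel_sphere :: "(real^'n) set set" where
  "borel_sphere \<equiv> sets (restrict_space borel (sphere 0 1))"

lemmas cb1 = convex_body_cball[OF zero_le_one, of "0 :: real^'n"]
lemmas \<mu>_props = S_props[OF cb1]

lemma mixed_volume_scaleR2:
  assumes "convex_body A" "convex_body K" "t > 0"
  shows "mixed_volume (A # (*\<^sub>R) t ` K # Cs) = t * mixed_volume (A # K # Cs)"
  using mixed_volume_scaleR[of "A # Cs" K t] assms Cs len by (simp add: mixed_volume_swap[of A])

lemma integral_S_scaleR:
  assumes "convex_body K" "t > 0" "supp_diff f"
  shows "(\<integral>x. f x \<partial>S ((*\<^sub>R) t ` K)) = t * (\<integral>x. f x \<partial>S K)"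
proof -
  obtain A B where AB: "convex_body A" "convex_body B" "\<And>x. norm x = 1 \<Longrightarrow> f x = support_fun A x - support_fun B x"
    using dsfE[OF assms(3)] by blast
  note i = integral_S[where f=f, OF _ AB]
  have "(\<integral>x. f x \<partial>S ((*\<^sub>R) t ` K))
      = real CARD('n) * (mixed_volume (A # (*\<^sub>R) t ` K # Cs) - mixed_volume (B # (*\<^sub>R) t ` K # Cs))"
    by (rule i[OF convex_body_scaleR[OF assms(1)]])
  also have "\<dots> = t * (real CARD('n) * (mixed_volume (A # K # Cs) - mixed_volume (B # K # Cs)))"
    using AB(1,2) assms(1,2) by (simp add: mixed_volume_scaleR2 algebra_simps)
  also have "real CARD('n) * (mixed_volume (A # K # Cs) - mixed_volume (B # K # Cs)) = (\<integral>x. f x \<partial>S K)"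
    by (rule i[OF assms(1), symmetric])
  finally show ?thesis .
qed

lemma measure_S_scaleR:
  assumes K: "convex_body K" and t: "t > 0" and A: "A \<in> borel_sphere"
  shows "measure (S ((*\<^sub>R) t ` K)) A = t * measure (S K) A"
proof -
  define X where "X i = (if i then (*\<^sub>R) t ` K else K)" for i
  define c where "c i = (if i then 1 else - t)" for i
  have X: "convex_body (X i)" for i using K by (auto simp: X_def convex_body_scaleR)
  have "(\<Sum>i\<in>UNIV. c i * measure (S (X i)) (A \<inter> {x \<in> sphere 0 1. 1 > (0::real)})) = 0"
  proof (rule sphere_measures_lincomb)
    fix g :: "real^'n \<Rightarrow> real" assume "supp_diff g"
    then show "(\<Sum>i\<in>UNIV. c i * (\<integral>x. g x \<partial>S (X i))) = 0"
      using integral_S_scaleR[OF K t, of g] by (simp add: c_def X_def UNIV_bool)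
  qed (use A in \<open>auto simp: S_props[OF X] supp_diff_const\<close>)
  moreover have "A \<inter> {x \<in> sphere 0 1. 1 > (0::real)} = A"
    using sets.sets_into_space[OF A] by (auto simp: space_restrict_space)
  ultimately show ?thesis by (simp add: c_def X_def UNIV_bool)
qed

lemma S_zero:
  shows "A \<in> borel_sphere \<Longrightarrow> measure (S {0}) A = 0" and "supp_diff f \<Longrightarrow> (\<integral>x. f x \<partial>S {0}) = 0"
  using measure_S_add[OF convex_body_sing[of 0] convex_body_sing[of 0], of A]
    integral_S_add[OF convex_body_sing[of 0] convex_body_sing[of 0], of f] by simp_all

text \<open>This is \<open>S\<^bsub>f,C\<^esub>\<close>; the \<open>SOME\<close> is independent of the choice of the bodies.\<close>
definition signed_S :: "(real^'n \<Rightarrow> real) \<Rightarrow> (real^'n) set \<Rightarrow> real" where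
  "signed_S f A = (SOME v. \<exists>K L. convex_body K \<and> convex_body L \<and>
     (\<forall>x\<in>sphere 0 1. f x = support_fun K x - support_fun L x) \<and> v = measure (S K) A - measure (S L) A)"

lemma signed_S_eq:
  assumes A: "A \<in> borel_sphere" and K: "convex_body K" and L: "convex_body L"
    and f: "\<And>x. norm x = 1 \<Longrightarrow> f x = support_fun K x - support_fun L x"
  shows "signed_S f A = measure (S K) A - measure (S L) A"
  unfolding signed_S_def
proof (rule some_equality)
  fix v assume "\<exists>K L. convex_body K \<and> convex_body L \<and>
     (\<forall>x\<in>sphere 0 1. f x = support_fun K x - support_fun L x) \<and> v = measure (S K) A - measure (S L) A"
  then obtain K' L' where *: "convex_body K'" "convex_body L'"
     "\<And>x. norm x = 1 \<Longrightarrow> f x = support_fun K' x - support_fun L' x"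
     "v = measure (S K') A - measure (S L') A" by auto
  have "K + L' = K' + L"
  proof (rule support_fun_inject)
    show "support_fun (K + L') u = support_fun (K' + L) u" if "norm u = 1" for u
      using f[OF that] *(3)[OF that] by (simp add: support_fun_plus K L * convex_body_plus)
  qed (intro convex_body_plus K L *)+
  then have "measure (S K) A + measure (S L') A = measure (S K') A + measure (S L) A"
    using measure_S_add[OF K *(2) A] measure_S_add[OF *(1) L A] by simp
  then show "v = measure (S K) A - measure (S L) A" using *(4) by simp
qed (use assms in auto)

lemma signed_S_add:
  assumes A: "A \<in> borel_sphere" and "supp_diff f" "supp_diff g"
  shows "signed_S (\<lambda>x. f x + g x) A = signed_S f A + signed_S g A"
proof -
  obtain K L where 1: "convex_body K" "convex_body L" "\<And>x. norm x = 1 \<Longrightarrow> f x = support_fun K x - support_fun L x"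
    using dsfE[OF assms(2)] by blast
  obtain K' L' where 2: "convex_body K'" "convex_body L'" "\<And>x. norm x = 1 \<Longrightarrow> g x = support_fun K' x - support_fun L' x"
    using dsfE[OF assms(3)] by blast
  have "signed_S (\<lambda>x. f x + g x) A = measure (S (K + K')) A - measure (S (L + L')) A"
    by (rule signed_S_eq[OF A convex_body_plus[OF 1(1) 2(1)] convex_body_plus[OF 1(2) 2(2)]])
      (simp add: support_fun_plus 1 2 convex_body_plus)
  then show ?thesis
    using signed_S_eq[OF A 1] signed_S_eq[OF A 2] by (simp add: measure_S_add A 1 2)
qed

lemma signed_S_scale:
  assumes A: "A \<in> borel_sphere" and "supp_diff f"
  shows "signed_S (\<lambda>x. c * f x) A = c * signed_S f A"
proof -
  obtain K L where 1: "convex_body K" "convex_body L" "\<And>x. norm x = 1 \<Longrightarrow> f x = support_fun K x - support_fun L x"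
    using dsfE[OF assms(2)] by blast
  have pos: "signed_S (\<lambda>x. c * f x) A = c * signed_S f A" if "c > 0" for c
  proof -
    have "signed_S (\<lambda>x. c * f x) A = measure (S ((*\<^sub>R) c ` K)) A - measure (S ((*\<^sub>R) c ` L)) A"
      using that by (intro signed_S_eq[OF A] convex_body_scaleR 1)
        (simp add: support_fun_scaleR 1 convex_body_scaleR right_diff_distrib)
    then show ?thesis using signed_S_eq[OF A 1] that by (simp add: measure_S_scaleR 1 A right_diff_distrib)
  qed
  have zero: "signed_S (\<lambda>x. 0) A = 0"
    using signed_S_eq[OF A convex_body_sing[of 0] convex_body_sing[of 0], of "\<lambda>x. 0"] by simp
  consider "c = 0" | "c > 0" | "c < 0" by linarith
  then show ?thesis
  proof cases
    case 3
    have "signed_S (\<lambda>x. c * f x + (- c) * f x) A = signed_S (\<lambda>x. c * f x) A + signed_S (\<lambda>x. (- c) * f x) A"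
      by (intro signed_S_add A supp_diff_scale assms(2))
    then show ?thesis using pos[of "- c"] zero 3 by simp
  qed (use pos zero in auto)
qed

lemma signed_S_const:
  assumes A: "A \<in> borel_sphere"
  shows "signed_S (\<lambda>_. c) A = c * measure \<mu> A"
proof -
  have "signed_S (\<lambda>_. 1) A = measure \<mu> A"
    using signed_S_eq[OF A cb1 convex_body_sing[of 0], of "\<lambda>_. 1"] S_zero(1)[OF A]
    by (simp add: support_fun_cball support_fun_sing)
  then show ?thesis using signed_S_scale[OF A supp_diff_const, of c 1] by simp
qed

definition has_density :: "(real^'n \<Rightarrow> real) \<Rightarrow> (real^'n \<Rightarrow> real) \<Rightarrow> bool" where
  "has_density f \<rho> \<longleftrightarrow> supp_diff f \<and> integrable \<mu> \<rho> \<and>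
     (\<forall>A\<in>borel_sphere. signed_S f A = (\<integral>x. indicator A x * \<rho> x \<partial>\<mu>))"

lemma indicator_integrable: "A \<in> borel_sphere \<Longrightarrow> integrable \<mu> \<rho> \<Longrightarrow> integrable \<mu> (\<lambda>x. indicator A x * \<rho> x :: real)"
  using integrable_mult_indicator[of A \<mu> \<rho>] by (simp add: \<mu>_props(3))

lemma has_density_add:
  assumes "has_density f \<rho>" "has_density g \<sigma>"
  shows "has_density (\<lambda>x. f x + g x) (\<lambda>x. \<rho> x + \<sigma> x)"
  using assms unfolding has_density_def
  by (auto simp: signed_S_add distrib_left indicator_integrable intro: supp_diff_add)

lemma has_density_scale:
  assumes "has_density f \<rho>"
  shows "has_density (\<lambda>x. c * f x) (\<lambda>x. c * \<rho> x)"
  using assms unfolding has_density_def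
  by (auto simp: signed_S_scale mult.left_commute[of _ c] intro: supp_diff_scale)

lemma has_density_const: "has_density (\<lambda>_. c) (\<lambda>_. c)"
proof -
  interpret finite_measure \<mu> by (rule \<mu>_props(1))
  have "(\<integral>x. indicator A x * c \<partial>\<mu>) = c * measure \<mu> A" if "A \<in> borel_sphere" for A
    using that sets.sets_into_space[OF that] by (simp add: \<mu>_props(2,3) Int_absorb2 space_restrict_space)
  then show ?thesis by (auto simp: has_density_def supp_diff_const signed_S_const)
qed

lemma has_density_sum: "finite I \<Longrightarrow> (\<And>i. i \<in> I \<Longrightarrow> has_density (f i) (\<rho> i)) \<Longrightarrow>
    has_density (\<lambda>x. \<Sum>i\<in>I. f i x) (\<lambda>x. \<Sum>i\<in>I. \<rho> i x)"
  by (induction I rule: finite_induct) (auto intro: has_density_const has_density_add)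

lemma cball_scaleR: "t > 0 \<Longrightarrow> (*\<^sub>R) t ` cball 0 1 = cball (0 :: real^'n) t"
  by (rule support_fun_inject) (auto simp: convex_body_scaleR convex_body_cball support_fun_scaleR support_fun_cball)

text \<open>\<open>has_density\<close> tests the density on Borel sets; the second clause tests it
  on integrals of differences of support functions for every representing pair of bodies, as the
  bilinear form (f, g) |-> V(f, g, Cs) demands.\<close>

definition mixed_density :: "(real^'n \<Rightarrow> real) \<Rightarrow> (real^'n \<Rightarrow> real) \<Rightarrow> bool" where
  "mixed_density f \<rho> \<longleftrightarrow> has_density f \<rho> \<and>
     (\<forall>K K' h. convex_body K \<and> convex_body K' \<and> (\<forall>x. norm x = 1 \<longrightarrow> f x = support_fun K x - support_fun K' x) \<and>
        supp_diff h \<longrightarrow> (\<integral>x. h x \<partial>S K) - (\<integral>x. h x \<partial>S K') = (\<integral>x. h x * \<rho> x \<partial>\<mu>))"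

lemma mixed_densityD:
  assumes "mixed_density f \<rho>"
  shows "has_density f \<rho>"
    and "convex_body K \<Longrightarrow> convex_body K' \<Longrightarrow> (\<And>x. norm x = 1 \<Longrightarrow> f x = support_fun K x - support_fun K' x) \<Longrightarrow>
      supp_diff h \<Longrightarrow> (\<integral>x. h x \<partial>S K) - (\<integral>x. h x \<partial>S K') = (\<integral>x. h x * \<rho> x \<partial>\<mu>)"
  using assms unfolding mixed_density_def by blast+

text \<open>The unit ball has support function 1 on the sphere. As a partner in
  \<open>density_symmetric\<close>, this case evaluates the total integral of another
  density.\<close>

lemma mixed_density_one: "mixed_density (\<lambda>_. 1) (\<lambda>_. 1)"
  unfolding mixed_density_def
proof (intro conjI allI impI; (elim conjE)?)
  fix K K' :: "(real^'n) set" and h :: "real^'n \<Rightarrow> real"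
  assume *: "convex_body K" "convex_body K'" "\<forall>x. norm x = 1 \<longrightarrow> 1 = support_fun K x - support_fun K' x" "supp_diff h"
  have "K = K' + cball 0 1"
  proof (rule support_fun_inject)
    show "support_fun K u = support_fun (K' + cball 0 1) u" if u: "norm u = 1" for u
      using *(3)[rule_format, OF u] support_fun_plus[OF *(2) cb1 convex_body_plus[OF *(2) cb1], of u] u
        support_fun_cball[OF zero_le_one, of u] by simp
  qed (intro * convex_body_plus cb1)+
  then show "(\<integral>x. h x \<partial>S K) - (\<integral>x. h x \<partial>S K') = (\<integral>x. h x * 1 \<partial>\<mu>)"
    using integral_S_add[OF *(2) cb1 *(4)] by simp
qed (rule has_density_const)

text \<open>For large \<open>c\<close> both f + c and c - f are support functions, of
  \<open>L\<close> and \<open>L'\<close>, and \<open>L + L'\<close> is the ball of radius 2c. Hence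
  the measure of \<open>L\<close> is at most 2c times that of the unit ball, which gives absolute
  continuity and a Radon-Nikodym density.\<close>

lemma ex_density:
  assumes C2: "C2_sphere f"
  obtains \<rho> where "mixed_density f \<rho>"
proof -
  interpret finite_measure \<mu> by (rule \<mu>_props(1))
  obtain c1 where c1: "c1 \<ge> 0" "\<And>c. c \<ge> c1 \<Longrightarrow> \<exists>K. convex_body K \<and> (\<forall>x\<in>sphere 0 1. support_fun K x = f x + c)"
    using C2_sphere_support_fun[OF C2] by blast
  obtain c2 where c2: "c2 \<ge> 0" "\<And>c. c \<ge> c2 \<Longrightarrow> \<exists>K. convex_body K \<and> (\<forall>x\<in>sphere 0 1. support_fun K x = (-1) * f x + c)"
    using C2_sphere_support_fun[OF C2_sphere_scale(1)[OF C2, of "-1"]] by blast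
  define c where "c = c1 + c2 + 1"
  have c: "c \<ge> c1" "c \<ge> c2" "c > 0" using c1(1) c2(1) by (auto simp: c_def)
  obtain L where L: "convex_body L" "\<And>x. norm x = 1 \<Longrightarrow> support_fun L x = f x + c" using c1(2)[OF c(1)] by auto
  obtain L' where L': "convex_body L'" "\<And>x. norm x = 1 \<Longrightarrow> support_fun L' x = c - f x" using c2(2)[OF c(2)] by auto
  have cb: "measure (S (cball 0 t)) A = t * measure \<mu> A" if "t > 0" "A \<in> borel_sphere" for t A
    using measure_S_scaleR[OF cb1 that] cball_scaleR[OF that(1)] by simp
  have cbi: "(\<integral>x. h x \<partial>S (cball 0 t)) = t * (\<integral>x. h x \<partial>\<mu>)" if "t > 0" "supp_diff h" for t h
    using integral_S_scaleR[OF cb1 that] cball_scaleR[OF that(1)] by simp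
  have "L + L' = cball 0 (2 * c)"
    by (rule support_fun_inject) (use c in \<open>auto simp: L L' convex_body_plus convex_body_cball support_fun_plus support_fun_cball\<close>)
  then have LL: "measure (S L) A + measure (S L') A = 2 * c * measure \<mu> A" if "A \<in> borel_sphere" for A
    using measure_S_add[OF L(1) L'(1) that] cb[OF _ that, of "2 * c"] c by simp
  have fin: "finite_measure (S L)" by (rule S_props[OF L(1)])
  have sets: "sets (S L) = sets \<mu>" by (simp add: S_props[OF L(1)] \<mu>_props)
  have ac: "absolutely_continuous \<mu> (S L)"
    unfolding absolutely_continuous_def
  proof
    fix A assume A: "A \<in> null_sets \<mu>"
    then have A': "A \<in> borel_sphere" "measure \<mu> A = 0" by (auto simp: \<mu>_props(3) null_sets_def measure_def)
    then have "measure (S L) A = 0"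
      using LL[OF A'(1), unfolded A'(2)] measure_nonneg[of "S L" A] measure_nonneg[of "S L'" A] by linarith
    then show "A \<in> null_sets (S L)"
      using A'(1) finite_measure.emeasure_eq_measure[OF fin] by (auto simp: null_sets_def S_props[OF L(1)])
  qed
  obtain D where D: "D \<in> borel_measurable \<mu>" "AE x in \<mu>. RN_deriv \<mu> (S L) x = ennreal (D x)" "\<And>x. 0 \<le> D x"
    by (rule real_RN_deriv[OF fin ac sets]) (rule that)
  have "density \<mu> (RN_deriv \<mu> (S L)) = S L" by (rule density_RN_deriv[OF ac sets])
  moreover have "density \<mu> (RN_deriv \<mu> (S L)) = density \<mu> (\<lambda>x. ennreal (D x))"
    using D by (intro density_cong) auto
  ultimately have dens: "S L = density \<mu> (\<lambda>x. ennreal (D x))" by simp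
  have intD: "integrable \<mu> D"
  proof (rule integrableI_nonneg)
    have "(\<integral>\<^sup>+x. ennreal (D x) \<partial>\<mu>) = emeasure (S L) (space \<mu>)"
      using D(1) by (simp add: dens emeasure_density cong: nn_integral_cong)
    then show "(\<integral>\<^sup>+x. ennreal (D x) \<partial>\<mu>) < \<infinity>"
      using finite_measure.emeasure_finite[OF fin] by (simp add: top.not_eq_extremum)
  qed (use D in auto)
  have measL: "measure (S L) A = (\<integral>x. indicator A x * D x \<partial>\<mu>)" if A: "A \<in> borel_sphere" for A
  proof -
    have "measure (S L) A = (\<integral>x. indicator A x \<partial>S L)"
      using A sets.sets_into_space[OF A] by (simp add: S_props[OF L(1)] Int_absorb2 space_restrict_space)
    also have "\<dots> = (\<integral>x. D x * indicator A x \<partial>\<mu>)"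
    proof -
      have "A \<in> sets \<mu>" using A by (simp add: \<mu>_props(3))
      then show ?thesis unfolding dens using D by (subst integral_real_density) auto
    qed
    finally show ?thesis by (simp add: mult.commute)
  qed
  \<comment> \<open>On the sphere \<open>f\<close> is the difference of the support functions of
    \<open>L\<close> and of the ball of radius \<open>c\<close>, and the latter has density
    \<open>c\<close>.\<close>
  define \<rho> where "\<rho> x = D x - c" for x
  have d: "has_density f \<rho>"
    unfolding has_density_def
  proof (intro conjI ballI)
    show "supp_diff f" by (rule supp_diff_if_C2_sphere[OF C2])
    show "integrable \<mu> \<rho>" unfolding \<rho>_def using intD by simp
    fix A assume A: "A \<in> borel_sphere"
    have "signed_S f A = measure (S L) A - measure (S (cball 0 c)) A"
      using c by (intro signed_S_eq[OF A L(1) convex_body_cball]) (auto simp: L support_fun_cball)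
    also have "\<dots> = (\<integral>x. indicator A x * D x \<partial>\<mu>) - (\<integral>x. indicator A x * c \<partial>\<mu>)"
      using cb[OF c(3) A] measL[OF A] A sets.sets_into_space[OF A]
      by (simp add: \<mu>_props(2,3) Int_absorb2 space_restrict_space)
    also have "\<dots> = (\<integral>x. indicator A x * \<rho> x \<partial>\<mu>)"
      unfolding \<rho>_def right_diff_distrib
      using indicator_integrable[OF A intD] indicator_integrable[OF A integrable_const[of c]]
      by (rule Bochner_Integration.integral_diff[symmetric])
    finally show "signed_S f A = (\<integral>x. indicator A x * \<rho> x \<partial>\<mu>)" .
  qed
  have "(\<integral>x. h x \<partial>S K) - (\<integral>x. h x \<partial>S K') = (\<integral>x. h x * \<rho> x \<partial>\<mu>)"
    if K: "convex_body K" "convex_body K'" "\<And>x. norm x = 1 \<Longrightarrow> f x = support_fun K x - support_fun K' x" and h: "supp_diff h" for K K' h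
  proof -
    have "K + cball 0 c = K' + L"
      by (rule support_fun_inject)
        (use c K in \<open>auto simp: L convex_body_plus convex_body_cball support_fun_plus support_fun_cball\<close>)
    then have 1: "(\<integral>x. h x \<partial>S K) + c * (\<integral>x. h x \<partial>\<mu>) = (\<integral>x. h x \<partial>S K') + (\<integral>x. h x \<partial>S L)"
      using integral_S_add[OF K(1) convex_body_cball h, of c 0] integral_S_add[OF K(2) L(1) h] cbi[OF c(3) h] c
      by simp
    have hi: "integrable (S L) h" "integrable \<mu> h" using S_props(4)[OF L(1) h] \<mu>_props(4)[OF h] .
    then have hm: "h \<in> borel_measurable \<mu>" by simp
    have 2: "(\<integral>x. h x \<partial>S L) = (\<integral>x. D x * h x \<partial>\<mu>)"
      unfolding dens using D hm by (subst integral_real_density) auto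
    have 3: "integrable \<mu> (\<lambda>x. D x * h x)"
      using hi(1) D hm unfolding dens by (subst (asm) integrable_real_density) auto
    have "(\<integral>x. h x * \<rho> x \<partial>\<mu>) = (\<integral>x. D x * h x - c * h x \<partial>\<mu>)"
      by (rule Bochner_Integration.integral_cong) (auto simp: \<rho>_def algebra_simps)
    also have "\<dots> = (\<integral>x. D x * h x \<partial>\<mu>) - c * (\<integral>x. h x \<partial>\<mu>)" using 3 hi(2) by simp
    finally show ?thesis using 1 2 by simp
  qed
  with d have "mixed_density f \<rho>" unfolding mixed_density_def by blast
  then show thesis by (rule that)
qed

section \<open>Positivity of densities where the Hessian is positive\<close>

lemma density_nonneg_on_open:
  assumes d: "has_density f \<rho>" and U: "open U"
    and nn: "\<And>A. A \<in> borel_sphere \<Longrightarrow> A \<subseteq> U \<Longrightarrow> signed_S f A \<ge> 0"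
  shows "AE x in \<mu>. x \<in> U \<longrightarrow> \<rho> x \<ge> 0"
proof -
  have int: "integrable \<mu> \<rho>" using d by (simp add: has_density_def)
  define A where "A = {x \<in> space \<mu>. \<rho> x < 0} \<inter> (U \<inter> space \<mu>)"
  have "{x \<in> space \<mu>. \<rho> x < 0} \<in> sets \<mu>" using int by measurable
  moreover have "U \<inter> space \<mu> \<in> sets \<mu>" using U by (auto simp: \<mu>_props sets_restrict_space Int_commute)
  ultimately have A: "A \<in> sets \<mu>" unfolding A_def by (rule sets.Int)
  then have A': "A \<in> borel_sphere" by (simp add: \<mu>_props)
  have i: "integrable \<mu> (\<lambda>x. - (indicator A x * \<rho> x))" using indicator_integrable[OF A' int] by simp
  have "(\<integral>x. indicator A x * \<rho> x \<partial>\<mu>) \<ge> 0" using nn[OF A'] d A' by (auto simp: has_density_def A_def)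
  moreover have pos: "AE x in \<mu>. 0 \<le> - (indicator A x * \<rho> x)" by (rule AE_I2) (auto simp: A_def indicator_def)
  moreover have "(\<integral>x. - (indicator A x * \<rho> x) \<partial>\<mu>) \<ge> 0" using pos by (rule integral_nonneg_AE)
  ultimately have "(\<integral>x. - (indicator A x * \<rho> x) \<partial>\<mu>) = 0" by simp
  then have "AE x in \<mu>. - (indicator A x * \<rho> x) = 0" using integral_nonneg_eq_0_iff_AE[OF i pos] by simp
  then show ?thesis by (rule AE_mp) (rule AE_I2, auto simp: A_def indicator_def)
qed

text \<open>Near a point of positive definiteness \<open>f\<close> lies above its tangent planes, so
  \<open>measure_S_local_dominance\<close> makes the signed measure nonnegative on a small ball.
  Countably many of the resulting open sets suffice by the Lindeloef property, which leaves a single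
  null set.\<close>

lemma density_nonneg_posdef:
  assumes C2: "C2_sphere f" and d: "has_density f \<rho>"
  shows "AE x in \<mu>. posdef_at f x \<longrightarrow> \<rho> x \<ge> 0"
proof -
  obtain K K' where K: "convex_body K" "convex_body K'" "\<And>x. norm x = 1 \<Longrightarrow> f x = support_fun K x - support_fun K' x"
    using dsfE[OF supp_diff_if_C2_sphere[OF C2]] by blast
  note hh = has_hess_if_C2_sphere[OF C2]
  define \<F> where "\<F> = {U. open U \<and> (\<forall>A\<in>borel_sphere. A \<subseteq> U \<longrightarrow> signed_S f A \<ge> 0)}"
  have loc: "\<exists>U\<in>\<F>. x0 \<in> U" if x0: "norm x0 = 1" and pd: "posdef_at f x0" for x0
  proof -
    obtain r where r: "r > 0" "\<And>y z. y \<in> sphere 0 1 \<inter> cball x0 r \<Longrightarrow> z \<in> sphere 0 1 \<inter> cball x0 r \<Longrightarrow>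
        grad (hom_ext f) z \<bullet> y \<le> f y"
      using posdef_at_local_support[OF C2 x0 pd] by blast
    have "signed_S f A \<ge> 0" if A: "A \<in> borel_sphere" "A \<subseteq> ball x0 r" for A
    proof -
      have "measure (S K') A \<le> measure (S K) A"
      proof (rule measure_S_local_dominance[OF K(1,2) x0 r(1) _ _ _ A])
        show "continuous_on (sphere 0 1 \<inter> cball x0 r) (grad (hom_ext f))"
          by (rule continuous_on_subset[OF has_hess_continuous(2)[OF hh]]) auto
        show "grad (hom_ext f) z \<bullet> y \<le> support_fun K y - support_fun K' y"
          if "y \<in> sphere 0 1 \<inter> cball x0 r" "z \<in> sphere 0 1 \<inter> cball x0 r" for y z
          using r(2)[OF that] K(3)[of y] that by simp
        show "grad (hom_ext f) y \<bullet> y = support_fun K y - support_fun K' y" if "y \<in> sphere 0 1 \<inter> cball x0 r" for y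
        proof -
          have "y \<noteq> 0" "norm y = 1" using that by auto
          then show ?thesis using euler_grad[OF C2, of y] hom_ext_sphere[of y f] K(3)[of y] by simp
        qed
      qed
      then show ?thesis using signed_S_eq[OF A(1) K] by simp
    qed
    then have "ball x0 r \<in> \<F>" by (auto simp: \<F>_def)
    then show ?thesis using r(1) by (intro bexI[of _ "ball x0 r"]) auto
  qed
  obtain \<F>' where F': "\<F>' \<subseteq> \<F>" "countable \<F>'" "\<Union>\<F>' = \<Union>\<F>"
    using Lindelof[of \<F>] by (auto simp: \<F>_def)
  have "AE x in \<mu>. \<forall>U\<in>\<F>'. x \<in> U \<longrightarrow> \<rho> x \<ge> 0"
    using F'(1) by (subst AE_ball_countable[OF F'(2)]) (auto simp: \<F>_def intro!: density_nonneg_on_open[OF d])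
  then show ?thesis
  proof (rule AE_mp, intro AE_I2 impI)
    fix x assume x: "x \<in> space \<mu>" "\<forall>U\<in>\<F>'. x \<in> U \<longrightarrow> \<rho> x \<ge> 0" "posdef_at f x"
    then obtain U where "U \<in> \<F>" "x \<in> U" using loc[of x] by (auto simp: \<mu>_props(2))
    then have "x \<in> \<Union>\<F>'" using F'(3) by blast
    then show "\<rho> x \<ge> 0" using x(2) by blast
  qed
qed

definition coord_density :: "'n \<Rightarrow> 'n \<Rightarrow> real^'n \<Rightarrow> real" where
  "coord_density i j = (SOME \<rho>. has_density (\<lambda>x. x $ i * x $ j) \<rho>)"

lemma has_density_coord: "has_density (\<lambda>x. x $ i * x $ j) (coord_density i j)"
proof -
  obtain \<rho> where "mixed_density (\<lambda>x. x $ i * x $ j) \<rho>"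
    by (rule ex_density[OF C2_sphere_coord])
  then have "has_density (\<lambda>x. x $ i * x $ j) \<rho>" by (rule mixed_densityD(1))
  then show ?thesis unfolding coord_density_def
    by (rule someI[where P="has_density (\<lambda>x. x $ i * x $ j)"])
qed

lemma coord_density_commute: "coord_density i j = coord_density j i"
  by (simp add: coord_density_def mult.commute)

lemma has_density_qf: "has_density (qf M) (\<lambda>x. pairing M (\<lambda>i j. coord_density i j x))"
proof -
  have "qf M = (\<lambda>x. \<Sum>i\<in>UNIV. \<Sum>j\<in>UNIV. M $ i $ j * (x $ i * x $ j))" by (rule ext) (rule qf_eq_sum)
  then show ?thesis
    unfolding pairing_def
    by (auto intro!: has_density_sum has_density_scale has_density_coord)
qed

text \<open>Quantifying over all quadratic forms at once requires a countable dense set of them.\<close>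
lemma density_pairing_nonneg:
  fixes f :: "real^'n \<Rightarrow> real"
  assumes C2: "C2_sphere f" and d: "has_density f \<rho>"
  shows "AE x in \<mu>. \<forall>M. \<forall>b\<in>{-1,0,1::real}.
    (\<forall>v. v \<bullet> x = 0 \<longrightarrow> 2 * (v \<bullet> (M *v v)) - qf M x * (norm v)\<^sup>2 + b * (v \<bullet> (D2 f x *v v)) \<ge> 0) \<longrightarrow>
    pairing M (\<lambda>i j. coord_density i j x) + b * \<rho> x \<ge> 0"
proof -
  obtain D :: "(real^'n^'n) set" where D: "countable D" "\<And>X. open X \<Longrightarrow> X \<noteq> {} \<Longrightarrow> \<exists>d\<in>D. d \<in> X"
    using countable_dense_exists[where 'a="real^'n^'n"] by blast
  \<comment> \<open>The constant 1/(k+1) turns semidefiniteness into strict positivity and leaves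
    room for replacing \<open>M\<close> by a nearby element of the dense set. The value b = 0 serves
    quadratic forms alone; b = 1 and b = -1 give the two-sided comparison with
    \<open>f\<close>.\<close>
  define \<phi> where "\<phi> M b k = (\<lambda>x::real^'n. qf M x + (b * f x + 1 / Suc k))" for M b and k :: nat
  let ?R = "\<lambda>M x. pairing M (\<lambda>i j. coord_density i j x)"
  have C2\<phi>: "C2_sphere (\<phi> M b k)" for M b k
    unfolding \<phi>_def by (intro C2_sphere_add C2_sphere_scale C2_sphere_qf C2_sphere_const C2)
  have "has_density (\<phi> M b k) (\<lambda>x. ?R M x + (b * \<rho> x + 1 / Suc k))" for M b k
    unfolding \<phi>_def by (intro has_density_add has_density_qf has_density_scale d has_density_const)
  then have "AE x in \<mu>. posdef_at (\<phi> M b k) x \<longrightarrow> ?R M x + (b * \<rho> x + 1 / Suc k) \<ge> 0" for M b k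
    by (rule density_nonneg_posdef[OF C2\<phi>])
  then have "AE x in \<mu>. \<forall>M\<in>D. \<forall>b\<in>{-1,0,1}. \<forall>k. posdef_at (\<phi> M b k) x \<longrightarrow> ?R M x + (b * \<rho> x + 1 / Suc k) \<ge> 0"
    by (subst AE_ball_countable[OF D(1)], intro ballI, subst AE_ball_countable) (auto simp: AE_all_countable)
  then show ?thesis
  proof (rule AE_mp, intro AE_I2 impI allI ballI)
    fix x M and b :: real
    assume "x \<in> space \<mu>" and b: "b \<in> {-1,0,1}"
      and *: "\<forall>M\<in>D. \<forall>b\<in>{-1,0,1}. \<forall>k. posdef_at (\<phi> M b k) x \<longrightarrow> ?R M x + (b * \<rho> x + 1 / Suc k) \<ge> 0"
      and nn: "\<forall>v. v \<bullet> x = 0 \<longrightarrow> 2 * (v \<bullet> (M *v v)) - qf M x * (norm v)\<^sup>2 + b * (v \<bullet> (D2 f x *v v)) \<ge> 0"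
    then have x: "norm x = 1" "x \<noteq> 0" by (auto simp: \<mu>_props(2))
    \<comment> \<open>Replacing \<open>M\<close> costs at most three times the distance, two from
      the term 2 v . M v and one from \<open>qf M x\<close>; the factor 4 keeps this below
      1/(k+1).\<close>
    have "\<exists>M'\<in>D. dist M' M < 1 / (4 * Suc k)" for k :: nat
      using D(2)[of "ball M (1 / (4 * Suc k))"] by (auto simp: dist_commute simp del: of_nat_Suc)
    then obtain N where N: "\<And>k. N k \<in> D" "\<And>k::nat. dist (N k) M < 1 / (4 * Suc k)" by metis
    have "posdef_at (\<phi> (N k) b k) x" for k
      unfolding posdef_at_def
    proof (intro allI impI)
      fix v assume v: "v \<noteq> 0" "v \<bullet> x = 0"
      let ?e = "norm (N k - M)"
      have "D2 (\<phi> (N k) b k) x = D2 (qf (N k)) x + (b *\<^sub>R D2 f x + D2 (\<lambda>_. 1 / Suc k) x)"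
        unfolding \<phi>_def by (simp add: C2_sphere_add C2_sphere_scale C2_sphere_qf(1) C2_sphere_const(1) C2 x del: of_nat_Suc)
      then have eq: "v \<bullet> (D2 (\<phi> (N k) b k) x *v v)
          = 2 * (v \<bullet> (N k *v v)) - qf (N k) x * (norm v)\<^sup>2 + (b * (v \<bullet> (D2 f x *v v)) + 1 / Suc k * (norm v)\<^sup>2)"
        using C2_sphere_qf(2)[OF x(1) v(2), of "N k"] C2_sphere_const(2)[OF x(1) v(2), of "1 / Suc k"]
        by (simp add: matrix_vector_mult_add_rdistrib inner_add_right del: of_nat_Suc flip: scaleR_matrix_vector_assoc)
      have 1: "v \<bullet> (N k *v v) \<ge> v \<bullet> (M *v v) - ?e * (norm v)\<^sup>2"
        using abs_quadratic_le[of v "N k - M"] unfolding matrix_vector_mult_diff_rdistrib inner_diff_right by linarith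
      have "\<bar>qf (N k) x - qf M x\<bar> \<le> ?e"
        using abs_qf_le[of "N k - M" x] x(1) by (simp add: qf_def matrix_vector_mult_diff_rdistrib inner_diff_right)
      then have "qf (N k) x \<le> qf M x + ?e" by linarith
      then have 2: "qf (N k) x * (norm v)\<^sup>2 \<le> (qf M x + ?e) * (norm v)\<^sup>2" by (rule mult_right_mono) simp
      have "?e < 1 / (4 * Suc k)" using N(2)[of k] by (simp add: dist_norm)
      then have "3 * ?e < 1 / Suc k" by (simp add: field_simps)
      then have 3: "3 * ?e * (norm v)\<^sup>2 < 1 / Suc k * (norm v)\<^sup>2" using v(1) by (intro mult_strict_right_mono) auto
      have "2 * (v \<bullet> (M *v v)) - qf M x * (norm v)\<^sup>2 + b * (v \<bullet> (D2 f x *v v)) \<ge> 0" using nn v(2) by blast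
      then show "v \<bullet> (D2 (\<phi> (N k) b k) x *v v) > 0"
        unfolding eq using 1 2 3 by (simp add: distrib_right del: of_nat_Suc)
    qed
    then have ge: "?R (N k) x + (b * \<rho> x + 1 / Suc k) \<ge> 0" for k using * N(1) b by blast
    have lim1: "(\<lambda>k. 1 / real (Suc k)) \<longlonglongrightarrow> 0" by (rule LIMSEQ_Suc[OF lim_const_over_n])
    from lim1 have lim0: "(\<lambda>k. 1 / (4 * real (Suc k))) \<longlonglongrightarrow> 0"
      using tendsto_mult_right_zero[of "\<lambda>k. 1 / real (Suc k)" sequentially "1/4"] by simp
    have "\<forall>k. dist (N k) M \<le> 1 / (4 * real (Suc k))" 
    proof
      show "dist (N k) M \<le> 1 / (4 * real (Suc k))" for k using N(2)[of k] by simp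
    qed
    then have "(\<lambda>k. dist (N k) M) \<longlonglongrightarrow> 0"
      by (intro tendsto_sandwich[OF _ always_eventually tendsto_const lim0]) simp_all
    then have "N \<longlonglongrightarrow> M" by (rule iffD2[OF tendsto_dist_iff])
    then have "(\<lambda>k. ?R (N k) x) \<longlonglongrightarrow> ?R M x"
      unfolding pairing_def by (intro tendsto_intros)
    then have "(\<lambda>k. ?R (N k) x + (b * \<rho> x + 1 / Suc k)) \<longlonglongrightarrow> ?R M x + (b * \<rho> x + 0)"
      by (intro tendsto_add tendsto_const lim1)
    then show "?R M x + b * \<rho> x \<ge> 0"
      using LIMSEQ_le_const[of _ "?R M x + (b * \<rho> x + 0)" 0] ge by auto
  qed
qed

definition weight :: "real^'n \<Rightarrow> real^'n^'n" where
  "weight x = (\<chi> i j. (coord_density i j x + x $ i * x $ j) / 2)"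

lemma transpose_weight: "transpose (weight x) = weight x"
  using coord_density_commute by (simp add: weight_def transpose_def vec_eq_iff mult.commute)

text \<open>Translates between traces and \<open>pairing\<close>. The term x . H x comes from the
  summand x_i x_j of \<open>weight\<close> and vanishes for Hessians \<open>D2 f x\<close>.\<close>

lemma trace_weight_mult:
  "trace (weight x ** H) = (pairing H (\<lambda>i j. coord_density i j x) + x \<bullet> (H *v x)) / 2"
proof -
  have "trace (weight x ** H) = trace (H ** weight x)" by (rule trace_mul_sym)
  also have "\<dots> = (\<Sum>i\<in>UNIV. \<Sum>j\<in>UNIV. H $ i $ j * coord_density i j x / 2 + x $ i * (H $ i $ j * x $ j) / 2)"
    unfolding trace_matrix_mult
  proof (intro sum.cong refl)
    fix i j
    show "H $ i $ j * weight x $ j $ i = H $ i $ j * coord_density i j x / 2 + x $ i * (H $ i $ j * x $ j) / 2"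
      using coord_density_commute[of j i] by (simp add: weight_def field_simps)
  qed
  also have "\<dots> = (pairing H (\<lambda>i j. coord_density i j x) + x \<bullet> (H *v x)) / 2"
    by (simp add: pairing_def inner_vec_def matrix_vector_mult_def sum.distrib sum_divide_distrib sum_distrib_left add_divide_distrib)
  finally show ?thesis .
qed

lemma quadratic_weight: "v \<bullet> (weight x *v v) = (pairing (outer2 v v) (\<lambda>i j. coord_density i j x) + (x \<bullet> v)\<^sup>2) / 2"
  using trace_mult_outer2[of "weight x" v v] 
  by (simp add: trace_weight_mult outer2_quadratic power2_eq_square inner_commute[of x])

text \<open>Each property comes from quadratic forms whose \<open>D2\<close> at \<open>x\<close> is
  known, compared with the constant 1, whose density is 1. A form with vanishing \<open>D2\<close>
  at \<open>x\<close> satisfies the inequality with both signs, so its density vanishes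
  there.\<close>

lemma AE_orthogonal_weight: "AE x in \<mu>. orthogonal_weight x (weight x)"
proof -
  have "AE x in \<mu>. \<forall>M. \<forall>b\<in>{-1,0,1::real}.
    (\<forall>v. v \<bullet> x = 0 \<longrightarrow> 2 * (v \<bullet> (M *v v)) - qf M x * (norm v)\<^sup>2 + b * (v \<bullet> (D2 (\<lambda>_. 1) x *v v)) \<ge> 0) \<longrightarrow>
    pairing M (\<lambda>i j. coord_density i j x) + b * 1 \<ge> 0"
    by (rule density_pairing_nonneg[OF C2_sphere_const(1) has_density_const])
  then show ?thesis
  proof (rule AE_mp, intro AE_I2 impI)
    fix x assume "x \<in> space \<mu>"
    then have x: "norm x = 1" "x \<bullet> x = 1" by (auto simp: \<mu>_props(2) norm_eq_1)
    let ?R = "\<lambda>M. pairing M (\<lambda>i j. coord_density i j x)"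
    assume "\<forall>M. \<forall>b\<in>{-1,0,1::real}.
      (\<forall>v. v \<bullet> x = 0 \<longrightarrow> 2 * (v \<bullet> (M *v v)) - qf M x * (norm v)\<^sup>2 + b * (v \<bullet> (D2 (\<lambda>_. 1) x *v v)) \<ge> 0) \<longrightarrow>
      ?R M + b * 1 \<ge> 0"
    then have P: "?R M + b \<ge> 0" if "b \<in> {-1,0,1}"
      "\<And>v. v \<bullet> x = 0 \<Longrightarrow> 2 * (v \<bullet> (M *v v)) - qf M x * (norm v)\<^sup>2 + b * (norm v)\<^sup>2 \<ge> 0" for M b
      using that C2_sphere_const(2)[OF x(1), of _ 1] by force
    note neg = matrix_vector_mult_minus
    \<comment> \<open>\<open>qf (mat 1)\<close> is 1 on the sphere, so \<open>mat 1\<close> with b =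
      -1 gives equality in the hypothesis of \<open>P\<close>, and likewise with both signs
      reversed.\<close>
    have tr: "?R (mat 1) = 1"
    proof -
      have "?R (mat 1) + (-1) \<ge> 0" by (rule P) (auto simp: qf_def x power2_norm_eq_inner)
      moreover have "?R (- mat 1) + 1 \<ge> 0" by (rule P) (auto simp: qf_def x power2_norm_eq_inner neg)
      moreover have "?R (- mat 1) = - ?R (mat 1)" using pairing_scaleR[of "-1" "mat 1"] by simp
      ultimately show ?thesis by simp
    qed
    have ker: "weight x *v x = 0"
    proof -
      have "(weight x *v x) $ i = 0" for i
      proof -
        \<comment> \<open>In the variable y this is the form y_i (x . y) + x_i |y|^2. At y = x its
          \<open>D2\<close> on tangent vectors is 2 x_i |v|^2 - 2 x_i |v|^2 = 0, and the vanishing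
          of its density is the \<open>i\<close>-th component of the kernel equation.\<close>
        define M where "M = axis i x + (x $ i) *\<^sub>R (mat 1 :: real^'n^'n)"
        have ax: "axis i x *v v = axis i (x \<bullet> v)" for v :: "real^'n"
          by (simp add: matrix_vector_mult_def axis_def vec_eq_iff inner_vec_def)
        have M: "M *v v = axis i (x \<bullet> v) + (x $ i) *\<^sub>R v" for v
          by (simp add: M_def matrix_vector_mult_add_rdistrib ax flip: scaleR_matrix_vector_assoc)
        have q: "qf M x = 2 * x $ i" "qf (- M) x = - (2 * x $ i)"
          by (simp_all add: qf_def neg M inner_add_right inner_diff_right inner_axis x)
        have v: "v \<bullet> (M *v v) = x $ i * (norm v)\<^sup>2" "v \<bullet> (- M *v v) = - (x $ i * (norm v)\<^sup>2)" if "v \<bullet> x = 0" for v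
          using that by (simp_all add: M neg inner_add_right inner_diff_right inner_axis inner_commute[of x] power2_norm_eq_inner)
        have "?R M + 0 \<ge> 0" "?R (- M) + 0 \<ge> 0" by (rule P; simp add: q v)+
        moreover have "?R (- M) = - ?R M" using pairing_scaleR[of "-1" M] by simp
        ultimately have "?R M = 0" by simp
        then have "(\<Sum>j\<in>UNIV. x $ j * coord_density i j x) + x $ i = 0"
          by (simp add: M_def pairing_add pairing_scaleR pairing_axis tr)
        moreover have "(weight x *v x) $ i = ((\<Sum>j\<in>UNIV. x $ j * coord_density i j x) + x $ i * (x \<bullet> x)) / 2"
          by (simp add: weight_def matrix_vector_mult_def inner_vec_def sum_distrib_left sum.distrib sum_divide_distrib
              add_divide_distrib distrib_left distrib_right mult_ac)
        ultimately show ?thesis by (simp add: x)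
      qed
      then show ?thesis by (simp add: vec_eq_iff)
    qed
    have psd: "0 \<le> v \<bullet> (weight x *v v)" for v
    proof -
      define w where "w = v - (v \<bullet> x) *\<^sub>R x"
      have wx: "w \<bullet> x = 0" by (simp add: w_def inner_diff_left x)
      have vw: "v = w + (v \<bullet> x) *\<^sub>R x" by (simp add: w_def)
      have "x \<bullet> (weight x *v w) = 0"
        using symmetric_inner_swap[OF transpose_weight, of x x w] ker by simp
      then have "v \<bullet> (weight x *v v) = w \<bullet> (weight x *v w)"
        by (subst (1 2) vw) (simp add: matrix_vector_right_distrib matrix_vector_mult_scaleR ker inner_add_left)
      also have "\<dots> = ?R (outer2 w w) / 2" using wx by (simp add: quadratic_weight inner_commute[of x])
      finally have "v \<bullet> (weight x *v v) = ?R (outer2 w w) / 2" .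
      \<comment> \<open>The form (w . y)^2 vanishes at y = x, so its \<open>D2\<close> there is 2 (w
        . v)^2 on tangent vectors.\<close>
      moreover have "?R (outer2 w w) + 0 \<ge> 0"
      proof (rule P)
        show "2 * (v \<bullet> (outer2 w w *v v)) - qf (outer2 w w) x * (norm v)\<^sup>2 + 0 * (norm v)\<^sup>2 \<ge> 0" for v
          using wx by (simp add: qf_def outer2_quadratic)
      qed simp
      ultimately show ?thesis by simp
    qed
    have "trace (weight x) = 1"
      using trace_weight_mult[of x "mat 1"] by (simp add: tr x)
    then show "orthogonal_weight x (weight x)"
      using transpose_weight ker psd by (simp add: orthogonal_weight_def)
  qed
qed

text \<open>At the given \<open>x\<close> the function \<open>f\<close> is compared from both sides
  with a quadratic form having the same tangential \<open>D2\<close>. The positivity statement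
  covers all matrices at once outside one null set, so the form may depend on
  \<open>x\<close>.\<close>

lemma AE_density_eq_trace:
  assumes C2: "C2_sphere f" and d: "has_density f \<rho>"
  shows "AE x in \<mu>. \<rho> x = trace (weight x ** D2 f x)"
  using density_pairing_nonneg[OF C2 d]
proof (rule AE_mp, intro AE_I2 impI)
  fix x assume "x \<in> space \<mu>"
  then have x: "norm x = 1" "x \<noteq> 0" by (auto simp: \<mu>_props(2))
  let ?R = "\<lambda>M. pairing M (\<lambda>i j. coord_density i j x)"
  assume P: "\<forall>M. \<forall>b\<in>{-1,0,1::real}.
    (\<forall>v. v \<bullet> x = 0 \<longrightarrow> 2 * (v \<bullet> (M *v v)) - qf M x * (norm v)\<^sup>2 + b * (v \<bullet> (D2 f x *v v)) \<ge> 0) \<longrightarrow>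
    ?R M + b * \<rho> x \<ge> 0"
  \<comment> \<open>One factor 1/2 symmetrises, the other cancels the 2 in the \<open>D2\<close> of
    a quadratic form. Since \<open>D2 f x\<close> annihilates \<open>x\<close>,
    \<open>qf M x\<close> vanishes and adds no correction.\<close>
  define M where "M = (1 / 4) *\<^sub>R (D2 f x + transpose (D2 f x))"
  have M: "v \<bullet> (M *v v) = v \<bullet> (D2 f x *v v) / 2" for v
  proof -
    have "v \<bullet> (transpose (D2 f x) *v v) = v \<bullet> (D2 f x *v v)"
      by (metis inner_commute transpose_matrix_vector vector_matrix_inner)
    then show ?thesis
      by (simp add: M_def matrix_vector_mult_add_rdistrib inner_add_right flip: scaleR_matrix_vector_assoc)
  qed
  have neg: "v \<bullet> (- M *v v) = - (v \<bullet> (D2 f x *v v) / 2)" for v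
    using M[of v] by (simp add: matrix_vector_mult_minus)
  have q: "qf M x = 0" "qf (- M) x = 0"
    using M[of x] neg[of x] by (simp_all add: qf_def D2_right_zero[OF C2 x(2)])
  have "?R M + (-1) * \<rho> x \<ge> 0" "?R (- M) + 1 * \<rho> x \<ge> 0"
    by (rule P[rule_format]; simp add: q M neg)+
  moreover have "?R (- M) = - ?R M" using pairing_scaleR[of "-1" M] by simp
  moreover have "?R M = ?R (D2 f x) / 2"
    using pairing_transpose[of "\<lambda>i j. coord_density i j x" "D2 f x"] coord_density_commute
    by (simp add: M_def pairing_scaleR pairing_add)
  ultimately have "\<rho> x = ?R (D2 f x) / 2" by simp
  then show "\<rho> x = trace (weight x ** D2 f x)"
    by (simp add: trace_weight_mult D2_right_zero[OF C2 x(2)])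
qed

lemma measurable_sphere: "continuous_on (sphere 0 1) h \<Longrightarrow> h \<in> borel_measurable \<mu>"
  using borel_measurable_continuous_on_restrict measurable_cong_sets[OF \<mu>_props(3) refl] by blast

lemma measurable_weight: "weight \<in> borel_measurable \<mu>"
proof (rule borel_measurable_matrixI)
  fix i j
  have [measurable]: "coord_density i j \<in> borel_measurable \<mu>"
    
    using has_density_coord[of i j] unfolding has_density_def by (intro borel_measurable_integrable) blast
  have [measurable]: "(\<lambda>x. x $ k) \<in> borel_measurable \<mu>" for k
    by (intro measurable_sphere continuous_intros)
  show "(\<lambda>x. weight x $ i $ j) \<in> borel_measurable \<mu>" unfolding weight_def by simp
qed

text \<open>On the exceptional null set \<open>weight\<close> is replaced by the normalised
  projection, so that the pointwise properties hold everywhere while the almost-everywhere formula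
  is unaffected.\<close>

lemma ex_orthogonal_weight:
  obtains A where "A \<in> borel_measurable \<mu>" "\<And>x. norm x = 1 \<Longrightarrow> orthogonal_weight x (A x)"
    "\<And>f \<rho>. C2_sphere f \<Longrightarrow> has_density f \<rho> \<Longrightarrow> AE x in \<mu>. \<rho> x = trace (A x ** D2 f x)"
proof -
  obtain N where N: "{x \<in> space \<mu>. \<not> orthogonal_weight x (weight x)} \<subseteq> N" "emeasure \<mu> N = 0" "N \<in> sets \<mu>"
    using AE_orthogonal_weight by (rule AE_E)
  define P where "P x = (1 / (real CARD('n) - 1)) *\<^sub>R (mat 1 - outer2 x x)" for x :: "real^'n"
  define A where "A x = (if x \<in> N then P x else weight x)" for x
  have "P \<in> borel_measurable \<mu>"
    unfolding P_def outer2_def by (intro measurable_sphere continuous_intros)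
  then have "A \<in> borel_measurable \<mu>"
    unfolding A_def using N(3) measurable_weight by (intro measurable_If_set) auto
  moreover have "orthogonal_weight x (A x)" if "norm x = 1" for x
    using N(1) orthogonal_weight_projection[OF that] that len
    by (auto simp: A_def P_def \<mu>_props(2))
  moreover have "AE x in \<mu>. \<rho> x = trace (A x ** D2 f x)" if "C2_sphere f" "has_density f \<rho>" for f \<rho>
  proof -
    have "AE x in \<mu>. x \<notin> N" using N by (intro AE_not_in) (auto simp: null_sets_def)
    then show ?thesis using AE_density_eq_trace[OF that] by eventually_elim (simp add: A_def)
  qed
  ultimately show thesis by (rule that)
qed

lemma measurable_trace_D2:
  assumes "A \<in> borel_measurable \<mu>" "C2_sphere f"
  shows "(\<lambda>x. trace (A x ** D2 f x)) \<in> borel_measurable \<mu>"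
proof -
  have "continuous_on (sphere 0 1) (D2 f)"
    by (rule continuous_on_subset[OF has_hessD(3)[OF has_hess_if_C2_sphere[OF assms(2)]]]) auto
  then have [measurable]: "(\<lambda>x. D2 f x $ i $ j) \<in> borel_measurable \<mu>" for i j
    by (intro measurable_sphere continuous_intros)
  have [measurable]: "(\<lambda>x. A x $ i $ j) \<in> borel_measurable \<mu>" for i j
    using assms(1) by (intro borel_measurable_continuous_on[where f="\<lambda>B. B $ i $ j"] continuous_intros)
  show ?thesis unfolding trace_matrix_mult by measurable
qed

section \<open>Symmetry and the quadratic form\<close>

lemma integrable_supp_diff_mult:
  assumes f: "supp_diff f" and g: "integrable \<mu> g"
  shows "integrable \<mu> (\<lambda>x. f x * g x :: real)"
proof -
  have "bounded (f ` sphere 0 1)" by (intro compact_imp_bounded compact_continuous_image supp_diff_continuous f) simp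
  then obtain B where "\<forall>x\<in>sphere 0 1. \<bar>f x\<bar> \<le> B" by (auto simp: bounded_iff)
  then have "\<bar>f x\<bar> \<le> \<bar>B\<bar>" if "x \<in> space \<mu>" for x using that unfolding \<mu>_props(2) by fastforce
  then have "AE x in \<mu>. norm (f x * g x) \<le> norm (B * g x)"
    by (intro AE_I2) (simp add: abs_mult mult_right_mono)
  moreover have "(\<lambda>x. f x * g x) \<in> borel_measurable \<mu>"
    using measurable_sphere[OF supp_diff_continuous[OF f]] g by measurable
  ultimately show ?thesis using integrable_mult_right[OF g, of B] by (rule_tac Bochner_Integration.integrable_bound)
qed

text \<open>Both integrals are n times the mixed volume of \<open>f\<close>, \<open>g\<close> and
  \<open>Cs\<close>, expanded over representing bodies; symmetry of mixed volumes exchanges the two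
  leading entries.\<close>

lemma density_symmetric:
  assumes f: "supp_diff f" and g: "supp_diff g" and fd: "mixed_density f \<rho>" and gd: "mixed_density g \<sigma>"
  shows "(\<integral>x. f x * \<sigma> x \<partial>\<mu>) = (\<integral>x. g x * \<rho> x \<partial>\<mu>)"
proof -
  obtain K L where 1: "convex_body K" "convex_body L" "\<And>x. norm x = 1 \<Longrightarrow> f x = support_fun K x - support_fun L x"
    using dsfE[OF f] by blast
  obtain K' L' where 2: "convex_body K'" "convex_body L'" "\<And>x. norm x = 1 \<Longrightarrow> g x = support_fun K' x - support_fun L' x"
    using dsfE[OF g] by blast
  note i = integral_S[where f=f, OF _ 1] and j = integral_S[where f=g, OF _ 2]
  have "(\<integral>x. f x * \<sigma> x \<partial>\<mu>) = real CARD('n) * ((mixed_volume (K # K' # Cs) - mixed_volume (L # K' # Cs))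
      - (mixed_volume (K # L' # Cs) - mixed_volume (L # L' # Cs)))"
    using mixed_densityD(2)[OF gd 2 f] i[OF 2(1)] i[OF 2(2)] by (simp only: right_diff_distrib)
  moreover have "(\<integral>x. g x * \<rho> x \<partial>\<mu>) = real CARD('n) * ((mixed_volume (K' # K # Cs) - mixed_volume (L' # K # Cs))
      - (mixed_volume (K' # L # Cs) - mixed_volume (L' # L # Cs)))"
    using mixed_densityD(2)[OF fd 1 g] j[OF 1(1)] j[OF 1(2)] by (simp only: right_diff_distrib)
  ultimately show ?thesis
    by (simp add: mixed_volume_swap[of K'] mixed_volume_swap[of L'])
qed

text \<open>With densities rho, sigma, tau of f, g and f g, the product formula gives f g - <grad f,
  A grad g> = (f g + f sigma + g rho - tau)/2 almost everywhere. The integrals of f sigma and g rho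
  agree by symmetry, and that of tau equals that of f g by symmetry with the constant 1, so the
  integral of f sigma remains.\<close>

lemma integral_sgrad_weight:
  assumes A: "\<And>x. norm x = 1 \<Longrightarrow> orthogonal_weight x (A x)"
      "\<And>f \<rho>. C2_sphere f \<Longrightarrow> has_density f \<rho> \<Longrightarrow>
        AE x in \<mu>. \<rho> x = trace (A x ** D2 f x)"
      "A \<in> borel_measurable \<mu>"
    and f: "C2_sphere f" and g: "C2_sphere g" and K: "convex_body K" "convex_body K'"
      "\<And>x. norm x = 1 \<Longrightarrow> g x = support_fun K x - support_fun K' x"
  shows "integrable \<mu> (\<lambda>x. f x * g x - sgrad f x \<bullet> (A x *v sgrad g x))"
    and "(\<integral>x. f x \<partial>S K) - (\<integral>x. f x \<partial>S K')
      = (\<integral>x. f x * g x - sgrad f x \<bullet> (A x *v sgrad g x) \<partial>\<mu>)"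
proof -
  note supp_diff = supp_diff_if_C2_sphere[OF f] supp_diff_if_C2_sphere[OF g] supp_diff_if_C2_sphere[OF C2_sphere_mult(1)[OF f g]]
  obtain \<rho> where \<rho>': "mixed_density f \<rho>" by (rule ex_density[OF f])
  obtain \<sigma> where \<sigma>': "mixed_density g \<sigma>" by (rule ex_density[OF g])
  obtain \<tau> where \<tau>': "mixed_density (\<lambda>x. f x * g x) \<tau>"
    by (rule ex_density[OF C2_sphere_mult(1)[OF f g]])
  note \<rho> = mixed_densityD(1)[OF \<rho>'] and \<sigma> = mixed_densityD(1)[OF \<sigma>']
    and \<tau> = mixed_densityD(1)[OF \<tau>']
  have sym: "(\<integral>x. f x * \<sigma> x \<partial>\<mu>) = (\<integral>x. g x * \<rho> x \<partial>\<mu>)"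
    by (rule density_symmetric[OF supp_diff(1,2) \<rho>' \<sigma>'])
  have tot: "(\<integral>x. 1 * \<tau> x \<partial>\<mu>) = (\<integral>x. f x * g x * 1 \<partial>\<mu>)"
    by (rule density_symmetric[OF supp_diff_const supp_diff(3) mixed_density_one \<tau>'])
  have int: "integrable \<mu> \<rho>" "integrable \<mu> \<sigma>" "integrable \<mu> \<tau>"
    using \<rho> \<sigma> \<tau> by (auto simp: has_density_def)
  have ints: "integrable \<mu> (\<lambda>x. f x * \<sigma> x)" "integrable \<mu> (\<lambda>x. g x * \<rho> x)" "integrable \<mu> (\<lambda>x. f x * g x)"
    using integrable_supp_diff_mult[OF supp_diff(1) int(2)] integrable_supp_diff_mult[OF supp_diff(2) int(1)] \<mu>_props(4)[OF supp_diff(3)] by auto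
  define E where "E x = f x * g x - sgrad f x \<bullet> (A x *v sgrad g x)" for x
  define E' where "E' x = (f x * g x + (f x * \<sigma> x + g x * \<rho> x) - \<tau> x) / 2" for x
  have AE: "AE x in \<mu>. E x = E' x"
    using A(2)[OF f \<rho>] A(2)[OF g \<sigma>] A(2)[OF C2_sphere_mult(1)[OF f g] \<tau>] AE_space
  proof eventually_elim
    case (elim x)
    then have x: "norm x = 1" by (simp add: \<mu>_props(2))
    show ?case
      using trace_D2_mult[OF f g x, of "A x"] A(1)[OF x] elim
      by (simp add: E_def E'_def orthogonal_weight_def field_simps)
  qed
  have E': "integrable \<mu> E'" unfolding E'_def using ints int(3) by simp
  have "trace (A x ** D2 (\<lambda>x. f x * g x) x) = f x * trace (A x ** D2 g x) + g x * trace (A x ** D2 f x) - f x * g x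
      + 2 * (sgrad f x \<bullet> (A x *v sgrad g x))" if "x \<in> space \<mu>" for x
    using trace_D2_mult[OF f g, of x "A x"] A(1)[of x] that by (simp add: \<mu>_props(2) orthogonal_weight_def)
  \<comment> \<open>This identity holds at every point of the sphere and expresses \<open>E\<close>
    through functions already known to be measurable; the identity with \<open>E'\<close> holds only
    almost everywhere.\<close>
  then have E_eq: "E x = (f x * g x + (f x * trace (A x ** D2 g x) + g x * trace (A x ** D2 f x))
      - trace (A x ** D2 (\<lambda>x. f x * g x) x)) / 2" if "x \<in> space \<mu>" for x
    using that by (simp add: E_def)
  have meas: "E \<in> borel_measurable \<mu>"
  proof (subst measurable_cong[OF E_eq])
    have [measurable]: "(\<lambda>x. trace (A x ** D2 f x)) \<in> borel_measurable \<mu>" "(\<lambda>x. trace (A x ** D2 g x)) \<in> borel_measurable \<mu>"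
      "(\<lambda>x. trace (A x ** D2 (\<lambda>x. f x * g x) x)) \<in> borel_measurable \<mu>"
      by (intro measurable_trace_D2[OF A(3)] f g C2_sphere_mult)+
    have [measurable]: "f \<in> borel_measurable \<mu>" "g \<in> borel_measurable \<mu>"
      using \<mu>_props(4)[OF supp_diff(1)] \<mu>_props(4)[OF supp_diff(2)] by auto
    show "(\<lambda>x. (f x * g x + (f x * trace (A x ** D2 g x) + g x * trace (A x ** D2 f x))
      - trace (A x ** D2 (\<lambda>x. f x * g x) x)) / 2) \<in> borel_measurable \<mu>" by measurable
  qed
  have E: "integrable \<mu> E"
    using integrable_cong_AE[OF meas _ AE] E' by blast
  then show "integrable \<mu> (\<lambda>x. f x * g x - sgrad f x \<bullet> (A x *v sgrad g x))" by (simp add: E_def[abs_def])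
  have "(\<integral>x. f x \<partial>S K) - (\<integral>x. f x \<partial>S K') = (\<integral>x. f x * \<sigma> x \<partial>\<mu>)"
    by (rule mixed_densityD(2)[OF \<sigma>' K supp_diff(1)])
  also have "\<dots> = (\<integral>x. E' x \<partial>\<mu>)"
    unfolding E'_def using ints int(3) sym tot by simp
  also have "\<dots> = (\<integral>x. E x \<partial>\<mu>)"
    using AE meas E' by (intro integral_cong_AE) auto
  finally show "(\<integral>x. f x \<partial>S K) - (\<integral>x. f x \<partial>S K')
      = (\<integral>x. f x * g x - sgrad f x \<bullet> (A x *v sgrad g x) \<partial>\<mu>)" by (simp add: E_def)
qed

text \<open>\<open>c\<close> is the normalisation of the operator and becomes the dimension n in the
  final statement.\<close>

lemma signed_density_trace:
  assumes A: "\<And>f \<rho>. C2_sphere f \<Longrightarrow> has_density f \<rho> \<Longrightarrow>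
        AE x in \<mu>. \<rho> x = trace (A x ** D2 f x)"
      "A \<in> borel_measurable \<mu>"
    and f: "C2_sphere f" and K: "convex_body K" "convex_body K'"
      "\<And>x. norm x = 1 \<Longrightarrow> f x = support_fun K x - support_fun K' x"
    and \<omega>: "\<omega> \<in> sets \<mu>"
  shows "set_integrable \<mu> \<omega> (\<lambda>x. trace (A x ** D2 f x) / c)"
    and "(measure (S K) \<omega> - measure (S K') \<omega>) / c
      = (\<integral>x\<in>\<omega>. trace (A x ** D2 f x) / c \<partial>\<mu>)"
proof -
  obtain \<rho> where "mixed_density f \<rho>" by (rule ex_density[OF f])
  then have \<rho>: "has_density f \<rho>" by (rule mixed_densityD(1))
  note AE = A(1)[OF f \<rho>]
  have i: "integrable \<mu> \<rho>" using \<rho> by (simp add: has_density_def)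
  have m: "(\<lambda>x. trace (A x ** D2 f x)) \<in> borel_measurable \<mu>" by (rule measurable_trace_D2[OF A(2) f])
  have it: "integrable \<mu> (\<lambda>x. trace (A x ** D2 f x))"
  proof -
    have "AE x in \<mu>. trace (A x ** D2 f x) = \<rho> x" using AE by eventually_elim simp
    then show ?thesis using integrable_cong_AE[OF m borel_measurable_integrable[OF i]] i by blast
  qed
  have "integrable \<mu> (\<lambda>x. indicator \<omega> x *\<^sub>R (trace (A x ** D2 f x) / c))"
    using integrable_mult_indicator[OF \<omega>, of "\<lambda>x. trace (A x ** D2 f x) / c"] it by simp
  then show "set_integrable \<mu> \<omega> (\<lambda>x. trace (A x ** D2 f x) / c)" by (simp add: set_integrable_def)
  have \<omega>': "\<omega> \<in> sets (restrict_space borel (sphere 0 1))" using \<omega> by (simp add: \<mu>_props(3))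
  have "measure (S K) \<omega> - measure (S K') \<omega> = signed_S f \<omega>"
    by (rule signed_S_eq[OF \<omega>' K, symmetric])
  also have "\<dots> = (\<integral>x. indicator \<omega> x * \<rho> x \<partial>\<mu>)" using \<rho> \<omega>' by (simp add: has_density_def)
  also have "\<dots> = (\<integral>x. indicator \<omega> x * trace (A x ** D2 f x) \<partial>\<mu>)"
  proof (rule integral_cong_AE)
    show "AE x in \<mu>. indicator \<omega> x * \<rho> x = indicator \<omega> x * trace (A x ** D2 f x)" using AE by eventually_elim simp
  qed (use i m \<omega> in measurable)
  finally show "(measure (S K) \<omega> - measure (S K') \<omega>) / c
      = (\<integral>x\<in>\<omega>. trace (A x ** D2 f x) / c \<partial>\<mu>)"
    by (simp add: set_lebesgue_integral_def)
qed

end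

text \<open>On C^2 functions the operator is 1/n times the density of S_{f,C}, and the closed form
  equals the L^2 pairing of f with the operator applied to g, that is, 1/n times the integral of f
  against S_{g,C}. Both are expressed through arbitrary pairs of representing bodies, so that
  neither depends on a choice.\<close>

theorem theorem5p13:
  fixes Cs :: "(real^'n) set list"
  assumes n3: "CARD('n) \<ge> 3"
    and lenC: "length Cs = CARD('n) - 2"
    and bodies: "\<forall>C\<in>set Cs. convex_body C"
    and nonzero: "emeasure (mixed_area_measure (cball 0 1 # Cs)) (sphere 0 1) \<noteq> 0"
  shows "\<exists>A :: real^'n \<Rightarrow> real^'n^'n.
     A \<in> borel_measurable (restrict_space borel (sphere 0 1)) \<and>
     (\<forall>x\<in>sphere 0 1. transpose (A x) = A x \<and> A x *v x = 0 \<and>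
        (\<forall>v. 0 \<le> v \<bullet> (A x *v v)) \<and> trace (A x) = 1) \<and>
     (\<forall>f K K'. C2_sphere f \<and> convex_body K \<and> convex_body K' \<and>
        (\<forall>x\<in>sphere 0 1. f x = support_fun K x - support_fun K' x) \<longrightarrow>
        (\<forall>\<omega>\<in>sets (mixed_area_measure (cball 0 1 # Cs)).
           set_integrable (mixed_area_measure (cball 0 1 # Cs)) \<omega>
              (\<lambda>x. trace (A x ** D2 f x) / real CARD('n)) \<and>
           (measure (mixed_area_measure (K # Cs)) \<omega>
              - measure (mixed_area_measure (K' # Cs)) \<omega>) / real CARD('n)
           = (\<integral>x\<in>\<omega>. trace (A x ** D2 f x) / real CARD('n)
                  \<partial>mixed_area_measure (cball 0 1 # Cs)))) \<and>
     (\<forall>f g K K'. C2_sphere f \<and> C2_sphere g \<and> convex_body K \<and> convex_body K' \<and>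
        (\<forall>x\<in>sphere 0 1. g x = support_fun K x - support_fun K' x) \<longrightarrow>
        integrable (mixed_area_measure (cball 0 1 # Cs))
           (\<lambda>x. f x * g x - sgrad f x \<bullet> (A x *v sgrad g x)) \<and>
        ((\<integral>x. f x \<partial>mixed_area_measure (K # Cs))
           - (\<integral>x. f x \<partial>mixed_area_measure (K' # Cs))) / real CARD('n)
        = (\<integral>x. f x * g x - sgrad f x \<bullet> (A x *v sgrad g x)
              \<partial>mixed_area_measure (cball 0 1 # Cs)) / real CARD('n))"
proof -
  have len: "Suc (Suc (length Cs)) = CARD('n)" using n3 lenC by simp
  have cb: "convex_body (cball (0 :: real^'n) 1)" by (simp add: convex_body_cball)
  obtain A where A: "A \<in> borel_measurable (mixed_area_measure (cball 0 1 # Cs))"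
    "\<And>x. norm x = 1 \<Longrightarrow> orthogonal_weight x (A x)"
    "\<And>f \<rho>. C2_sphere f \<Longrightarrow> has_density Cs f \<rho> \<Longrightarrow>
      AE x in mixed_area_measure (cball 0 1 # Cs). \<rho> x = trace (A x ** D2 f x)"
    by (rule ex_orthogonal_weight[OF bodies len]) (rule that)
  show ?thesis
  proof (intro exI[of _ A] conjI allI impI ballI; (elim conjE)?)
    show "A \<in> borel_measurable (restrict_space borel (sphere 0 1))"
      using A(1) measurable_cong_sets[OF S_props(3)[OF bodies len cb] refl] by blast
    fix x :: "real^'n" assume "x \<in> sphere 0 1"
    then have "orthogonal_weight x (A x)" using A(2) by simp
    then show "transpose (A x) = A x" "A x *v x = 0" "trace (A x) = 1" "\<And>v. 0 \<le> v \<bullet> (A x *v v)"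
      by (simp_all add: orthogonal_weight_def)
  next
    fix f :: "real^'n \<Rightarrow> real" and K K' \<omega>
    assume *: "C2_sphere f" "convex_body K" "convex_body K'"
      "\<forall>x\<in>sphere 0 1. f x = support_fun K x - support_fun K' x"
      "\<omega> \<in> sets (mixed_area_measure (cball 0 1 # Cs))"
    then have f: "f x = support_fun K x - support_fun K' x" if "norm x = 1" for x using that by simp
    note 1 = signed_density_trace[OF bodies len A(3,1) *(1-3) f *(5), of "real CARD('n)"]
    show "set_integrable (mixed_area_measure (cball 0 1 # Cs)) \<omega> (\<lambda>x. trace (A x ** D2 f x) / real CARD('n))"
      by (rule 1)
    show "(measure (mixed_area_measure (K # Cs)) \<omega> - measure (mixed_area_measure (K' # Cs)) \<omega>) / real CARD('n)
        = (\<integral>x\<in>\<omega>. trace (A x ** D2 f x) / real CARD('n) \<partial>mixed_area_measure (cball 0 1 # Cs))"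
      by (rule 1)
  next
    fix f g :: "real^'n \<Rightarrow> real" and K K'
    assume *: "C2_sphere f" "C2_sphere g" "convex_body K" "convex_body K'"
      "\<forall>x\<in>sphere 0 1. g x = support_fun K x - support_fun K' x"
    then have g: "g x = support_fun K x - support_fun K' x" if "norm x = 1" for x using that by simp
    note 2 = integral_sgrad_weight[OF bodies len A(2,3,1) *(1-4) g]
    show "integrable (mixed_area_measure (cball 0 1 # Cs)) (\<lambda>x. f x * g x - sgrad f x \<bullet> (A x *v sgrad g x))"
      by (rule 2)
    show "((\<integral>x. f x \<partial>mixed_area_measure (K # Cs)) - (\<integral>x. f x \<partial>mixed_area_measure (K' # Cs))) / real CARD('n)
        = (\<integral>x. f x * g x - sgrad f x \<bullet> (A x *v sgrad g x) \<partial>mixed_area_measure (cball 0 1 # Cs)) / real CARD('n)"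
      by (simp only: 2(2))
  qed
qed

end
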